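(* Let $G=\mathbb{R}^2\rtimes\mathbb{R}^+$ with right Haar measure $\rho$, let $H^1$ be the atomic Hardy space on $G$ built on Calderón–Zygmund sets, and let $\mathcal{M}$ be the heat maximal operator $\mathcal{M}f(x)=\sup_{t>0}|f\ast p_t(x)|$, $x\in G$. (i) There exists a constant $C>0$ such that for every $f\in H^1$ one has $\mathcal{M}f\in L^1$ and $$\|\mathcal{M}f\|_1\le C\,\|f\|_{H^1}.$$ (ii) The converse inequality is false: there is no constant $C>0$ such that $\|f\|_{H^1}\le C\,\|\mathcal{M}f\|_1$ for all $f\in H^1$. Moreover, there exists $f\in L^1$ with $\mathcal{M}f\in L^1$ but $f\notin H^1$.
   Context: $G=\mathbb{R}^2\rtimes\mathbb{R}^+$ is the Lie group with product $(x_1,x_2,a)\cdot(x_1',x_2',a')=(x_1+a x_1',\,x_2+a x_2',\,aa')$ and identity $e=(0,0,1)$. Points are written $x=(x_1,x_2,a)$, and $|x|=\sqrt{x_1^2+x_2^2}$. The right Haar measure is $d\rho(x)=a^{-1}\,dx_1\,dx_2\,da$ and the modular function is $\delta(x)=a^{-2}$. $L^p$ and $\|\cdot\|_p$ refer to the measure $\rho$. $G$ carries the left-invariant metric $d$ of three-dimensional hyperbolic space; with $r(x)=d(x,e)$ it is given by $\cosh r(x)=\tfrac12\left(a+a^{-1}+a^{-1}|x|^2\right)$, and $d(x,y)=r(y^{-1}x)$. A Calderón–Zygmund set is a set $R=[x_1-L/2,x_1+L/2]\times[x_2-L/2,x_2+L/2]\times[a e^{-r},a e^{r}]$, where $L>0$,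 $r>0$ and $(x_1,x_2,a)\in G$ satisfy $e^{2}a r\le L<e^{8}a r$ if $r<1$, and $a e^{2r}\le L<a e^{8r}$ if $r\ge1$. An atom is a function $A\in L^1$ supported in a Calderón–Zygmund set $R$ with $\|A\|_\infty\le\rho(R)^{-1}$ and $\int A\,d\rho=0$. $H^1$ is the space of all $f\in L^1$ that can be written $f=\sum_j\lambda_jA_j$ (convergence in $L^1$) with atoms $A_j$ and complex numbers $\lambda_j$ with $\sum_j|\lambda_j|<\infty$; $\|f\|_{H^1}$ is the infimum of $\sum_j|\lambda_j|$ over all such decompositions. Let $X_0=a\,\partial_a$, $X_1=a\,\partial_{x_1}$, $X_2=a\,\partial_{x_2}$ (left-invariant vector fields) and $\Delta=-(X_0^2+X_1^2+X_2^2)$, which is essentially selfadjoint on $L^2(\rho)$. The heat semigroup is $e^{-t\Delta}f=f\ast p_t$, where $f\ast g(x)=\int_G f(xy^{-1})g(y)\,d\rho(y)$ and the heat kernel is $$p_t(x)=\frac{1}{8\pi^{3/2}}\,\delta^{1/2}(x)\,\frac{r(x)}{\sinh r(x)}\,t^{-3/2}e^{-r(x)^2/(4t)},\qquad t>0.$$ *)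

theory Defs
  imports "HOL-Analysis.Analysis" "HOL-Probability.Essential_Supremum"
begin

(* The group has the open half-space G as its carrier inside real * real * real; the operations
   are meaningful on G only. *)

type_synonym pt = "real \<times> real \<times> real"

definition G :: "pt set" where
  "G = {(x1, x2, a). a > 0}"

fun gmult :: "pt \<Rightarrow> pt \<Rightarrow> pt" (infixl "\<cdot>" 70) where
  "gmult (x1, x2, a) (y1, y2, b) = (x1 + a * y1, x2 + a * y2, a * b)"

definition gone :: pt where
  "gone = (0, 0, 1)"

fun ginv :: "pt \<Rightarrow> pt" where
  "ginv (x1, x2, a) = (- x1 / a, - x2 / a, 1 / a)"

lemma gmult_closed: "x \<in> G \<Longrightarrow> y \<in> G \<Longrightarrow> x \<cdot> y \<in> G"
  by (auto simp: G_def)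

lemma ginv_closed: "x \<in> G \<Longrightarrow> ginv x \<in> G"
  by (auto simp: G_def)

lemma gmult_assoc: "x \<cdot> y \<cdot> z = x \<cdot> (y \<cdot> z)"
  by (cases x; cases y; cases z) (simp add: algebra_simps)

lemma gone_left: "gone \<cdot> x = x" and gone_right: "x \<cdot> gone = x"
  by (cases x; simp add: gone_def)+

lemma ginv_left: "x \<in> G \<Longrightarrow> ginv x \<cdot> x = gone" and ginv_right: "x \<in> G \<Longrightarrow> x \<cdot> ginv x = gone"
  by (auto simp: G_def gone_def)

definition rho :: "pt measure" where
  "rho = density (restrict_space lborel G) (\<lambda>(x1, x2, a). ennreal (1 / a))"

fun modular :: "pt \<Rightarrow> real" where
  "modular (x1, x2, a) = 1 / a\<^sup>2"

fun radius :: "pt \<Rightarrow> real" where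
  "radius (x1, x2, a) = arcosh ((a + 1 / a + (x1\<^sup>2 + x2\<^sup>2) / a) / 2)"

lemma cosh_radius:
  assumes "(x1, x2, a) \<in> G"
  shows "cosh (radius (x1, x2, a)) = (a + 1 / a + (x1\<^sup>2 + x2\<^sup>2) / a) / 2"
proof -
  have a: "a > 0" using assms by (simp add: G_def)
  have "0 \<le> (a - 1)\<^sup>2 / a" using a by simp
  also have "(a - 1)\<^sup>2 / a = a + 1 / a - 2"
    using a by (simp add: field_simps power2_eq_square)
  finally have "2 \<le> a + 1 / a" by simp
  moreover have "0 \<le> (x1\<^sup>2 + x2\<^sup>2) / a" using a by simp
  ultimately show ?thesis by (simp add: cosh_arcosh_real)
qed

(* At r = 0 the quotient r / sinh r is given its limit 1. *)
definition heat_kernel :: "real \<Rightarrow> pt \<Rightarrow> real" where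
  "heat_kernel t x =
     1 / (8 * pi powr (3/2)) * modular x powr (1/2)
     * (if radius x = 0 then 1 else radius x / sinh (radius x))
     * t powr (- 3/2) * exp (- (radius x)\<^sup>2 / (4 * t))"

definition convolution :: "(pt \<Rightarrow> complex) \<Rightarrow> (pt \<Rightarrow> complex) \<Rightarrow> pt \<Rightarrow> complex" (infixl "\<star>" 70) where
  "(f \<star> g) x = (\<integral>y. f (x \<cdot> ginv y) * g y \<partial>rho)"

(* The supremum may be infinite at individual points, so it is taken in ennreal. *)
definition heat_maximal :: "(pt \<Rightarrow> complex) \<Rightarrow> pt \<Rightarrow> ennreal" where
  "heat_maximal f x = (SUP t\<in>{0<..}. ennreal (cmod ((f \<star> (\<lambda>y. complex_of_real (heat_kernel t y))) x)))"

definition L1_norm :: "(pt \<Rightarrow> ennreal) \<Rightarrow> ennreal" where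
  "L1_norm g = (\<integral>\<^sup>+ x. g x \<partial>rho)"

definition in_L1 :: "(pt \<Rightarrow> ennreal) \<Rightarrow> bool" where
  "in_L1 g \<longleftrightarrow> g \<in> borel_measurable rho \<and> L1_norm g < \<infinity>"

definition CZ_set :: "pt set \<Rightarrow> bool" where
  "CZ_set R \<longleftrightarrow>
     (\<exists>x1 x2 a L r. (x1, x2, a) \<in> G \<and> L > 0 \<and> r > 0
        \<and> (r < 1 \<longrightarrow> exp 2 * a * r \<le> L \<and> L < exp 8 * a * r)
        \<and> (r \<ge> 1 \<longrightarrow> a * exp (2 * r) \<le> L \<and> L < a * exp (8 * r))
        \<and> R = {x1 - L/2 .. x1 + L/2} \<times> {x2 - L/2 .. x2 + L/2} \<times> {a * exp (- r) .. a * exp r})"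

(* Elements of L^1 are classes modulo null sets, so the support condition is an a.e. statement. *)
definition atom :: "(pt \<Rightarrow> complex) \<Rightarrow> bool" where
  "atom A \<longleftrightarrow> integrable rho A \<and> (\<integral>x. A x \<partial>rho) = 0
     \<and> (\<exists>R. CZ_set R \<and> (AE x in rho. x \<notin> R \<longrightarrow> A x = 0)
          \<and> esssup rho (\<lambda>x. ennreal (cmod (A x))) \<le> inverse (emeasure rho R))"

(* Finite sums are included, because the zero function is an atom. *)
definition atomic_decomposition ::
    "(pt \<Rightarrow> complex) \<Rightarrow> (nat \<Rightarrow> complex) \<Rightarrow> (nat \<Rightarrow> pt \<Rightarrow> complex) \<Rightarrow> bool" where
  "atomic_decomposition f l A \<longleftrightarrow>
     (\<forall>j. atom (A j)) \<and> summable (\<lambda>j. cmod (l j))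
     \<and> (\<lambda>n. \<integral>x. cmod (f x - (\<Sum>j<n. l j * A j x)) \<partial>rho) \<longlonglongrightarrow> 0"

definition H1 :: "(pt \<Rightarrow> complex) set" where
  "H1 = {f. integrable rho f \<and> (\<exists>l A. atomic_decomposition f l A)}"

definition H1_norm :: "(pt \<Rightarrow> complex) \<Rightarrow> real" where
  "H1_norm f = Inf {\<Sum>j. cmod (l j) | l A. atomic_decomposition f l A}"

end

theory Submission
  imports Defs "HOL-Probability.Distributions" "HOL-Real_Asymp.Real_Asymp"
begin

text \<open>Let \<open>E\<close> and \<open>E'\<close> be the Euclidean distances of \<open>x\<close> to \<open>z\<close> and to the reflection of \<open>z\<close> in the boundary
  plane. Then \<open>d(x, z) = 2 ln (E + E') - ln (4 a b)\<close>, where \<open>a\<close>, \<open>b\<close> are the heights of \<open>x\<close>, \<open>z\<close>, and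
  \<open>f * p\<^sub>t\<close> is given by the symmetric kernel \<open>c \<Phi>\<^sub>t(d) / (E E')\<close> with \<open>\<Phi>\<^sub>t(d) = d t\<^sup>-\<^sup>3\<^sup>/\<^sup>2 exp (- d\<^sup>2 / 4t)\<close>.
  Uniformly in \<open>t\<close> one has \<open>\<Phi>\<^sub>t(d) \<le> C d\<^sup>-\<^sup>2\<close> and \<open>\<bar>\<Phi>\<^sub>t'(d)\<bar> \<le> C d\<^sup>-\<^sup>3\<close>.

  For the bound on \<open>H\<^sup>1\<close> an atom is moved to the identity by a left translation. On a comparable
  enlargement of its support the maximal function is controlled by the sup norm, since the heat kernel
  has mass one. Far away in the horizontal directions the cancellation of the atom gains a factor
  \<open>r / d\<close>, which makes the kernel integrable; far above and far below the support the size of the kernel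
  suffices.

  For the converse, take the difference of two small bumps at horizontal distance \<open>X\<close>. Each bump has
  maximal function of size \<open>1 / (d\<^sup>2 E E')\<close>, which just fails to be integrable, and the bumps cancel beyond
  distance of order \<open>ln X\<close>; this gives norm \<open>O(sqrt (ln X))\<close>. On the other hand \<open>ln (1 + \<bar>x\<^sub>1\<bar>)\<close> has bounded mean
  oscillation on Calderon-Zygmund sets, so the \<open>H\<^sup>1\<close> norm of the difference is at least of order \<open>ln X\<close>.\<close>

section \<open>The right Haar measure\<close>

text \<open>The supremum over \<open>t\<close> is never located: bounds on the size and oscillation
  of the kernel hold uniformly in \<open>t\<close>, and only these majorants are integrated. On the
  horosphere of log-height \<open>v\<close> the integral of \<open>g(d) / (E E')\<close> equals
  \<open>pi\<close> times the integral of \<open>g\<close> from \<open>|v|\<close> to infinity. For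
  \<open>g = d^-2\<close> this is \<open>pi / |v|\<close>, which diverges logarithmically in
  \<open>v\<close>; one more power of \<open>d\<close> leaves \<open>pi / (2 v^2)\<close>. Hence a
  single gain \<open>r / d\<close> from cancellation is exactly what the positive half needs, and
  without it the loss out to distance \<open>D\<close> is only logarithmic in \<open>D\<close>. Two
  bumps at horizontal distance \<open>X\<close> have hyperbolic distance of order
  \<open>ln X\<close>, so their maximal function loses only a power of \<open>ln X\<close> below
  one, while \<open>ln (1 + |x1|)\<close> changes by about \<open>ln X\<close> between them. This
  gap refutes the converse, and any bound that is \<open>o(ln X)\<close> would do. The logarithm has
  to be truncated: atomic decompositions converge only in L1, so only bounded functions can be
  paired with them term by term. The oscillation bound does not depend on the truncation level,
  which may therefore tend to infinity.\<close>

lemma nn_integral_exp_substitution: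
  fixes f :: "real \<Rightarrow> ennreal"
  assumes [measurable]: "f \<in> borel_measurable borel"
  shows "(\<integral>\<^sup>+a. f a * (indicator {0<..} a * ennreal (1 / a)) \<partial>lborel) = (\<integral>\<^sup>+v. f (exp v) \<partial>lborel)"
proof -
  let ?w = "\<lambda>a::real. indicator {0<..} a * ennreal (1 / a)"
  \<comment> \<open>Lebesgue measure is recognised as the image of \<open>da / a\<close> under
    \<open>ln\<close> by its values on intervals, which the fundamental theorem of calculus
    supplies.\<close>
  have eq: "lborel = distr (density lborel ?w) borel ln"
  proof (rule lborel_eqI)
    fix l u :: real assume "\<And>b. b \<in> Basis \<Longrightarrow> l \<bullet> b \<le> u \<bullet> b"
    then have lu: "l \<le> u" by simp
    have "emeasure (distr (density lborel ?w) borel ln) (box l u)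
        = (\<integral>\<^sup>+a. ?w a * indicator (ln -` box l u) a \<partial>lborel)"
      using measurable_sets[of ln borel borel "box l u"]
      by (subst emeasure_distr; simp add: emeasure_density)
    also have "\<dots> = (\<integral>\<^sup>+a. ennreal (1 / a) * indicator {exp l..exp u} a \<partial>lborel)"
    proof (rule nn_integral_cong_AE)
      have "AE a in lborel. a \<noteq> exp l" "AE a in lborel. a \<noteq> exp u"
        using AE_lborel_singleton by auto
      then show "AE a in lborel. ?w a * indicator (ln -` box l u) a
          = ennreal (1 / a) * indicator {exp l..exp u} a"
      proof eventually_elim
        case (elim a)
        show ?case
        proof (cases "a > 0")
          case True
          then have "l < ln a \<longleftrightarrow> exp l < a" "ln a < u \<longleftrightarrow> a < exp u"
            by (metis exp_less_cancel_iff exp_ln)+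
          with True elim show ?thesis by (auto simp: indicator_def box_real)
        next
          case False
          then have "\<not> exp l \<le> a" using exp_gt_zero[of l] by linarith
          with False show ?thesis by (auto simp: indicator_def)
        qed
      qed
    qed
    also have "\<dots> = ln (exp u) - ln (exp l)"
    proof (rule nn_integral_FTC_Icc)
      fix a :: real assume a: "a \<in> {exp l..exp u}"
      then have "a > 0" using exp_gt_zero[of l] by (auto simp del: exp_gt_zero)
      then show "(ln has_real_derivative 1 / a) (at a)" "0 \<le> 1 / a"
        by (auto intro!: derivative_eq_intros)
    qed (use lu in auto)
    finally show "emeasure (distr (density lborel ?w) borel ln) (box l u) = ennreal (\<Prod>b\<in>Basis. (u - l) \<bullet> b)"
      by simp
  qed simp
  have "(\<integral>\<^sup>+v. f (exp v) \<partial>lborel) = (\<integral>\<^sup>+v. f (exp v) \<partial>distr (density lborel ?w) borel ln)"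
    by (subst eq) simp
  also have "\<dots> = (\<integral>\<^sup>+a. ?w a * f (exp (ln a)) \<partial>lborel)"
    by (simp add: nn_integral_distr nn_integral_density)
  also have "\<dots> = (\<integral>\<^sup>+a. f a * ?w a \<partial>lborel)"
    by (intro nn_integral_cong) (auto simp: indicator_def mult.commute)
  finally show ?thesis by simp
qed

lemma G_measurable [measurable]: "G \<in> sets borel"
proof -
  have "G = (\<lambda>z. snd (snd z)) -` {0<..} \<inter> space borel"
    by (auto simp: G_def)
  also have "\<dots> \<in> sets (borel :: pt measure)"
    by (rule measurable_sets[where A="borel"]) (auto intro!: borel_measurable_continuous_onI continuous_intros)
  finally show ?thesis .
qed

lemma space_rho: "space rho = G"
  by (simp add: rho_def space_restrict_space)

lemma sets_rho: "sets rho = sets (restrict_space borel G)"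
  by (simp add: rho_def cong: sets_restrict_space_cong)

lemma measurable_rhoI [measurable (raw)]: "f \<in> measurable borel N \<Longrightarrow> f \<in> measurable rho N"
  using measurable_restrict_space1[of f borel N G] measurable_cong_sets[OF sets_rho refl] by blast

lemma sets_rho_iff: "S \<in> sets rho \<longleftrightarrow> S \<in> sets borel \<and> S \<subseteq> G"
  unfolding sets_rho using sets_restrict_space_iff[of G borel S] by auto

lemma nn_integral_lborel_triple:
  fixes f :: "real \<times> real \<times> real \<Rightarrow> ennreal"
  assumes "f \<in> borel_measurable borel"
  shows "(\<integral>\<^sup>+z. f z \<partial>lborel) = (\<integral>\<^sup>+x. \<integral>\<^sup>+y. \<integral>\<^sup>+z. f (x, y, z) \<partial>lborel \<partial>lborel \<partial>lborel)"
proof -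
  have [measurable]: "f \<in> borel_measurable (borel \<Otimes>\<^sub>M borel)" "f \<in> borel_measurable (borel \<Otimes>\<^sub>M borel \<Otimes>\<^sub>M borel)"
    using assms unfolding borel_prod by simp_all
  have "(\<integral>\<^sup>+z. f z \<partial>lborel) = (\<integral>\<^sup>+x. \<integral>\<^sup>+y. f (x, y) \<partial>lborel \<partial>lborel)"
    by (subst lborel.nn_integral_fst) (simp_all add: lborel_prod assms)
  also have "\<dots> = (\<integral>\<^sup>+x. \<integral>\<^sup>+y. f (x, y) \<partial>(lborel \<Otimes>\<^sub>M lborel) \<partial>lborel)"
    by (simp add: lborel_prod)
  also have "\<dots> = (\<integral>\<^sup>+x. \<integral>\<^sup>+y. \<integral>\<^sup>+z. f (x, y, z) \<partial>lborel \<partial>lborel \<partial>lborel)"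
    by (intro nn_integral_cong lborel.nn_integral_fst[symmetric]) measurable
  finally show ?thesis .
qed

text \<open>In the coordinate \<open>v = ln a\<close> the measure \<open>da / a\<close> is Lebesgue
  measure. The log-height is made the outermost variable so that the inner double integral runs over
  a horosphere.\<close>

lemma nn_integral_rho:
  fixes f :: "pt \<Rightarrow> ennreal"
  assumes f [measurable]: "f \<in> borel_measurable borel"
  shows "(\<integral>\<^sup>+z. f z \<partial>rho) = (\<integral>\<^sup>+v. \<integral>\<^sup>+x1. \<integral>\<^sup>+x2. f (x1, x2, exp v) \<partial>lborel \<partial>lborel \<partial>lborel)"
proof -
  have f': "f \<in> borel_measurable (borel \<Otimes>\<^sub>M borel \<Otimes>\<^sub>M borel)"
    using f unfolding borel_prod by simp
  note f'[measurable]
  have m: "(\<lambda>(x1::real, x2::real, a::real). ennreal (1 / a)) \<in> borel_measurable borel"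
    unfolding borel_prod[symmetric] by measurable
  have "(\<integral>\<^sup>+z. f z \<partial>rho) = (\<integral>\<^sup>+z. (\<lambda>(x1, x2, a). ennreal (1 / a)) z * f z \<partial>restrict_space lborel G)"
    unfolding rho_def
    using m f by (intro nn_integral_density)
       ( auto intro!: measurable_restrict_space1)
  also have "\<dots> = (\<integral>\<^sup>+z. (\<lambda>(x1, x2, a). ennreal (1 / a)) z * f z * indicator G z \<partial>lborel)"
    by (subst nn_integral_restrict_space) auto
  also have "\<dots> = (\<integral>\<^sup>+(x1, x2, a). f (x1, x2, a) * (indicator {0<..} a * ennreal (1 / a)) \<partial>lborel)"
    by (intro nn_integral_cong) (auto simp: G_def indicator_def mult.commute)
  also have "\<dots> = (\<integral>\<^sup>+x1. \<integral>\<^sup>+x2. \<integral>\<^sup>+a. f (x1, x2, a) * (indicator {0<..} a * ennreal (1 / a)) \<partial>lborel \<partial>lborel \<partial>lborel)"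
    by (subst nn_integral_lborel_triple) (auto simp: borel_prod[symmetric])
  also have "\<dots> = (\<integral>\<^sup>+x1. \<integral>\<^sup>+x2. \<integral>\<^sup>+v. f (x1, x2, exp v) \<partial>lborel \<partial>lborel \<partial>lborel)"
    by (intro nn_integral_cong nn_integral_exp_substitution) measurable
  also have "\<dots> = (\<integral>\<^sup>+x1. \<integral>\<^sup>+v. \<integral>\<^sup>+x2. f (x1, x2, exp v) \<partial>lborel \<partial>lborel \<partial>lborel)"
    by (intro nn_integral_cong lborel_pair.Fubini') measurable
  also have "\<dots> = (\<integral>\<^sup>+v. \<integral>\<^sup>+x1. \<integral>\<^sup>+x2. f (x1, x2, exp v) \<partial>lborel \<partial>lborel \<partial>lborel)"
    by (intro lborel_pair.Fubini') measurable
  finally show ?thesis .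
qed

lemma emeasure_rho:
  assumes "S \<in> sets rho"
  shows "emeasure rho S = (\<integral>\<^sup>+v. \<integral>\<^sup>+x1. \<integral>\<^sup>+x2. indicator S (x1, x2, exp v) \<partial>lborel \<partial>lborel \<partial>lborel)"
proof -
  have "S \<in> sets borel" using assms by (simp add: sets_rho_iff)
  then show ?thesis using assms by (subst nn_integral_rho[symmetric]) auto
qed

lemma gmult_left_measurable [measurable]: "(\<lambda>z. c \<cdot> z) \<in> borel_measurable borel"
proof -
  obtain c1 c2 a where c: "c = (c1, c2, a)" by (cases c)
  have "(\<lambda>z. c \<cdot> z) = (\<lambda>z. (c1 + a * fst z, c2 + a * fst (snd z), a * snd (snd z)))"
    by (auto simp: c fun_eq_iff)
  then show ?thesis
    by (auto intro!: borel_measurable_continuous_onI continuous_intros)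
qed

lemma ginv_gmult_eq: "ginv z \<cdot> x = ((fst x - fst z) / snd (snd z),
    (fst (snd x) - fst (snd z)) / snd (snd z), snd (snd x) / snd (snd z))"
  by (cases x; cases z) (simp add: diff_divide_distrib)

lemma proj_measurable [measurable]: "(\<lambda>z::pt. fst z) \<in> borel_measurable borel"
  "(\<lambda>z::pt. fst (snd z)) \<in> borel_measurable borel" "(\<lambda>z::pt. snd (snd z)) \<in> borel_measurable borel"
  by (auto intro!: borel_measurable_continuous_onI continuous_intros)

lemma triple_measurable [measurable (raw)]:
  assumes [measurable]: "f \<in> borel_measurable M" "g \<in> borel_measurable M" "h \<in> borel_measurable M"
  shows "(\<lambda>z. (f z, g z, h z) :: pt) \<in> borel_measurable M"
  by (intro borel_measurable_Pair assms)

lemma ginv_gmult_measurable [measurable (raw)]: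
  assumes [measurable]: "f \<in> borel_measurable M" "g \<in> borel_measurable M"
  shows "(\<lambda>z. ginv (f z) \<cdot> g z) \<in> borel_measurable M"
proof -
  have *: "(\<lambda>w. p (h w)) \<in> borel_measurable M"
    if "p \<in> borel_measurable borel" "h \<in> borel_measurable M" for p :: "pt \<Rightarrow> real" and h
    using measurable_compose[OF that(2,1)] .
  note [measurable] = *[OF proj_measurable(1)] *[OF proj_measurable(2)] *[OF proj_measurable(3)]
  show ?thesis
    unfolding ginv_gmult_eq by measurable
qed

lemma modular_eq: "modular z = 1 / (snd (snd z))\<^sup>2"
  by (cases z) simp

lemma modular_measurable [measurable]: "modular \<in> borel_measurable borel"
  unfolding modular_eq[abs_def] by measurable

lemma left_translate_measurable: "c \<in> G \<Longrightarrow> (\<lambda>z. c \<cdot> z) \<in> measurable rho rho"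
proof (rule measurableI)
  show "c \<in> G \<Longrightarrow> z \<in> space rho \<Longrightarrow> c \<cdot> z \<in> space rho" for z
    by (simp add: space_rho gmult_closed)
  show "c \<in> G \<Longrightarrow> S \<in> sets rho \<Longrightarrow> (\<lambda>z. c \<cdot> z) -` S \<inter> space rho \<in> sets rho" for S
    using measurable_sets[of "\<lambda>z. c \<cdot> z" rho borel S] by (auto simp: sets_rho_iff)
qed

lemma inverse_translate_measurable:
  assumes x: "x \<in> G"
  shows "(\<lambda>z. ginv z \<cdot> x) \<in> measurable rho rho"
proof (rule measurableI)
  show "ginv z \<cdot> x \<in> space rho" if "z \<in> space rho" for z
    using that x by (auto simp: space_rho gmult_closed ginv_closed)
  show "(\<lambda>z. ginv z \<cdot> x) -` S \<inter> space rho \<in> sets rho" if "S \<in> sets rho" for S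
    using that measurable_sets[of "\<lambda>z. ginv z \<cdot> x" rho borel S] by (auto simp: sets_rho_iff)
qed

text \<open>Left multiplication dilates both horizontal coordinates by \<open>a\<close> and shifts
  the log-height, so it scales the right Haar measure by \<open>a^2\<close>. The affine
  substitutions undo this one coordinate at a time.\<close>

lemma rho_left_translate:
  assumes "0 < a"
  shows "rho = distr (density rho (\<lambda>_. ennreal (a\<^sup>2))) rho (\<lambda>z. (c1, c2, a) \<cdot> z)"
proof (rule measure_eqI)
  let ?c = "(c1, c2, a)"
  have T: "(\<lambda>z. ?c \<cdot> z) \<in> measurable rho rho"
    using assms by (intro left_translate_measurable) (simp add: G_def)
  fix S assume S: "S \<in> sets rho"
  then have Sb [measurable]: "S \<in> sets borel" by (simp add: sets_rho_iff)
  then have [measurable]: "S \<in> sets (borel \<Otimes>\<^sub>M borel \<Otimes>\<^sub>M borel)" unfolding borel_prod .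
  let ?I = "\<lambda>x1 x2 v. indicator S (x1, x2, exp v) :: ennreal"
  have "emeasure (distr (density rho (\<lambda>_. ennreal (a\<^sup>2))) rho (\<lambda>z. ?c \<cdot> z)) S
      = (\<integral>\<^sup>+z. ennreal (a\<^sup>2) * indicator S (?c \<cdot> z) \<partial>rho)"
    using T S measurable_sets[OF T S]
    by (subst emeasure_distr) (auto simp: emeasure_density indicator_def intro!: nn_integral_cong)
  also have "\<dots> = (\<integral>\<^sup>+v. \<integral>\<^sup>+x1. \<integral>\<^sup>+x2. ennreal (a\<^sup>2) * ?I (c1 + a * x1) (c2 + a * x2) (ln a + v) \<partial>lborel \<partial>lborel \<partial>lborel)"
    using assms by (subst nn_integral_rho) (auto simp: exp_add)
  also have "\<dots> = (\<integral>\<^sup>+v. \<integral>\<^sup>+x1. \<integral>\<^sup>+x2. ?I x1 x2 (ln a + v) \<partial>lborel \<partial>lborel \<partial>lborel)"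
  proof (rule nn_integral_cong)
    fix v :: real
    have "(\<integral>\<^sup>+x1. \<integral>\<^sup>+x2. ?I x1 x2 (ln a + v) \<partial>lborel \<partial>lborel)
        = ennreal a * (\<integral>\<^sup>+x1. \<integral>\<^sup>+x2. ?I (c1 + a * x1) x2 (ln a + v) \<partial>lborel \<partial>lborel)"
      using assms by (subst nn_integral_real_affine[where c=a and t=c1]) auto
    also have "\<dots> = ennreal a * (\<integral>\<^sup>+x1. ennreal a * (\<integral>\<^sup>+x2. ?I (c1 + a * x1) (c2 + a * x2) (ln a + v) \<partial>lborel) \<partial>lborel)"
      using assms by (subst nn_integral_real_affine[where c=a and t=c2]) auto
    also have "\<dots> = (\<integral>\<^sup>+x1. \<integral>\<^sup>+x2. ennreal (a\<^sup>2) * ?I (c1 + a * x1) (c2 + a * x2) (ln a + v) \<partial>lborel \<partial>lborel)"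
      using assms by (simp add: nn_integral_cmult power2_eq_square ennreal_mult mult.assoc)
    finally show "(\<integral>\<^sup>+x1. \<integral>\<^sup>+x2. ennreal (a\<^sup>2) * ?I (c1 + a * x1) (c2 + a * x2) (ln a + v) \<partial>lborel \<partial>lborel)
      = (\<integral>\<^sup>+x1. \<integral>\<^sup>+x2. ?I x1 x2 (ln a + v) \<partial>lborel \<partial>lborel)" ..
  qed
  also have "\<dots> = (\<integral>\<^sup>+v. \<integral>\<^sup>+x1. \<integral>\<^sup>+x2. ?I x1 x2 v \<partial>lborel \<partial>lborel \<partial>lborel)"
    by (subst (2) nn_integral_real_affine[where c=1 and t="ln a"]) auto
  also have "\<dots> = emeasure rho S"
    by (rule emeasure_rho[OF S, symmetric])
  finally show "emeasure rho S = emeasure (distr (density rho (\<lambda>_. ennreal (a\<^sup>2))) rho (\<lambda>z. ?c \<cdot> z)) S" ..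
qed simp

text \<open>The map is an inversion followed by a right translation: the latter preserves
  \<open>rho\<close>, the former contributes the modular function as a density. It is the change of
  variables that turns convolution into a kernel integral.\<close>

lemma rho_inverse_translate:
  assumes x: "x \<in> G"
  shows "rho = distr (density rho (\<lambda>z. ennreal (modular z))) rho (\<lambda>z. ginv z \<cdot> x)"
proof (rule measure_eqI)
  obtain y1 y2 a where xa: "x = (y1, y2, a)" and a: "0 < a"
    using x by (auto simp: G_def)
  note T = inverse_translate_measurable[OF x]
  fix S assume S: "S \<in> sets rho"
  then have Sb [measurable]: "S \<in> sets borel" by (simp add: sets_rho_iff)
  then have [measurable]: "S \<in> sets (borel \<Otimes>\<^sub>M borel \<Otimes>\<^sub>M borel)" unfolding borel_prod .
  let ?I = "\<lambda>x1 x2 v. indicator S (x1, x2, exp v) :: ennreal"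
  have "emeasure (distr (density rho (\<lambda>z. ennreal (modular z))) rho (\<lambda>z. ginv z \<cdot> x)) S
      = (\<integral>\<^sup>+z. ennreal (modular z) * indicator S (ginv z \<cdot> x) \<partial>rho)"
    using T S measurable_sets[OF T S]
    by (subst emeasure_distr) (auto simp: emeasure_density indicator_def intro!: nn_integral_cong)
  also have "\<dots> = (\<integral>\<^sup>+v. \<integral>\<^sup>+x1. \<integral>\<^sup>+x2. ennreal ((exp (-v))\<^sup>2) * ?I (y1 * exp (-v) + - exp (-v) * x1) (y2 * exp (-v) + - exp (-v) * x2) (ln a + - 1 * v) \<partial>lborel \<partial>lborel \<partial>lborel)"
    using a by (subst nn_integral_rho)
      (auto simp: exp_add exp_minus exp_diff xa ginv_gmult_eq field_simps power_divide intro!: nn_integral_cong)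
  also have "\<dots> = (\<integral>\<^sup>+v. \<integral>\<^sup>+x1. \<integral>\<^sup>+x2. ?I x1 x2 (ln a + - 1 * v) \<partial>lborel \<partial>lborel \<partial>lborel)"
  proof (rule nn_integral_cong)
    fix v :: real
    let ?b = "exp (-v)"
    have "(\<integral>\<^sup>+x1. \<integral>\<^sup>+x2. ?I x1 x2 (ln a + - 1 * v) \<partial>lborel \<partial>lborel)
        = ennreal ?b * (\<integral>\<^sup>+x1. \<integral>\<^sup>+x2. ?I (y1 * ?b + - ?b * x1) x2 (ln a + - 1 * v) \<partial>lborel \<partial>lborel)"
      by (subst nn_integral_real_affine[where c="- ?b" and t="y1 * ?b"]) auto
    also have "\<dots> = ennreal ?b * (\<integral>\<^sup>+x1. ennreal ?b * (\<integral>\<^sup>+x2. ?I (y1 * ?b + - ?b * x1) (y2 * ?b + - ?b * x2) (ln a + - 1 * v) \<partial>lborel) \<partial>lborel)"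
      by (subst nn_integral_real_affine[where c="- ?b" and t="y2 * ?b"]) auto
    also have "\<dots> = (\<integral>\<^sup>+x1. \<integral>\<^sup>+x2. ennreal (?b\<^sup>2) * ?I (y1 * ?b + - ?b * x1) (y2 * ?b + - ?b * x2) (ln a + - 1 * v) \<partial>lborel \<partial>lborel)"
      by (simp add: nn_integral_cmult power2_eq_square ennreal_mult mult.assoc)
    finally show "(\<integral>\<^sup>+x1. \<integral>\<^sup>+x2. ennreal (?b\<^sup>2) * ?I (y1 * ?b + - ?b * x1) (y2 * ?b + - ?b * x2) (ln a + - 1 * v) \<partial>lborel \<partial>lborel)
      = (\<integral>\<^sup>+x1. \<integral>\<^sup>+x2. ?I x1 x2 (ln a + - 1 * v) \<partial>lborel \<partial>lborel)" ..
  qed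
  also have "\<dots> = (\<integral>\<^sup>+v. \<integral>\<^sup>+x1. \<integral>\<^sup>+x2. ?I x1 x2 v \<partial>lborel \<partial>lborel \<partial>lborel)"
    by (subst (2) nn_integral_real_affine[where c="-1" and t="ln a"]) auto
  also have "\<dots> = emeasure rho S"
    by (rule emeasure_rho[OF S, symmetric])
  finally show "emeasure rho S = emeasure (distr (density rho (\<lambda>z. ennreal (modular z))) rho (\<lambda>z. ginv z \<cdot> x)) S" ..
qed simp

section \<open>The heat kernel in Euclidean distances\<close>

lemma sinh_ge_self: "0 \<le> y \<Longrightarrow> y \<le> sinh (y::real)"
  using real_le_x_sinh[of y] by (simp add: sinh_field_def exp_minus)

definition mirror :: "pt \<Rightarrow> pt" where
  "mirror z = (fst z, fst (snd z), - snd (snd z))"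

definition hyp_dist :: "pt \<Rightarrow> pt \<Rightarrow> real" where
  "hyp_dist x z = 2 * ln (dist x z + dist x (mirror z)) - ln (snd (snd x)) - ln (snd (snd z)) - 2 * ln 2"

text \<open>The integral kernel, with respect to \<open>rho\<close>, of convolution with the heat kernel: the factor
  \<open>modular z\<close> comes from the substitution \<open>y = z\<^sup>-\<^sup>1 x\<close>.\<close>

definition kernel_at :: "real \<Rightarrow> pt \<Rightarrow> pt \<Rightarrow> real" where
  "kernel_at t x z = modular z * heat_kernel t (ginv z \<cdot> x)"

text \<open>The factor \<open>\<Phi>\<^sub>t\<close> of the overview; it carries all of the
  dependence on \<open>t\<close>.\<close>

definition gauss_factor :: "real \<Rightarrow> real \<Rightarrow> real" where
  "gauss_factor t d = d * t powr (- 3/2) * exp (- d\<^sup>2 / (4 * t))"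

lemma dist_pt: "dist (x1, x2, a) (z1, z2, b) = sqrt ((x1 - z1)\<^sup>2 + (x2 - z2)\<^sup>2 + (a - b :: real)\<^sup>2)"
  for x1 x2 z1 z2 :: real
  by (simp add: dist_Pair_Pair dist_real_def add.assoc)

lemma dist_mirror_pt:
  "dist (x1, x2, a) (mirror (z1, z2, b)) = sqrt ((x1 - z1)\<^sup>2 + (x2 - z2)\<^sup>2 + (a + b)\<^sup>2)"
  by (simp add: mirror_def dist_pt)

lemma dist_pt_sq: "(dist (x1, x2, a) (z1, z2, b))\<^sup>2 = (x1 - z1)\<^sup>2 + (x2 - z2)\<^sup>2 + (a - b :: real)\<^sup>2"
  for x1 x2 z1 z2 :: real
  by (simp add: dist_pt)

lemma dist_mirror_pt_sq:
  "(dist (x1, x2, a) (mirror (z1, z2, b)))\<^sup>2 = (x1 - z1)\<^sup>2 + (x2 - z2)\<^sup>2 + (a + b)\<^sup>2"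
  by (simp add: dist_mirror_pt)

lemma dist_mirror_mirror: "dist (mirror z) (mirror w) = dist z w"
  by (cases z; cases w) (simp add: mirror_def dist_pt power2_commute)

lemma gone_in_G: "gone \<in> G"
  by (simp add: gone_def G_def)

context
  fixes x z :: pt
  assumes x: "x \<in> G" and z: "z \<in> G"
begin

lemma height_pos: "0 < snd (snd x)" "0 < snd (snd z)"
  using x z by (auto simp: G_def)

text \<open>Equivalently \<open>(E' - E) (E' + E) = 4 a b\<close>. This is what makes
  \<open>exp\<close>, \<open>cosh\<close> and \<open>sinh\<close> of \<open>hyp_dist\<close>
  algebraic in the two Euclidean distances and the heights.\<close>

lemma dist_mirror_sq: "(dist x (mirror z))\<^sup>2 = (dist x z)\<^sup>2 + 4 * snd (snd x) * snd (snd z)"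
proof -
  obtain x1 x2 a z1 z2 b where e: "x = (x1, x2, a)" "z = (z1, z2, b)"
    by (metis surj_pair)
  show ?thesis
    unfolding e dist_pt_sq dist_mirror_pt_sq by (simp add: power2_eq_square algebra_simps)
qed

lemma dist_less_mirror: "dist x z < dist x (mirror z)"
proof (rule power_less_imp_less_base[where n=2])
  show "(dist x z)\<^sup>2 < (dist x (mirror z))\<^sup>2"
    using height_pos by (simp add: dist_mirror_sq)
qed simp

lemma dist_mirror_pos: "0 < dist x (mirror z)"
  using dist_less_mirror zero_le_dist[of x z] by linarith

lemma exp_hyp_dist:
  "exp (hyp_dist x z) = (dist x z + dist x (mirror z))\<^sup>2 / (4 * snd (snd x) * snd (snd z))"
proof -
  let ?S = "dist x z + dist x (mirror z)"
  have S: "0 < ?S" using dist_mirror_pos by (simp add: add_nonneg_pos)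
  have "hyp_dist x z = ln (?S\<^sup>2 / (4 * snd (snd x) * snd (snd z)))"
    using S height_pos ln_realpow[of 2 2] by (simp add: hyp_dist_def ln_div ln_mult ln_realpow)
  then show ?thesis
    using S height_pos by simp
qed

lemma exp_neg_hyp_dist:
  "exp (- hyp_dist x z) = (dist x (mirror z) - dist x z)\<^sup>2 / (4 * snd (snd x) * snd (snd z))"
proof -
  let ?a = "snd (snd x)" and ?b = "snd (snd z)" and ?E = "dist x z" and ?E' = "dist x (mirror z)"
  have p: "(?E' - ?E) * (?E + ?E') = 4 * ?a * ?b"
    using dist_mirror_sq by (simp add: power2_eq_square algebra_simps)
  have S: "0 < ?E + ?E'" using dist_mirror_pos by (simp add: add_nonneg_pos)
  have "(?E' - ?E)\<^sup>2 * (?E + ?E')\<^sup>2 = (4 * ?a * ?b)\<^sup>2"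
    using p by (metis power_mult_distrib)
  then show ?thesis
    using S height_pos
    by (simp add: exp_minus exp_hyp_dist inverse_eq_divide frac_eq_eq) (simp add: power2_eq_square)
qed

lemma cosh_hyp_dist:
  "cosh (hyp_dist x z) = ((dist x z)\<^sup>2 + (dist x (mirror z))\<^sup>2) / (4 * snd (snd x) * snd (snd z))"
  using height_pos unfolding cosh_def exp_hyp_dist exp_neg_hyp_dist
  by (simp add: field_simps power2_eq_square)

lemma sinh_hyp_dist:
  "sinh (hyp_dist x z) = dist x z * dist x (mirror z) / (2 * snd (snd x) * snd (snd z))"
  using height_pos unfolding sinh_def exp_hyp_dist exp_neg_hyp_dist
  by (simp add: field_simps power2_eq_square)

lemma hyp_dist_nonneg: "0 \<le> hyp_dist x z"
proof -
  have "0 \<le> sinh (hyp_dist x z)" using height_pos unfolding sinh_hyp_dist by simp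
  then show ?thesis by simp
qed

lemma hyp_dist_pos: "x \<noteq> z \<Longrightarrow> 0 < hyp_dist x z"
proof -
  assume "x \<noteq> z"
  then have "0 < sinh (hyp_dist x z)" using height_pos dist_mirror_pos unfolding sinh_hyp_dist by simp
  then show ?thesis by simp
qed

text \<open>Both sides have the same hyperbolic cosine, and since \<open>hyp_dist\<close> is
  nonnegative, \<open>arcosh\<close> recovers it.\<close>

lemma radius_eq_hyp_dist: "radius (ginv z \<cdot> x) = hyp_dist x z"
proof -
  obtain x1 x2 a z1 z2 b where e: "x = (x1, x2, a)" "z = (z1, z2, b)"
    by (metis surj_pair)
  have ab: "0 < a" "0 < b" using height_pos by (auto simp: e)
  have "(a / b + b / a + (((x1 - z1) / b)\<^sup>2 + ((x2 - z2) / b)\<^sup>2) / (a / b)) / 2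
      = ((dist x z)\<^sup>2 + (dist x (mirror z))\<^sup>2) / (4 * a * b)"
    using ab unfolding e dist_pt_sq dist_mirror_pt_sq
    by (simp add: divide_simps power2_eq_square) (simp add: algebra_simps)
  also have "\<dots> = cosh (hyp_dist x z)"
    unfolding cosh_hyp_dist by (simp add: e)
  finally show ?thesis
    using ab hyp_dist_nonneg
    by (simp add: e arcosh_cosh_real diff_divide_distrib)
qed

text \<open>From \<open>E >= |a - b|\<close> and \<open>E' >= a + b\<close>, the sum
  \<open>E + E'\<close> is at least twice the larger height, and the remaining logarithms give the
  distance between the two horospheres.\<close>

lemma hyp_dist_ge_ln: "\<bar>ln (snd (snd x)) - ln (snd (snd z))\<bar> \<le> hyp_dist x z"
proof -
  let ?a = "snd (snd x)" and ?b = "snd (snd z)" and ?E = "dist x z" and ?E' = "dist x (mirror z)"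
  obtain x1 x2 a z1 z2 b where e: "x = (x1, x2, a)" "z = (z1, z2, b)"
    by (metis surj_pair)
  have ab: "0 < a" "0 < b" using height_pos by (auto simp: e)
  have "\<bar>a - b\<bar> \<le> ?E" "a + b \<le> ?E'"
    unfolding e dist_pt dist_mirror_pt by (rule real_le_rsqrt; simp)+
  then have S: "2 * a \<le> ?E + ?E'" "2 * b \<le> ?E + ?E'" by linarith+
  have "ln (2 * a) \<le> ln (?E + ?E')" "ln (2 * b) \<le> ln (?E + ?E')"
    using S ab by auto
  then show ?thesis
    using ab unfolding hyp_dist_def e by (simp add: ln_mult)
qed

end

text \<open>On the diagonal the right-hand side is \<open>0\<close> (division by zero), the kernel is not.\<close>

lemma kernel_at_eq:
  assumes "x \<in> G" "z \<in> G" "x \<noteq> z"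
  shows "kernel_at t x z = 1 / (4 * pi powr (3/2)) * gauss_factor t (hyp_dist x z) / (dist x z * dist x (mirror z))"
proof -
  obtain x1 x2 a z1 z2 b where e: "x = (x1, x2, a)" "z = (z1, z2, b)"
    by (metis surj_pair)
  have ab: "0 < a" "0 < b" using assms by (auto simp: e G_def)
  \<comment> \<open>The heights cancel: \<open>modular z\<close> is \<open>1 / b^2\<close>, this
    factor is \<open>b / a\<close>, and \<open>1 / sinh\<close> is \<open>2 a b / (E E')\<close>.
    The product \<open>2 / (E E')\<close> is symmetric in \<open>x\<close> and \<open>z\<close> and
    turns the coefficient \<open>1/8\<close> into \<open>1/4\<close>.\<close>
  have "modular (ginv z \<cdot> x) powr (1/2) = sqrt ((b / a)\<^sup>2)"
    using ab by (simp add: e powr_half_sqrt power_divide)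
  then have m: "modular (ginv z \<cdot> x) powr (1/2) = b / a"
    using ab by simp
  have h: "hyp_dist x z \<noteq> 0" using hyp_dist_pos[OF assms] by simp
  have d: "dist x z \<noteq> 0" "dist x (mirror z) \<noteq> 0"
    using assms dist_mirror_pos[OF assms(1,2)] by auto
  have "pi powr (3/2) \<noteq> 0" by simp
  with h d show ?thesis
    unfolding kernel_at_def heat_kernel_def m radius_eq_hyp_dist[OF assms(1,2)] sinh_hyp_dist[OF assms(1,2)] gauss_factor_def
    using ab by (simp add: e power2_eq_square)
qed

lemma kernel_at_nonneg: "0 < t \<Longrightarrow> x \<in> G \<Longrightarrow> z \<in> G \<Longrightarrow> 0 \<le> kernel_at t x z"
  using hyp_dist_nonneg[of x z]
  by (auto simp: kernel_at_def heat_kernel_def radius_eq_hyp_dist modular_eq[of z] intro!: mult_nonneg_nonneg divide_nonneg_nonneg) 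

text \<open>Near the boundary plane the factor \<open>1 / (a b)\<close> blows up, but it is at most
  \<open>exp h / a^2\<close> because \<open>h >= ln (a / b)\<close>, and the Gaussian absorbs
  \<open>exp h\<close> since \<open>h - h^2 / (4 t) <= t\<close>. The bound degenerates as
  \<open>t\<close> varies; it serves to make heat averages of L1 functions exist and be continuous
  for fixed \<open>t\<close> and \<open>x\<close>.\<close>

lemma kernel_at_bounded:
  assumes t: "0 < t" and xz: "x \<in> G" "z \<in> G"
  shows "kernel_at t x z \<le> t powr (- 3/2) * exp t / (snd (snd x))\<^sup>2"
proof -
  obtain x1 x2 a z1 z2 b where e: "x = (x1, x2, a)" "z = (z1, z2, b)"
    by (metis surj_pair)
  have ab: "0 < a" "0 < b" using xz by (auto simp: e G_def)
  let ?h = "hyp_dist x z"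
  let ?q = "if ?h = 0 then 1 else ?h / sinh ?h"
  have h: "0 \<le> ?h" by (rule hyp_dist_nonneg[OF xz])
  have "modular (ginv z \<cdot> x) powr (1/2) = sqrt ((b / a)\<^sup>2)"
    using ab by (simp add: e powr_half_sqrt power_divide)
  then have m: "modular (ginv z \<cdot> x) powr (1/2) = b / a"
    using ab by simp
  have "?h \<le> sinh ?h" if "?h \<noteq> 0" using sinh_ge_self[OF h] .
  then have q: "0 \<le> ?q" "?q \<le> 1" using h by (auto simp: divide_le_eq)
  have "ln (a / b) \<le> ?h"
    using hyp_dist_ge_ln[OF xz] ab by (simp add: e ln_div)
  then have "a / b \<le> exp ?h"
    using ab by (metis divide_pos_pos exp_le_cancel_iff exp_ln)
  then have b: "1 / (a * b) \<le> exp ?h / a\<^sup>2"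
    using ab by (simp add: field_simps power2_eq_square)
  have "0 \<le> (?h - 2 * t)\<^sup>2" by simp
  then have "?h - ?h\<^sup>2 / (4 * t) \<le> t"
    using t by (simp add: field_simps power2_eq_square)
  then have ex: "exp ?h * exp (- ?h\<^sup>2 / (4 * t)) \<le> exp t"
    by (simp flip: exp_add)
  have p: "1 \<le> pi powr (3/2)" using pi_ge_two by (intro ge_one_powr_ge_zero) auto
  have "kernel_at t x z = 1 / (8 * pi powr (3/2)) * (1 / (a * b)) * ?q * t powr (-3/2) * exp (- ?h\<^sup>2 / (4 * t))"
    unfolding kernel_at_def heat_kernel_def m radius_eq_hyp_dist[OF xz] using ab by (simp add: e power2_eq_square mult_ac)
  also have "\<dots> \<le> 1 * (exp ?h / a\<^sup>2) * 1 * t powr (-3/2) * exp (- ?h\<^sup>2 / (4 * t))"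
    using p b q ab by (intro mult_mono) (auto simp: divide_le_eq)
  also have "\<dots> = t powr (-3/2) * (exp ?h * exp (- ?h\<^sup>2 / (4 * t))) / a\<^sup>2"
    by (simp add: mult_ac)
  also have "\<dots> \<le> t powr (-3/2) * exp t / a\<^sup>2"
    using ex by (intro divide_right_mono mult_left_mono) auto
  finally show ?thesis by (simp add: e)
qed

section \<open>Kernel bounds that are uniform in time\<close>

lemma cubic_le_exp:
  assumes "0 \<le> (y::real)"
  shows "(1 + y) ^ 3 \<le> 1728 * exp (y / 4)"
proof -
  \<comment> \<open>Cubing this produces \<open>12 ^ 3 = 1728\<close>, the source of that constant
    in all later kernel bounds.\<close>
  have "1 + y \<le> 12 * exp (y / 12)"
    using exp_ge_add_one_self[of "y/12"] assms by linarith
  then have "(1 + y) ^ 3 \<le> (12 * exp (y / 12)) ^ 3"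
    using assms by (intro power_mono) auto
  also have "\<dots> = 1728 * exp (y / 4)"
    by (simp add: power_mult_distrib flip: exp_of_nat_mult)
  finally show ?thesis .
qed

text \<open>With \<open>y = d^2 / t\<close> the left side is \<open>d^-3\<close> times a bounded
  function of \<open>y\<close> alone. The weight dominates both \<open>1\<close>, for the size of
  \<open>gauss_factor\<close>, and \<open>|1 - d^2 / (2 t)|\<close>, which appears in its
  derivative.\<close>

lemma gauss_factor_weight:
  fixes t d :: real
  assumes "0 < t" "0 < d"
  shows "t powr (- 3/2) * exp (- d\<^sup>2 / (4 * t)) * (1 + d\<^sup>2 / (2 * t)) \<le> 1728 / d ^ 3"
proof -
  define y where "y = d\<^sup>2 / t"
  have y: "0 < y" using assms by (simp add: y_def zero_less_divide_iff)
  have "t powr (- 3/2) = y powr (3/2) / d ^ 3"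
  proof -
    have "y powr (3/2) = d\<^sup>2 powr (3/2) / t powr (3/2)"
      using assms by (simp add: y_def powr_divide)
    also have "d\<^sup>2 powr (3/2) = (d powr 2) powr (3/2)" using assms by simp
    also have "\<dots> = d powr 3" unfolding powr_powr by simp
    also have "\<dots> = d ^ 3" using assms by simp
    finally show ?thesis using assms by (simp add: powr_minus field_simps)
  qed
  moreover have "y powr (3/2) * (1 + y / 2) \<le> (1 + y) ^ 3"
  proof -
    have "y powr (3/2) \<le> (1 + y) powr (3/2)" using y by (intro powr_mono2) auto
    also have "\<dots> \<le> (1 + y) powr 2" using y by (intro powr_mono) auto
    also have "\<dots> = (1 + y)\<^sup>2" using y by simp
    finally have "y powr (3/2) * (1 + y / 2) \<le> (1 + y)\<^sup>2 * (1 + y)"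
      using y by (intro mult_mono) auto
    then show ?thesis by (simp add: power3_eq_cube power2_eq_square mult_ac)
  qed
  then have "y powr (3/2) * (1 + y / 2) * exp (- (y / 4)) \<le> 1728 * exp (y / 4) * exp (- (y / 4))"
    using cubic_le_exp[of y] y by (intro mult_right_mono) auto
  then have "y powr (3/2) * (1 + y / 2) * exp (- (y / 4)) \<le> 1728"
    by (simp flip: exp_add add: mult.assoc)
  ultimately show ?thesis
    using assms by (simp add: y_def divide_right_mono mult_ac)
qed

lemma gauss_factor_nonneg: "0 \<le> d \<Longrightarrow> 0 \<le> gauss_factor t d"
  by (simp add: gauss_factor_def)

lemma gauss_factor_le:
  assumes "0 < t" "0 < d"
  shows "gauss_factor t d \<le> 1728 / d\<^sup>2"
proof -
  have "t powr (- 3/2) * exp (- d\<^sup>2 / (4 * t)) * 1 \<le> t powr (- 3/2) * exp (- d\<^sup>2 / (4 * t)) * (1 + d\<^sup>2 / (2 * t))"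
    using assms by (intro mult_left_mono) auto
  also note gauss_factor_weight[OF assms]
  finally have "d * (t powr (- 3/2) * exp (- d\<^sup>2 / (4 * t))) \<le> d * (1728 / d ^ 3)"
    using assms by (intro mult_left_mono) auto
  then show ?thesis
    using assms by (simp add: gauss_factor_def power3_eq_cube power2_eq_square mult_ac)
qed

lemma gauss_factor_diff:
  assumes t: "0 < t" and m: "0 < m" "m \<le> d" "m \<le> d'"
  shows "\<bar>gauss_factor t d - gauss_factor t d'\<bar> \<le> 1728 * \<bar>d - d'\<bar> / m ^ 3"
proof -
  have "norm (gauss_factor t d - gauss_factor t d') \<le> 1728 / m ^ 3 * norm (d - d')"
  proof (rule field_differentiable_bound[of "{m..}"])
    fix s assume s: "s \<in> {m..}"
    have "((\<lambda>d. gauss_factor t d) has_field_derivative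
        t powr (- 3/2) * exp (- s\<^sup>2 / (4 * t)) * (1 - s\<^sup>2 / (2 * t))) (at s)"
      unfolding gauss_factor_def using t
      by (auto intro!: derivative_eq_intros simp: field_simps power2_eq_square)
    then show "((\<lambda>d. gauss_factor t d) has_field_derivative
        t powr (- 3/2) * exp (- s\<^sup>2 / (4 * t)) * (1 - s\<^sup>2 / (2 * t))) (at s within {m..})"
      by (rule has_field_derivative_at_within)
    have "norm (t powr (- 3/2) * exp (- s\<^sup>2 / (4 * t)) * (1 - s\<^sup>2 / (2 * t)))
        = t powr (- 3/2) * exp (- s\<^sup>2 / (4 * t)) * \<bar>1 - s\<^sup>2 / (2 * t)\<bar>"
      by (simp add: abs_mult)
    also have "\<dots> \<le> t powr (- 3/2) * exp (- s\<^sup>2 / (4 * t)) * (1 + s\<^sup>2 / (2 * t))"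
      using t by (intro mult_left_mono) (auto simp: abs_if)
    also have "\<dots> \<le> 1728 / s ^ 3"
      using t s m by (intro gauss_factor_weight) auto
    also have "\<dots> \<le> 1728 / m ^ 3"
      using s m by (intro divide_left_mono power_mono mult_pos_pos) auto
    finally show "norm (t powr (- 3/2) * exp (- s\<^sup>2 / (4 * t)) * (1 - s\<^sup>2 / (2 * t))) \<le> 1728 / m ^ 3" .
  qed (use m in auto)
  then show ?thesis by simp
qed

lemma kernel_at_coeff: "0 < 1 / (4 * pi powr (3/2))" "1 / (4 * pi powr (3/2)) \<le> 1"
proof -
  have "1 \<le> pi powr (3/2)" using pi_ge_two by (intro ge_one_powr_ge_zero) auto
  then show "0 < 1 / (4 * pi powr (3/2))" "1 / (4 * pi powr (3/2)) \<le> 1"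
    by (auto simp: divide_le_eq)
qed

lemma kernel_at_le:
  assumes "0 < t" "x \<in> G" "z \<in> G" "x \<noteq> z"
  shows "kernel_at t x z \<le> 1728 / ((hyp_dist x z)\<^sup>2 * (dist x z * dist x (mirror z)))"
proof -
  have h: "0 < hyp_dist x z" using hyp_dist_pos assms by simp
  have "kernel_at t x z \<le> 1 * (1728 / (hyp_dist x z)\<^sup>2) / (dist x z * dist x (mirror z))"
    unfolding kernel_at_eq[OF assms(2-)]
    using kernel_at_coeff gauss_factor_le[OF assms(1) h] gauss_factor_nonneg[of "hyp_dist x z" t] h
    by (intro divide_right_mono mult_mono) auto
  then show ?thesis by simp
qed

text \<open>A product rule: the change of \<open>gauss_factor\<close> at fixed denominator, plus the
  change of \<open>1 / (E E')\<close> at fixed \<open>gauss_factor\<close>. The variation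
  \<open>de\<close> of the hyperbolic distance stays a parameter because large and small boxes bound
  it differently.\<close>

lemma kernel_at_diff:
  assumes t: "0 < t" and G: "x \<in> G" "z \<in> G" "c \<in> G" and xc: "x \<noteq> c"
    and D: "4 * dist z c \<le> dist x c"
    and de: "\<bar>hyp_dist x z - hyp_dist x c\<bar> \<le> de" and h: "hyp_dist x c / 2 \<le> hyp_dist x z"
  shows "\<bar>kernel_at t x z - kernel_at t x c\<bar> \<le> 32 * 1728 * (de / ((hyp_dist x c) ^ 3 * (dist x c * dist x (mirror c)))
     + dist z c / ((hyp_dist x c)\<^sup>2 * ((dist x c)\<^sup>2 * dist x (mirror c))))"
proof -
  define E E' F F' where "E = dist x z" and "E' = dist x (mirror z)"
    and "F = dist x c" and "F' = dist x (mirror c)"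
  define d e where "d = hyp_dist x z" and "e = hyp_dist x c"
  define \<kappa> where "\<kappa> = 1 / (4 * pi powr (3/2))"
  have \<kappa>: "0 < \<kappa>" "\<kappa> \<le> 1" using kernel_at_coeff by (simp_all add: \<kappa>_def)
  have F: "0 < F" "F < F'" using xc dist_less_mirror[OF G(1,3)] by (auto simp: F_def F'_def)
  have "\<bar>E - F\<bar> \<le> dist z c" unfolding E_def F_def
    by (metis abs_dist_diff_le dist_commute)
  have "\<bar>E' - F'\<bar> \<le> dist (mirror z) (mirror c)" unfolding E'_def F'_def
    by (metis abs_dist_diff_le dist_commute)
  then have "\<bar>E' - F'\<bar> \<le> dist z c" by (simp add: dist_mirror_mirror)
  note EF = \<open>\<bar>E - F\<bar> \<le> dist z c\<close> this
  have E: "3/4 * F \<le> E" "3/4 * F' \<le> E'" using EF D F by (auto simp flip: F_def)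
  have E0: "0 < E" "0 < E'" using E F by auto
  have xz: "x \<noteq> z" using E0 by (auto simp: E_def)
  have e: "0 < e" using hyp_dist_pos[OF G(1,3) xc] by (simp add: e_def)
  have g: "\<bar>gauss_factor t d - gauss_factor t e\<bar> \<le> 1728 * de / (e/2) ^ 3"
  proof -
    have "\<bar>gauss_factor t d - gauss_factor t e\<bar> \<le> 1728 * \<bar>d - e\<bar> / (e/2) ^ 3"
      using gauss_factor_diff[OF t, of "e/2" d e] e h by (simp add: d_def e_def)
    also have "\<dots> \<le> 1728 * de / (e/2) ^ 3"
      using de e by (intro divide_right_mono mult_left_mono) (auto simp: d_def e_def)
    finally show ?thesis .
  qed
  have de0: "0 \<le> de" using de by linarith
  have ge: "0 \<le> gauss_factor t e" "gauss_factor t e \<le> 1728 / e\<^sup>2" using gauss_factor_le[OF t e] e by (auto simp: gauss_factor_nonneg)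
  have EE: "9/16 * (F * F') \<le> E * E'"
    using mult_mono[OF E] F E0 by (simp add: mult_ac)
  have 1: "\<bar>gauss_factor t d - gauss_factor t e\<bar> / (E * E') \<le> 32 * 1728 * (de / (e ^ 3 * (F * F')))"
  proof -
    have "\<bar>gauss_factor t d - gauss_factor t e\<bar> / (E * E') \<le> (1728 * de / (e/2) ^ 3) / (9/16 * (F * F'))"
      using g EE F de0 e by (intro frac_le) auto
    also have "\<dots> = 16/9 * 8 * 1728 * (de / (e ^ 3 * (F * F')))"
      using e F by (simp add: field_simps)
    also have "\<dots> \<le> 32 * 1728 * (de / (e ^ 3 * (F * F')))"
      using e F de0 by (intro mult_right_mono) auto
    finally show ?thesis .
  qed
  have inv: "\<bar>1 / (E * E') - 1 / (F * F')\<bar> \<le> 4 * (dist z c / (F\<^sup>2 * F'))"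
  proof -
    \<comment> \<open>Telescoping through the intermediate value
      \<open>1 / (E * F')\<close>.\<close>
    have "1 / (E * E') - 1 / (F * F') = (F - E) / (E * (F * F')) + (F' - E') / (E * (E' * F'))"
      using E0 F by (simp add: field_simps)
    then have "\<bar>1 / (E * E') - 1 / (F * F')\<bar> \<le> \<bar>F - E\<bar> / (E * (F * F')) + \<bar>F' - E'\<bar> / (E * (E' * F'))"
      using E0 F abs_triangle_ineq[of "(F - E) / (E * (F * F'))" "(F' - E') / (E * (E' * F'))"]
      by (simp add: abs_mult)
    also have "\<dots> \<le> dist z c / (3/4 * F * (F * F')) + dist z c / (3/4 * F * (3/4 * F * F'))"
      using E E0 F EF by (intro add_mono frac_le mult_mono) (auto simp: abs_minus_commute)
    also have "\<dots> = (4/3 + 16/9) * (dist z c / (F\<^sup>2 * F'))"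
      using F by (simp add: field_simps power2_eq_square)
    also have "\<dots> \<le> 4 * (dist z c / (F\<^sup>2 * F'))"
      using F by (intro mult_right_mono) auto
    finally show ?thesis .
  qed
  have 2: "gauss_factor t e * \<bar>1 / (E * E') - 1 / (F * F')\<bar> \<le> 32 * 1728 * (dist z c / (e\<^sup>2 * (F\<^sup>2 * F')))"
  proof -
    have "gauss_factor t e * \<bar>1 / (E * E') - 1 / (F * F')\<bar> \<le> 1728 / e\<^sup>2 * (4 * (dist z c / (F\<^sup>2 * F')))"
      using ge inv by (intro mult_mono) auto
    also have "\<dots> = 4 * 1728 * (dist z c / (e\<^sup>2 * (F\<^sup>2 * F')))"
      by simp
    also have "\<dots> \<le> 32 * 1728 * (dist z c / (e\<^sup>2 * (F\<^sup>2 * F')))"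
      using e F by (intro mult_right_mono) auto
    finally show ?thesis .
  qed
  have "kernel_at t x z - kernel_at t x c = \<kappa> * ((gauss_factor t d - gauss_factor t e) / (E * E') + gauss_factor t e * (1 / (E * E') - 1 / (F * F')))"
    unfolding kernel_at_eq[OF G(1,2) xz] kernel_at_eq[OF G(1,3) xc] \<kappa>_def
      E_def[symmetric] E'_def[symmetric] F_def[symmetric] F'_def[symmetric] d_def[symmetric] e_def[symmetric]
    by (simp add: algebra_simps diff_divide_distrib)
  then have "\<bar>kernel_at t x z - kernel_at t x c\<bar> \<le> 1 * \<bar>(gauss_factor t d - gauss_factor t e) / (E * E') + gauss_factor t e * (1 / (E * E') - 1 / (F * F'))\<bar>"
    using \<kappa> by (simp only: abs_mult abs_of_pos) (rule mult_right_mono, auto)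
  also have "\<dots> \<le> \<bar>gauss_factor t d - gauss_factor t e\<bar> / (E * E') + gauss_factor t e * \<bar>1 / (E * E') - 1 / (F * F')\<bar>"
    using E0 ge abs_triangle_ineq[of "(gauss_factor t d - gauss_factor t e) / (E * E')" "gauss_factor t e * (1 / (E * E') - 1 / (F * F'))"]
    by (simp add: abs_mult)
  finally show ?thesis
    using 1 2 by (simp add: algebra_simps E_def E'_def F_def F'_def d_def e_def)
qed

section \<open>Exact integrals over horospheres\<close>

text \<open>Polar coordinates without angles: both measures are compared on half-lines, where the
  area of a disc gives the value. The minus sign turns the upper half-lines of the uniqueness
  theorem into discs of finite measure.\<close>

lemma distr_norm_sq:
  "distr (lborel :: (real \<times> real) measure) borel (\<lambda>p. - ((fst p)\<^sup>2 + (snd p)\<^sup>2))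
    = distr (density lborel (\<lambda>q. ennreal pi * indicator {0..} q)) borel uminus"
  (is "?M = ?N")
proof (rule measure_eqI_lessThan)
  have M: "emeasure ?M {s<..} = ennreal (pi * max 0 (- s))" for s
  proof -
    have [measurable]: "(\<lambda>p::real\<times>real. - ((fst p)\<^sup>2 + (snd p)\<^sup>2)) \<in> borel_measurable borel"
      by (intro borel_measurable_continuous_onI continuous_intros)
    have "emeasure ?M {s<..} = emeasure lborel ((\<lambda>p. - ((fst p)\<^sup>2 + (snd p)\<^sup>2)) -` {s<..} \<inter> space (lborel :: (real \<times> real) measure))"
      by (rule emeasure_distr) measurable
    also have "\<dots> = emeasure lborel {p :: real \<times> real. s < - ((fst p)\<^sup>2 + (snd p)\<^sup>2)}"
      by (rule arg_cong2[where f=emeasure]) auto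
    also have "{p :: real \<times> real. s < - ((fst p)\<^sup>2 + (snd p)\<^sup>2)} = ball 0 (sqrt (- s))"
    proof -
      have "s < - ((fst p)\<^sup>2 + (snd p)\<^sup>2) \<longleftrightarrow> norm p < sqrt (- s)" for p :: "real \<times> real"
        by (simp add: norm_prod_def) linarith
      then show ?thesis unfolding ball_def dist_norm diff_0 norm_minus_cancel by simp
    qed
    also have "emeasure lborel (ball (0 :: real \<times> real) (sqrt (- s))) = ennreal (pi * max 0 (- s))"
    proof (cases "s < 0")
      case True
      then show ?thesis by (simp add: emeasure_ball unit_ball_vol_2)
    next
      case False
      then have *: "ball (0 :: real \<times> real) (sqrt (- s)) = {}" by simp
      show ?thesis unfolding * using False by (simp add: max_def)
    qed
    finally show ?thesis .
  qed
  have N: "emeasure ?N {s<..} = ennreal (pi * max 0 (- s))" for s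
  proof -
    have [measurable]: "uminus -` {s<..} \<in> sets (borel :: real measure)"
      using measurable_sets[of uminus borel borel "{s<..}"] by simp
    have "emeasure ?N {s<..} = (\<integral>\<^sup>+q. ennreal pi * indicator {0..} q * indicator (uminus -` {s<..}) q \<partial>lborel)"
      by (simp add: emeasure_distr emeasure_density)
    also have "\<dots> = (\<integral>\<^sup>+q. ennreal pi * indicator {0..<- s} q \<partial>lborel)"
      by (intro nn_integral_cong) (auto simp: indicator_def)
    also have "\<dots> = ennreal pi * emeasure lborel {0..<- s}"
      by (simp add: nn_integral_cmult)
    also have "\<dots> = ennreal (pi * max 0 (- s))"
      by (auto simp: max_def ennreal_mult')
    finally show ?thesis .
  qed
  show "emeasure ?M {s<..} < \<infinity>" "emeasure ?M {s<..} = emeasure ?N {s<..}" for s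
    unfolding M N by simp_all
qed simp_all

lemma nn_integral_norm_sq:
  fixes h :: "real \<Rightarrow> ennreal"
  assumes [measurable]: "h \<in> borel_measurable borel"
  shows "(\<integral>\<^sup>+x1. \<integral>\<^sup>+x2. h ((x1 - z1)\<^sup>2 + (x2 - z2)\<^sup>2) \<partial>lborel \<partial>lborel)
    = ennreal pi * (\<integral>\<^sup>+q. h q * indicator {0..} q \<partial>lborel)"
proof -
  have m [measurable]: "(\<lambda>p::real\<times>real. - ((fst p)\<^sup>2 + (snd p)\<^sup>2)) \<in> borel_measurable borel"
    by (intro borel_measurable_continuous_onI continuous_intros)
  have m' [measurable]: "(\<lambda>p::real\<times>real. ((fst p)\<^sup>2 + (snd p)\<^sup>2)) \<in> borel_measurable borel"
    by (intro borel_measurable_continuous_onI continuous_intros)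
  have "(\<integral>\<^sup>+x1. \<integral>\<^sup>+x2. h ((x1 - z1)\<^sup>2 + (x2 - z2)\<^sup>2) \<partial>lborel \<partial>lborel)
     = (\<integral>\<^sup>+x1. \<integral>\<^sup>+x2. h ((x1 - z1)\<^sup>2 + x2\<^sup>2) \<partial>lborel \<partial>lborel)"
  proof (rule nn_integral_cong)
    show "(\<integral>\<^sup>+x2. h ((x1 - z1)\<^sup>2 + (x2 - z2)\<^sup>2) \<partial>lborel) = (\<integral>\<^sup>+x2. h ((x1 - z1)\<^sup>2 + x2\<^sup>2) \<partial>lborel)" for x1
      by (subst nn_integral_real_affine[where c=1 and t=z2]) auto
  qed
  also have "\<dots> = (\<integral>\<^sup>+x1. \<integral>\<^sup>+x2. h (x1\<^sup>2 + x2\<^sup>2) \<partial>lborel \<partial>lborel)"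
    by (subst nn_integral_real_affine[where c=1 and t=z1]) auto
  also have "\<dots> = (\<integral>\<^sup>+p. h ((fst p)\<^sup>2 + (snd p)\<^sup>2) \<partial>(lborel \<Otimes>\<^sub>M lborel))"
    by (subst lborel.nn_integral_fst[symmetric]) auto
  also have "\<dots> = (\<integral>\<^sup>+p. h ((fst p)\<^sup>2 + (snd p)\<^sup>2) \<partial>lborel)"
    by (simp add: lborel_prod)
  also have "\<dots> = (\<integral>\<^sup>+q. h (- q) \<partial>distr (lborel :: (real \<times> real) measure) borel (\<lambda>p. - ((fst p)\<^sup>2 + (snd p)\<^sup>2)))"
    by (subst nn_integral_distr[OF _ _]) (use m in \<open>simp_all add: add.commute\<close>)
  also have "\<dots> = (\<integral>\<^sup>+q. ennreal pi * (h q * indicator {0..} q) \<partial>lborel)"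
    unfolding distr_norm_sq
    by (subst nn_integral_distr) (auto simp: nn_integral_density mult_ac)
  finally show ?thesis by (simp add: nn_integral_cmult)
qed

lemma nn_integral_rho_radial:
  fixes h :: "real \<Rightarrow> real \<Rightarrow> ennreal"
  assumes [measurable]: "case_prod h \<in> borel_measurable (borel \<Otimes>\<^sub>M borel)"
  shows "(\<integral>\<^sup>+z. h (ln (snd (snd z))) ((fst z - c1)\<^sup>2 + (fst (snd z) - c2)\<^sup>2) \<partial>rho)
    = (\<integral>\<^sup>+v. ennreal pi * (\<integral>\<^sup>+q. h v q * indicator {0..} q \<partial>lborel) \<partial>lborel)"
proof -
  have "(\<integral>\<^sup>+z. h (ln (snd (snd z))) ((fst z - c1)\<^sup>2 + (fst (snd z) - c2)\<^sup>2) \<partial>rho)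
      = (\<integral>\<^sup>+v. \<integral>\<^sup>+x1. \<integral>\<^sup>+x2. h v ((x1 - c1)\<^sup>2 + (x2 - c2)\<^sup>2) \<partial>lborel \<partial>lborel \<partial>lborel)"
    by (subst nn_integral_rho) auto
  also have "\<dots> = (\<integral>\<^sup>+v. ennreal pi * (\<integral>\<^sup>+q. h v q * indicator {0..} q \<partial>lborel) \<partial>lborel)"
    by (intro nn_integral_cong nn_integral_norm_sq) measurable
  finally show ?thesis .
qed

lemma nn_integral_rho_product:
  fixes \<phi> \<psi> :: "real \<Rightarrow> ennreal"
  assumes [measurable]: "\<phi> \<in> borel_measurable borel" "\<psi> \<in> borel_measurable borel"
  shows "(\<integral>\<^sup>+z. \<phi> (ln (snd (snd z))) * \<psi> ((fst z - c1)\<^sup>2 + (fst (snd z) - c2)\<^sup>2) \<partial>rho)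
    = ennreal pi * (\<integral>\<^sup>+v. \<phi> v \<partial>lborel) * (\<integral>\<^sup>+q. \<psi> q * indicator {0..} q \<partial>lborel)"
proof -
  have "(\<integral>\<^sup>+z. \<phi> (ln (snd (snd z))) * \<psi> ((fst z - c1)\<^sup>2 + (fst (snd z) - c2)\<^sup>2) \<partial>rho)
    = (\<integral>\<^sup>+v. ennreal pi * (\<integral>\<^sup>+q. \<phi> v * \<psi> q * indicator {0..} q \<partial>lborel) \<partial>lborel)"
    by (rule nn_integral_rho_radial) measurable
  also have "\<dots> = (\<integral>\<^sup>+v. (ennreal pi * (\<integral>\<^sup>+q. \<psi> q * indicator {0..} q \<partial>lborel)) * \<phi> v \<partial>lborel)"
    by (intro nn_integral_cong) (simp add: nn_integral_cmult mult_ac)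
  finally show ?thesis by (subst (asm) nn_integral_cmult) (simp_all add: mult_ac)
qed

lemma nn_integral_even:
  fixes f :: "real \<Rightarrow> ennreal"
  assumes [measurable]: "f \<in> borel_measurable borel"
  shows "(\<integral>\<^sup>+v. f \<bar>v\<bar> \<partial>lborel) = 2 * (\<integral>\<^sup>+v. f v * indicator {0..} v \<partial>lborel)"
proof -
  have "(\<integral>\<^sup>+v. f \<bar>v\<bar> \<partial>lborel) = (\<integral>\<^sup>+v. f v * indicator {0..} v + f (- v) * indicator {0..} (- v) \<partial>lborel)"
  proof (rule nn_integral_cong_AE)
    show "AE v in lborel. f \<bar>v\<bar> = f v * indicator {0..} v + f (- v) * indicator {0..} (- v)"
      using AE_lborel_singleton[of 0] by eventually_elim (auto simp: indicator_def)
  qed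
  also have "\<dots> = (\<integral>\<^sup>+v. f v * indicator {0..} v \<partial>lborel) + (\<integral>\<^sup>+v. f (- v) * indicator {0..} (- v) \<partial>lborel)"
    by (intro nn_integral_add) measurable
  also have "(\<integral>\<^sup>+v. f (- v) * indicator {0..} (- v) \<partial>lborel) = (\<integral>\<^sup>+v. f v * indicator {0..} v \<partial>lborel)"
    by (subst (2) nn_integral_real_affine[where c="-1" and t=0]) auto
  finally show ?thesis by (simp add: mult_2)
qed

lemma nn_integral_powr_tail:
  assumes "0 < s" "1 < \<alpha>"
  shows "(\<integral>\<^sup>+q. ennreal ((q + s) powr (- \<alpha>)) * indicator {0..} q \<partial>lborel) = ennreal (s powr (1 - \<alpha>) / (\<alpha> - 1))"
proof -
  have "(\<integral>\<^sup>+q. ennreal ((q + s) powr (- \<alpha>)) * indicator {0..} q \<partial>lborel)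
     = 0 - (- ((0 + s) powr (1 - \<alpha>) / (\<alpha> - 1)))"
  proof (rule nn_integral_FTC_atLeast)
    fix q :: real assume "0 \<le> q"
    then have "((\<lambda>q. (q + s) powr (1 - \<alpha>)) has_real_derivative (1 - \<alpha>) * (q + s) powr (1 - \<alpha> - 1) * 1) (at q)"
      using assms by (intro DERIV_chain2[OF has_real_derivative_powr]) (auto intro!: derivative_eq_intros)
    moreover have "- (1 / (\<alpha> - 1)) * ((1 - \<alpha>) * (q + s) powr (1 - \<alpha> - 1) * 1) = (q + s) powr (- \<alpha>)"
      using assms by (simp add: field_simps)
    ultimately have "((\<lambda>q. - (1 / (\<alpha> - 1)) * (q + s) powr (1 - \<alpha>)) has_real_derivative (q + s) powr (- \<alpha>)) (at q)"
      by (metis DERIV_cmult)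
    then
    show "((\<lambda>q. - ((q + s) powr (1 - \<alpha>) / (\<alpha> - 1))) has_real_derivative (q + s) powr (- \<alpha>)) (at q)"
      by simp
  next
    have "((\<lambda>q. (q + s) powr (1 - \<alpha>)) \<longlongrightarrow> 0) at_top"
      using assms by (intro tendsto_neg_powr) (auto, real_asymp)
    from tendsto_minus[OF tendsto_divide[OF this tendsto_const[of "\<alpha> - 1"]]]
    show "((\<lambda>q. - ((q + s) powr (1 - \<alpha>) / (\<alpha> - 1))) \<longlongrightarrow> 0) at_top"
      using assms by simp
  qed (use assms in auto)
  then show ?thesis by simp
qed

lemma nn_integral_powr_abs:
  assumes "0 < s" "1 < \<alpha>"
  shows "(\<integral>\<^sup>+v. ennreal ((\<bar>v\<bar> + s) powr (- \<alpha>)) \<partial>lborel) = ennreal (2 * s powr (1 - \<alpha>) / (\<alpha> - 1))"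
proof -
  have "(\<integral>\<^sup>+v. ennreal ((\<bar>v\<bar> + s) powr (- \<alpha>)) \<partial>lborel) = 2 * ennreal (s powr (1 - \<alpha>) / (\<alpha> - 1))"
    by (subst nn_integral_even[of "\<lambda>v. ennreal ((v + s) powr (- \<alpha>))"])
       (auto simp: nn_integral_powr_tail[OF assms])
  also have "\<dots> = ennreal (2 * (s powr (1 - \<alpha>) / (\<alpha> - 1)))"
    using assms by (subst ennreal_mult) auto
  finally show ?thesis by simp
qed

lemma hyp_dist_gone: "0 < a \<Longrightarrow> hyp_dist (x1, x2, a) gone
   = 2 * ln (sqrt (x1\<^sup>2 + x2\<^sup>2 + (a - 1)\<^sup>2) + sqrt (x1\<^sup>2 + x2\<^sup>2 + (a + 1)\<^sup>2)) - ln a - 2 * ln 2"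
  unfolding hyp_dist_def gone_def dist_pt dist_mirror_pt by simp

lemma dist_gone: "dist (x1, x2, a) gone = sqrt (x1\<^sup>2 + x2\<^sup>2 + (a - 1)\<^sup>2)"
  "dist (x1, x2, a) (mirror gone) = sqrt (x1\<^sup>2 + x2\<^sup>2 + (a + 1)\<^sup>2)"
  unfolding gone_def dist_pt dist_mirror_pt by simp_all

text \<open>As a function of the squared norm \<open>q\<close> of \<open>(x1, x2)\<close>, the distance to the identity has
  derivative \<open>1 / (E E')\<close>, so integrals of \<open>g(d) / (E E')\<close> over horospheres are exact.\<close>

lemma nn_integral_rho_hyp_dist:
  fixes g F :: "real \<Rightarrow> real"
  assumes g [measurable]: "g \<in> borel_measurable borel"
    and g0: "\<And>d. 0 < d \<Longrightarrow> 0 \<le> g d"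
    and F: "\<And>d. 0 < d \<Longrightarrow> (F has_real_derivative - g d) (at d)"
    and lim: "(F \<longlongrightarrow> 0) at_top"
  shows "(\<integral>\<^sup>+z. ennreal (g (hyp_dist z gone) / (dist z gone * dist z (mirror gone))) \<partial>rho)
    = (\<integral>\<^sup>+v. ennreal (pi * F \<bar>v\<bar>) \<partial>lborel)"
proof -
  define e e' where "e v q = sqrt (q + (exp v - 1)\<^sup>2)" and "e' v q = sqrt (q + (exp v + 1)\<^sup>2)" for v q :: real
  define \<eta> where "\<eta> v q = 2 * ln (e v q + e' v q) - v - 2 * ln 2" for v q
  have [measurable]: "case_prod \<eta> \<in> borel_measurable (borel \<Otimes>\<^sub>M borel)"
    "case_prod e \<in> borel_measurable (borel \<Otimes>\<^sub>M borel)" "case_prod e' \<in> borel_measurable (borel \<Otimes>\<^sub>M borel)"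
    unfolding \<eta>_def e_def e'_def by measurable
  let ?h = "\<lambda>v q. ennreal (g (\<eta> v q) / (e v q * e' v q))"
  have "(\<integral>\<^sup>+z. ennreal (g (hyp_dist z gone) / (dist z gone * dist z (mirror gone))) \<partial>rho)
      = (\<integral>\<^sup>+z. ?h (ln (snd (snd z))) ((fst z - 0)\<^sup>2 + (fst (snd z) - 0)\<^sup>2) \<partial>rho)"
    by (intro nn_integral_cong)
       (auto simp: space_rho G_def hyp_dist_gone dist_gone \<eta>_def e_def e'_def)
  also have "\<dots> = (\<integral>\<^sup>+v. ennreal pi * (\<integral>\<^sup>+q. ?h v q * indicator {0..} q \<partial>lborel) \<partial>lborel)"
    by (rule nn_integral_rho_radial) measurable
  also have "\<dots> = (\<integral>\<^sup>+v. ennreal (pi * F \<bar>v\<bar>) \<partial>lborel)"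
  proof (rule nn_integral_cong_AE)
    show "AE v in lborel. ennreal pi * (\<integral>\<^sup>+q. ?h v q * indicator {0..} q \<partial>lborel) = ennreal (pi * F \<bar>v\<bar>)"
      using AE_lborel_singleton[of 0]
    proof eventually_elim
      case (elim v)
      have ep: "0 < e v q" "0 < e' v q" if "0 \<le> q" for q
        using that elim by (auto simp: e_def e'_def intro!: add_nonneg_pos) (smt (verit) exp_gt_zero zero_less_power)
      \<comment> \<open>The point of the horosphere on the vertical axis is at distance
        \<open>|v|\<close>; this becomes the lower limit of integration.\<close>
      have \<eta>0: "\<eta> v 0 = \<bar>v\<bar>"
      proof (cases "0 \<le> v")
        case True
        then have "e v 0 + e' v 0 = 2 * exp v" by (auto simp: e_def e'_def)
        with True show ?thesis by (simp add: \<eta>_def ln_mult)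
      next
        case False
        then have "exp v \<le> 1" by simp
        then have "e v 0 + e' v 0 = 2" by (auto simp: e_def e'_def)
        with False show ?thesis by (simp add: \<eta>_def)
      qed
      have \<eta>d: "(\<eta> v has_real_derivative 1 / (e v q * e' v q)) (at q)" if "0 \<le> q" for q
      proof -
        have p: "0 < q + (exp v - 1)\<^sup>2" "0 < q + (exp v + 1)\<^sup>2"
          using ep[OF that] by (auto simp: e_def e'_def)
        have d: "(e v has_real_derivative 1 / (2 * e v q)) (at q)"
          "(e' v has_real_derivative 1 / (2 * e' v q)) (at q)"
          unfolding e_def e'_def using p by (auto intro!: derivative_eq_intros simp: field_simps)
        show ?thesis unfolding \<eta>_def
          using ep[OF that] by (auto intro!: derivative_eq_intros d add_pos_pos simp: divide_simps)
      qed
      have \<eta>pos: "0 < \<eta> v q" if "0 \<le> q" for q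
      proof -
        have "\<eta> v 0 \<le> \<eta> v q"
        proof (rule DERIV_nonneg_imp_nondecreasing[OF that])
          fix y :: real assume "0 \<le> y" "y \<le> q"
          then show "\<exists>d. (\<eta> v has_real_derivative d) (at y) \<and> 0 \<le> d"
            using \<eta>d[of y] ep[of y] by (intro exI[of _ "1 / (e v y * e' v y)"]) auto
        qed
        then show ?thesis using \<eta>0 elim by simp
      qed
      have lim\<eta>: "filterlim (\<eta> v) at_top at_top"
        unfolding \<eta>_def e_def e'_def by real_asymp
      have "(\<integral>\<^sup>+q. ?h v q * indicator {0..} q \<partial>lborel) = 0 - (- F (\<eta> v 0))"
      proof (rule nn_integral_FTC_atLeast)
        fix q :: real assume q: "0 \<le> q"
        show "((\<lambda>q. - F (\<eta> v q)) has_real_derivative g (\<eta> v q) / (e v q * e' v q)) (at q)"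
          using DERIV_chain2[OF F[OF \<eta>pos[OF q]] \<eta>d[OF q]] by (auto intro!: derivative_eq_intros)
        show "0 \<le> g (\<eta> v q) / (e v q * e' v q)"
          using g0[OF \<eta>pos[OF q]] ep[OF q] by simp
      next
        show "((\<lambda>q. - F (\<eta> v q)) \<longlongrightarrow> 0) at_top"
          using filterlim_compose[OF lim lim\<eta>] tendsto_minus by fastforce
      qed measurable
      then show ?case by (simp add: \<eta>0 ennreal_mult')
    qed
  qed
  finally show ?thesis .
qed

text \<open>Integrating over a horosphere and then over log-heights lowers the exponent by one each
  time. The borderline \<open>\<alpha> = 1\<close> is the bare size of the kernel;
  \<open>\<alpha> = 2\<close> is the case with cancellation, and \<open>\<alpha> = 3/2\<close> is
  used for a single bump.\<close>

lemma nn_integral_hyp_dist_powr: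
  assumes s: "0 < s" and \<alpha>: "1 < \<alpha>"
  shows "(\<integral>\<^sup>+z. ennreal ((hyp_dist z gone + s) powr (- \<alpha> - 1) / (dist z gone * dist z (mirror gone))) \<partial>rho)
    = ennreal (2 * pi * s powr (1 - \<alpha>) / (\<alpha> * (\<alpha> - 1)))"
proof -
  let ?g = "\<lambda>d. (d + s) powr (- \<alpha> - 1)" and ?F = "\<lambda>d. (d + s) powr (- \<alpha>) / \<alpha>"
  have "(\<integral>\<^sup>+z. ennreal (?g (hyp_dist z gone) / (dist z gone * dist z (mirror gone))) \<partial>rho)
      = (\<integral>\<^sup>+v. ennreal (pi * ?F \<bar>v\<bar>) \<partial>lborel)"
  proof (rule nn_integral_rho_hyp_dist)
    fix d :: real assume d: "0 < d"
    have "((\<lambda>d. (d + s) powr (- \<alpha>)) has_real_derivative (- \<alpha>) * (d + s) powr (- \<alpha> - 1) * 1) (at d)"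
      using s d by (intro DERIV_chain2[OF has_real_derivative_powr]) (auto intro!: derivative_eq_intros)
    from DERIV_cdivide[OF this, of \<alpha>] \<alpha>
    show "(?F has_real_derivative - ?g d) (at d)" by simp
  next
    have "((\<lambda>d. (d + s) powr (- \<alpha>)) \<longlongrightarrow> 0) at_top"
      using \<alpha> by (intro tendsto_neg_powr) (auto, real_asymp)
    from tendsto_divide[OF this tendsto_const[of \<alpha>]] \<alpha>
    show "(?F \<longlongrightarrow> 0) at_top" by simp
  qed auto
  also have "\<dots> = (\<integral>\<^sup>+v. ennreal (pi / \<alpha>) * ennreal ((\<bar>v\<bar> + s) powr (- \<alpha>)) \<partial>lborel)"
    using \<alpha> by (intro nn_integral_cong) (simp flip: ennreal_mult'')
  also have "\<dots> = ennreal (pi / \<alpha>) * ennreal (2 * s powr (1 - \<alpha>) / (\<alpha> - 1))"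
    by (simp add: nn_integral_cmult nn_integral_powr_abs[OF s \<alpha>])
  also have "\<dots> = ennreal (2 * pi * s powr (1 - \<alpha>) / (\<alpha> * (\<alpha> - 1)))"
    using \<alpha> by (simp flip: ennreal_mult add: mult_ac)
  finally show ?thesis .
qed

lemma kernel_at_gone: "kernel_at t x gone = heat_kernel t x"
proof -
  have "ginv gone = gone" by (simp add: gone_def)
  then show ?thesis by (simp add: kernel_at_def gone_left) (simp add: gone_def)
qed

lemma AE_rho_neq: "AE z in rho. z \<noteq> c"
proof -
  have "emeasure rho {z \<in> G. z = c} = 0"
  proof (cases "c \<in> G")
    case True
    then have "{z \<in> G. z = c} = {c}" by auto
    moreover have "{c} \<in> sets rho" using True by (auto simp: sets_rho_iff)
    moreover obtain c1 c2 a where c: "c = (c1, c2, a)" by (metis surj_pair)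
    have "(\<integral>\<^sup>+x2. indicator {c} (x1, x2, exp v) \<partial>lborel) = (0 :: ennreal)" for x1 v
    proof -
      have "(\<integral>\<^sup>+x2. indicator {c} (x1, x2, exp v) \<partial>lborel) \<le> (\<integral>\<^sup>+x2. indicator {c2} x2 \<partial>lborel)"
        by (rule nn_integral_mono) (auto simp: c indicator_def)
      then show ?thesis by simp
    qed
    ultimately show ?thesis by (simp add: emeasure_rho)
  next
    case False
    then have *: "{z \<in> G. z = c} = {}" by auto
    show ?thesis unfolding * by simp
  qed
  moreover have "{z \<in> G. z = c} \<in> sets rho"
  proof -
    have "{z \<in> G. z = c} = G \<inter> {c}" by auto
    then show ?thesis by (auto simp: sets_rho_iff)
  qed
  ultimately show ?thesis
    by (intro AE_I[where N="{z \<in> G. z = c}"]) (auto simp: space_rho)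
qed

text \<open>The horosphere integral is exact and leaves, as a function of the log-height, the
  centred normal density of variance \<open>2 t\<close>.\<close>

lemma nn_integral_heat_kernel:
  assumes t: "0 < t"
  shows "(\<integral>\<^sup>+z. ennreal (heat_kernel t z) \<partial>rho) = 1"
proof -
  define \<kappa> where "\<kappa> = 1 / (4 * pi powr (3/2))"
  have \<kappa>: "0 < \<kappa>" by (simp add: \<kappa>_def)
  let ?g = "\<lambda>d. \<kappa> * gauss_factor t d" and ?F = "\<lambda>d. \<kappa> * (2 * t powr (- 1/2) * exp (- d\<^sup>2 / (4 * t)))"
  have tt: "t powr (-1/2) = t * t powr (-3/2)"
    using t powr_add[of t 1 "-3/2"] by simp
  have "(\<integral>\<^sup>+z. ennreal (heat_kernel t z) \<partial>rho)
      = (\<integral>\<^sup>+z. ennreal (?g (hyp_dist z gone) / (dist z gone * dist z (mirror gone))) \<partial>rho)"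
  proof (rule nn_integral_cong_AE)
    show "AE z in rho. ennreal (heat_kernel t z) = ennreal (?g (hyp_dist z gone) / (dist z gone * dist z (mirror gone)))"
      using AE_rho_neq[of gone] AE_space
      by eventually_elim (simp add: kernel_at_eq[OF _ gone_in_G] space_rho \<kappa>_def flip: kernel_at_gone)
  qed
  also have "\<dots> = (\<integral>\<^sup>+v. ennreal (pi * ?F \<bar>v\<bar>) \<partial>lborel)"
  proof (rule nn_integral_rho_hyp_dist)
    show "?g \<in> borel_measurable borel" unfolding gauss_factor_def by measurable
    show "(?F has_real_derivative - ?g d) (at d)" for d
      unfolding gauss_factor_def tt using t by (auto intro!: derivative_eq_intros simp: field_simps)
    show "(?F \<longlongrightarrow> 0) at_top" using t by real_asymp
  qed (use \<kappa> in \<open>auto simp: gauss_factor_nonneg\<close>)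
  also have "\<dots> = (\<integral>\<^sup>+v. ennreal (normal_density 0 (sqrt (2 * t)) v) \<partial>lborel)"
  proof (rule nn_integral_cong)
    fix v :: real
    have "pi * \<kappa> * 2 * t powr (-1/2) = 1 / (2 * (pi powr (1/2) * t powr (1/2)))"
    proof -
      have "pi powr (3/2) = pi * pi powr (1/2)" using powr_add[of pi 1 "1/2"] by simp
      moreover have "t powr (-1/2) = 1 / t powr (1/2)" by (simp add: powr_minus_divide)
      ultimately show ?thesis by (simp add: \<kappa>_def)
    qed
    also have "\<dots> = 1 / sqrt (2 * pi * (2 * t))"
      using t by (simp add: powr_half_sqrt real_sqrt_mult)
    finally have "pi * \<kappa> * 2 * t powr (-1/2) = 1 / sqrt (2 * pi * (2 * t))" .
    moreover have "pi * ?F \<bar>v\<bar> = (pi * \<kappa> * 2 * t powr (-1/2)) * exp (- v\<^sup>2 / (4 * t))"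
      by (simp add: mult_ac)
    ultimately show "ennreal (pi * ?F \<bar>v\<bar>) = ennreal (normal_density 0 (sqrt (2 * t)) v)"
      using t by (simp add: normal_density_def mult_ac)
  qed
  also have "\<dots> = ennreal 1"
    using t by (subst nn_integral_eq_integral) auto
  finally show ?thesis by simp
qed

text \<open>The horizontal integral of \<open>(q + L^2) powr (- (3/2))\<close> is
  \<open>2 / L\<close>, so the prefactor \<open>L\<close> makes the value scale-invariant.\<close>

lemma nn_integral_log_power_weight:
  assumes L: "0 < L"
  shows "(\<integral>\<^sup>+z. ennreal (L * (\<bar>ln (snd (snd z))\<bar> + 1) powr (- 2)
      * ((fst z)\<^sup>2 + (fst (snd z))\<^sup>2 + L\<^sup>2) powr (- (3/2))) \<partial>rho) = ennreal (4 * pi)"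
proof -
  let ?\<phi> = "\<lambda>v::real. ennreal ((\<bar>v\<bar> + 1) powr (- 2))" and ?\<psi> = "\<lambda>q. ennreal L * ennreal ((q + L\<^sup>2) powr (- (3/2)))"
  have "(\<integral>\<^sup>+z. ennreal (L * (\<bar>ln (snd (snd z))\<bar> + 1) powr (- 2)
      * ((fst z)\<^sup>2 + (fst (snd z))\<^sup>2 + L\<^sup>2) powr (- (3/2))) \<partial>rho)
    = (\<integral>\<^sup>+z. ?\<phi> (ln (snd (snd z))) * ?\<psi> ((fst z - 0)\<^sup>2 + (fst (snd z) - 0)\<^sup>2) \<partial>rho)"
    using L by (intro nn_integral_cong) (simp add: mult_ac flip: ennreal_mult)
  also have "\<dots> = ennreal pi * (\<integral>\<^sup>+v. ?\<phi> v \<partial>lborel) * (\<integral>\<^sup>+q. ?\<psi> q * indicator {0..} q \<partial>lborel)"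
    by (rule nn_integral_rho_product) measurable
  also have "(\<integral>\<^sup>+v. ?\<phi> v \<partial>lborel) = 2"
    using nn_integral_powr_abs[of 1 2] by simp
  also have "(\<integral>\<^sup>+q. ?\<psi> q * indicator {0..} q \<partial>lborel) = ennreal L * ennreal ((L\<^sup>2) powr (1 - 3/2) / (3/2 - 1))"
    using L nn_integral_powr_tail[of "L\<^sup>2" "3/2"] by (simp add: nn_integral_cmult mult.assoc)
  also have "\<dots> = 2"
    using L by (simp add: powr_minus_divide powr_half_sqrt flip: ennreal_mult)
  finally show ?thesis by (simp add: ennreal_mult' mult_ac)
qed

section \<open>The heat maximal operator\<close>

lemma sigma_finite_rho: "sigma_finite_measure rho"
proof -
  have "sigma_finite_measure (restrict_space lborel G)"
    by (rule sigma_finite_measure_restrict_space[OF lborel.sigma_finite_measure_axioms]) simp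
  then interpret R: sigma_finite_measure "restrict_space lborel G" .
  have m: "(\<lambda>(x1::real, x2::real, a::real). ennreal (1 / a)) \<in> borel_measurable borel"
    unfolding borel_prod[symmetric] by measurable
  show ?thesis
    unfolding rho_def
    by (subst R.sigma_finite_iff_density_finite)
       (use m in \<open>auto intro!: measurable_restrict_space1 AE_I2\<close>)
qed

interpretation rho: sigma_finite_measure rho by (rule sigma_finite_rho)

lemma hyp_dist_measurable [measurable (raw)]:
  assumes [measurable]: "f \<in> borel_measurable M" "g \<in> borel_measurable M"
  shows "(\<lambda>w. hyp_dist (f w) (g w)) \<in> borel_measurable M"
proof -
  have "(\<lambda>p. hyp_dist (fst p) (snd p)) \<in> borel_measurable (borel :: (pt \<times> pt) measure)"
    unfolding hyp_dist_def mirror_def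
    by (intro borel_measurable_diff borel_measurable_times borel_measurable_ln borel_measurable_continuous_onI
        continuous_intros borel_measurable_const)
  from measurable_compose[OF borel_measurable_Pair[OF assms] this] show ?thesis by simp
qed

lemma dist_mirror_measurable [measurable (raw)]:
  assumes [measurable]: "f \<in> borel_measurable M" "g \<in> borel_measurable M"
  shows "(\<lambda>w. dist (f w) (mirror (g w))) \<in> borel_measurable M"
proof -
  have "(\<lambda>p. dist (fst p) (mirror (snd p))) \<in> borel_measurable (borel :: (pt \<times> pt) measure)"
    unfolding mirror_def by (intro borel_measurable_continuous_onI continuous_intros)
  from measurable_compose[OF borel_measurable_Pair[OF assms] this] show ?thesis by simp
qed

lemma modular_compose_measurable [measurable (raw)]:
  "f \<in> borel_measurable M \<Longrightarrow> (\<lambda>w. modular (f w)) \<in> borel_measurable M"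
  using measurable_compose[OF _ modular_measurable] .

lemma kernel_at_measurable [measurable (raw)]:
  assumes [measurable]: "f \<in> measurable M rho" "g \<in> measurable M rho"
  shows "(\<lambda>w. kernel_at t (f w) (g w)) \<in> borel_measurable M"
proof -
  have [measurable]: "f \<in> borel_measurable M" "g \<in> borel_measurable M"
  proof -
    have "id \<in> measurable rho borel" by measurable
    from measurable_compose[OF assms(1) this] measurable_compose[OF assms(2) this]
    show "f \<in> borel_measurable M" "g \<in> borel_measurable M" by (simp_all)
  qed
  have "kernel_at t (f w) (g w) = modular (g w) * (1 / (8 * pi powr (3/2)) * modular (ginv (g w) \<cdot> f w) powr (1/2)
     * (if hyp_dist (f w) (g w) = 0 then 1 else hyp_dist (f w) (g w) / sinh (hyp_dist (f w) (g w)))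
     * t powr (- 3/2) * exp (- (hyp_dist (f w) (g w))\<^sup>2 / (4 * t)))" if "w \<in> space M" for w
    using that measurable_space[OF assms(1)] measurable_space[OF assms(2)]
    by (simp add: kernel_at_def heat_kernel_def radius_eq_hyp_dist space_rho)
  moreover have "(\<lambda>w. modular (g w) * (1 / (8 * pi powr (3/2)) * modular (ginv (g w) \<cdot> f w) powr (1/2)
     * (if hyp_dist (f w) (g w) = 0 then 1 else hyp_dist (f w) (g w) / sinh (hyp_dist (f w) (g w)))
     * t powr (- 3/2) * exp (- (hyp_dist (f w) (g w))\<^sup>2 / (4 * t)))) \<in> borel_measurable M"
    unfolding sinh_field_def by measurable
  ultimately show ?thesis
    by (subst measurable_cong) auto
qed

lemma heat_kernel_measurable [measurable]: "heat_kernel t \<in> borel_measurable rho"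
proof -
  have "(\<lambda>z. kernel_at t z gone) \<in> borel_measurable rho"
    by (rule kernel_at_measurable) (auto simp: space_rho gone_in_G)
  then show ?thesis by (simp add: kernel_at_gone[abs_def])
qed

lemma gmult_ginv_ginv: "x \<in> G \<Longrightarrow> z \<in> G \<Longrightarrow> x \<cdot> ginv (ginv z \<cdot> x) = z"
  by (cases x; cases z) (auto simp: G_def field_simps)

lemma convolution_heat_eq:
  assumes x: "x \<in> G" and f [measurable]: "f \<in> borel_measurable rho"
  shows "Defs.convolution f (\<lambda>y. complex_of_real (heat_kernel t y)) x = (\<integral>z. f z * complex_of_real (kernel_at t x z) \<partial>rho)"
proof -
  have xg: "(\<lambda>y. x \<cdot> ginv y) \<in> measurable rho rho"
  proof (rule measurableI)
    show "x \<cdot> ginv z \<in> space rho" if "z \<in> space rho" for z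
      using that x by (auto simp: space_rho gmult_closed ginv_closed)
    have "(\<lambda>y. x \<cdot> (ginv y \<cdot> gone)) \<in> borel_measurable rho"
      by (rule measurable_compose[OF _ gmult_left_measurable]) measurable
    then have "(\<lambda>y. x \<cdot> ginv y) \<in> borel_measurable rho" by (simp add: gone_right)
    from measurable_sets[OF this] show "(\<lambda>y. x \<cdot> ginv y) -` S \<inter> space rho \<in> sets rho" if "S \<in> sets rho" for S
      using that by (auto simp: sets_rho_iff)
  qed
  note T = inverse_translate_measurable[OF x]
  let ?F = "\<lambda>y. f (x \<cdot> ginv y) * complex_of_real (heat_kernel t y)"
  have F [measurable]: "?F \<in> borel_measurable rho"
    using measurable_compose[OF xg f] by measurable
  have FT [measurable]: "(\<lambda>z. ?F (ginv z \<cdot> x)) \<in> borel_measurable rho"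
    using measurable_compose[OF T F] .
  have "(\<integral>y. ?F y \<partial>rho) = (\<integral>y. ?F y \<partial>distr (density rho (\<lambda>z. ennreal (modular z))) rho (\<lambda>z. ginv z \<cdot> x))"
    by (subst rho_inverse_translate[OF x]) (rule refl)
  also have "\<dots> = (\<integral>z. ?F (ginv z \<cdot> x) \<partial>density rho (\<lambda>z. ennreal (modular z)))"
    by (rule integral_distr) (use T in auto)
  also have "\<dots> = (\<integral>z. modular z *\<^sub>R ?F (ginv z \<cdot> x) \<partial>rho)"
    by (rule integral_density) (auto simp: modular_eq)
  also have "\<dots> = (\<integral>z. f z * complex_of_real (kernel_at t x z) \<partial>rho)"
    by (rule Bochner_Integration.integral_cong)
       (auto simp: space_rho gmult_ginv_ginv[OF x] kernel_at_def scaleR_conv_of_real)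
  finally show ?thesis by (simp add: Defs.convolution_def)
qed

lemma nn_integral_kernel_at:
  assumes x: "x \<in> G" and t: "0 < t"
  shows "(\<integral>\<^sup>+z. ennreal (kernel_at t x z) \<partial>rho) = 1"
proof -
  note T = inverse_translate_measurable[OF x]
  have [measurable]: "(\<lambda>z. heat_kernel t (ginv z \<cdot> x)) \<in> borel_measurable rho"
    using measurable_compose[OF T heat_kernel_measurable] .
  have "1 = (\<integral>\<^sup>+y. ennreal (heat_kernel t y) \<partial>distr (density rho (\<lambda>z. ennreal (modular z))) rho (\<lambda>z. ginv z \<cdot> x))"
    by (subst rho_inverse_translate[OF x, symmetric]) (simp add: nn_integral_heat_kernel[OF t])
  also have "\<dots> = (\<integral>\<^sup>+z. ennreal (modular z) * ennreal (heat_kernel t (ginv z \<cdot> x)) \<partial>rho)"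
    using T by (subst nn_integral_distr) (auto simp: nn_integral_density)
  also have "\<dots> = (\<integral>\<^sup>+z. ennreal (kernel_at t x z) \<partial>rho)"
    by (intro nn_integral_cong) (simp add: kernel_at_def modular_eq ennreal_mult''[symmetric] flip: ennreal_mult')
  finally show ?thesis ..
qed

definition heat_avg :: "(pt \<Rightarrow> complex) \<Rightarrow> pt \<Rightarrow> real \<Rightarrow> complex" where
  "heat_avg f x t = (\<integral>z. f z * complex_of_real (kernel_at t x z) \<partial>rho)"

lemma heat_maximal_eq:
  "x \<in> G \<Longrightarrow> f \<in> borel_measurable rho \<Longrightarrow> heat_maximal f x = (SUP t\<in>{0<..}. ennreal (cmod (heat_avg f x t)))"
  by (simp add: heat_maximal_def convolution_heat_eq heat_avg_def)

lemma kernel_at_section_measurable: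
  assumes "x \<in> G"
  shows "kernel_at t x \<in> borel_measurable rho"
proof -
  have "(\<lambda>_. x) \<in> measurable rho rho" using assms by (intro measurable_const) (simp add: space_rho)
  from kernel_at_measurable[OF this measurable_ident_sets[OF refl]] show ?thesis .
qed

lemma integrable_kernel_at:
  assumes f: "integrable rho f" and x: "x \<in> G" and t: "0 < t"
  shows "integrable rho (\<lambda>z. f z * complex_of_real (kernel_at t x z))"
proof (rule Bochner_Integration.integrable_bound)
  show "integrable rho (\<lambda>z. (t powr (- 3/2) * exp t / (snd (snd x))\<^sup>2) * cmod (f z))"
    using f by simp
  have [measurable]: "f \<in> borel_measurable rho" using f by simp
  note kernel_at_section_measurable[OF x, measurable]
  show "(\<lambda>z. f z * complex_of_real (kernel_at t x z)) \<in> borel_measurable rho"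
    by measurable
  show "AE z in rho. norm (f z * complex_of_real (kernel_at t x z)) \<le> norm ((t powr (- 3/2) * exp t / (snd (snd x))\<^sup>2) * cmod (f z))"
  proof (rule AE_I2)
    fix z assume "z \<in> space rho"
    then have z: "z \<in> G" by (simp add: space_rho)
    have "cmod (f z) * kernel_at t x z \<le> cmod (f z) * (t powr (- 3/2) * exp t / (snd (snd x))\<^sup>2)"
      using kernel_at_bounded[OF t x z] by (intro mult_left_mono) auto
    then show "norm (f z * complex_of_real (kernel_at t x z)) \<le> norm ((t powr (- 3/2) * exp t / (snd (snd x))\<^sup>2) * cmod (f z))"
      using kernel_at_nonneg[OF t x z] by (simp add: norm_mult abs_mult mult_ac)
  qed
qed

text \<open>Right-continuity in time is enough for approximation by rational times from above;
  \<open>kernel_at_bounded\<close> on \<open>[t, t + 1]\<close> supplies the dominating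
  function.\<close>

lemma heat_avg_continuous:
  assumes f: "integrable rho f" and x: "x \<in> G" and t: "0 < t"
    and s: "s \<longlonglongrightarrow> t" "\<And>n. t \<le> s n" "\<And>n. s n \<le> t + 1"
  shows "(\<lambda>n. heat_avg f x (s n)) \<longlonglongrightarrow> heat_avg f x t"
  unfolding heat_avg_def
proof (rule integral_dominated_convergence)
  have s0: "0 < s n" for n using s(2)[of n] t by linarith
  have [measurable]: "f \<in> borel_measurable rho" using f by simp
  note kernel_at_section_measurable[OF x, measurable]
  show "(\<lambda>z. f z * complex_of_real (kernel_at t x z)) \<in> borel_measurable rho"
    "\<And>n. (\<lambda>z. f z * complex_of_real (kernel_at (s n) x z)) \<in> borel_measurable rho"
    by measurable
  show "integrable rho (\<lambda>z. (t powr (- 3/2) * exp (t + 1) / (snd (snd x))\<^sup>2) * cmod (f z))"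
    using f by simp
  show "AE z in rho. (\<lambda>n. f z * complex_of_real (kernel_at (s n) x z)) \<longlonglongrightarrow> f z * complex_of_real (kernel_at t x z)"
    unfolding kernel_at_def heat_kernel_def using t by (auto intro!: AE_I2 tendsto_intros s(1))
  show "AE z in rho. norm (f z * complex_of_real (kernel_at (s n) x z)) \<le> (t powr (- 3/2) * exp (t + 1) / (snd (snd x))\<^sup>2) * cmod (f z)" for n
  proof (rule AE_I2)
    fix z assume "z \<in> space rho"
    then have z: "z \<in> G" by (simp add: space_rho)
    have "kernel_at (s n) x z \<le> s n powr (- 3/2) * exp (s n) / (snd (snd x))\<^sup>2" by (rule kernel_at_bounded[OF s0 x z])
    also have "\<dots> \<le> t powr (- 3/2) * exp (t + 1) / (snd (snd x))\<^sup>2"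
      using s(2,3)[of n] t by (intro divide_right_mono mult_mono powr_mono2') auto
    finally have "cmod (f z) * kernel_at (s n) x z \<le> cmod (f z) * (t powr (- 3/2) * exp (t + 1) / (snd (snd x))\<^sup>2)"
      by (intro mult_left_mono) auto
    then show "norm (f z * complex_of_real (kernel_at (s n) x z)) \<le> (t powr (- 3/2) * exp (t + 1) / (snd (snd x))\<^sup>2) * cmod (f z)"
      using kernel_at_nonneg[OF s0 x z, of n] by (simp add: norm_mult mult_ac)
  qed
qed

text \<open>A countable supremum is what makes the maximal function measurable.\<close>

lemma heat_maximal_rational:
  assumes f: "integrable rho f" and x: "x \<in> G"
  shows "heat_maximal f x = (SUP t\<in>\<rat> \<inter> {0<..}. ennreal (cmod (heat_avg f x t)))"
proof -
  let ?S = "SUP t\<in>\<rat> \<inter> {0<..}. ennreal (cmod (heat_avg f x t))"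
  have "ennreal (cmod (heat_avg f x t)) \<le> ?S" if t: "0 < t" for t
  proof -
    have "\<exists>r\<in>\<rat>. t < r \<and> r < t + 1 / real (Suc n)" for n
      by (rule Rats_dense_in_real) simp
    then obtain r where r: "\<And>n. r n \<in> \<rat>" "\<And>n. t < r n" "\<And>n. r n < t + 1 / real (Suc n)"
      by metis
    have r1: "r n \<le> t + 1" for n
    proof -
      have "1 / real (Suc n) \<le> 1" by simp
      with r(3)[of n] show ?thesis by linarith
    qed
    have "r \<longlonglongrightarrow> t"
    proof (rule tendsto_sandwich[of "\<lambda>_. t" _ _ "\<lambda>n. t + 1 / real (Suc n)"])
      show "(\<lambda>n. t + 1 / real (Suc n)) \<longlonglongrightarrow> t"
        using tendsto_add[OF tendsto_const LIMSEQ_inverse_real_of_nat, of t] by (simp add: inverse_eq_divide)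
    qed (use r in \<open>auto intro!: always_eventually less_imp_le\<close>)
    then have "(\<lambda>n. heat_avg f x (r n)) \<longlonglongrightarrow> heat_avg f x t"
      using r r1 by (intro heat_avg_continuous[OF f x t]) (auto intro: less_imp_le)
    then have "(\<lambda>n. ennreal (cmod (heat_avg f x (r n)))) \<longlonglongrightarrow> ennreal (cmod (heat_avg f x t))"
      by (intro tendsto_ennrealI tendsto_norm)
    moreover have "ennreal (cmod (heat_avg f x (r n))) \<le> ?S" for n
      using r(1)[of n] less_trans[OF t r(2)[of n]] by (intro SUP_upper) auto
    ultimately show ?thesis by (auto intro: LIMSEQ_le_const2)
  qed
  then have "(SUP t\<in>{0<..}. ennreal (cmod (heat_avg f x t))) \<le> ?S"
    by (intro SUP_least) auto
  moreover have "?S \<le> (SUP t\<in>{0<..}. ennreal (cmod (heat_avg f x t)))"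
    by (intro SUP_subset_mono) auto
  ultimately show ?thesis
    using x f by (simp add: heat_maximal_eq)
qed

lemma heat_maximal_measurable:
  assumes f: "integrable rho f"
  shows "heat_maximal f \<in> borel_measurable rho"
proof -
  have [measurable]: "f \<in> borel_measurable rho" using f by simp
  have [measurable]: "(\<lambda>x. heat_avg f x t) \<in> borel_measurable rho" for t
    unfolding heat_avg_def by measurable
  have "(\<lambda>x. SUP t\<in>\<rat> \<inter> {0<..}. ennreal (cmod (heat_avg f x t))) \<in> borel_measurable rho"
    by (intro borel_measurable_SUP) (auto intro: countable_Int1 countable_rat)
  then show ?thesis
    by (subst measurable_cong) (auto simp: heat_maximal_rational[OF f] space_rho)
qed

section \<open>Bounding the maximal function by kernel size, by mass one, and by
  cancellation\<close>

lemma heat_maximal_le_kernel: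
  assumes f: "integrable rho f" and x: "x \<in> G"
    and S: "\<And>t. 0 < t \<Longrightarrow> AE z in rho. f z \<noteq> 0 \<longrightarrow> ennreal (kernel_at t x z) \<le> S z"
  shows "heat_maximal f x \<le> (\<integral>\<^sup>+z. ennreal (cmod (f z)) * S z \<partial>rho)"
proof -
  have "ennreal (cmod (heat_avg f x t)) \<le> (\<integral>\<^sup>+z. ennreal (cmod (f z)) * S z \<partial>rho)" if t: "0 < t" for t
  proof -
    have "ennreal (cmod (heat_avg f x t)) \<le> (\<integral>\<^sup>+z. ennreal (norm (f z * complex_of_real (kernel_at t x z))) \<partial>rho)"
      unfolding heat_avg_def by (rule integral_norm_bound_ennreal[OF integrable_kernel_at[OF f x t]])
    also have "\<dots> \<le> (\<integral>\<^sup>+z. ennreal (cmod (f z)) * S z \<partial>rho)"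
    proof (rule nn_integral_mono_AE)
      show "AE z in rho. ennreal (norm (f z * complex_of_real (kernel_at t x z))) \<le> ennreal (cmod (f z)) * S z"
        using S[OF t] AE_space
      proof eventually_elim
        case (elim z)
        then show ?case
          using kernel_at_nonneg[OF t x, of z]
          by (cases "f z = 0") (auto simp: norm_mult ennreal_mult space_rho intro!: mult_left_mono)
      qed
    qed
    finally show ?thesis .
  qed
  then show ?thesis using x f by (auto simp: heat_maximal_eq intro!: SUP_least)
qed

lemma heat_maximal_le_bound:
  assumes f: "integrable rho f" and x: "x \<in> G" and M: "AE z in rho. cmod (f z) \<le> M"
  shows "heat_maximal f x \<le> ennreal M"
proof -
  have "ennreal (cmod (heat_avg f x t)) \<le> ennreal M" if t: "0 < t" for t
  proof -
    note kernel_at_section_measurable[OF x, measurable]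
    have "ennreal (cmod (heat_avg f x t)) \<le> (\<integral>\<^sup>+z. ennreal (norm (f z * complex_of_real (kernel_at t x z))) \<partial>rho)"
      unfolding heat_avg_def by (rule integral_norm_bound_ennreal[OF integrable_kernel_at[OF f x t]])
    also have "\<dots> \<le> (\<integral>\<^sup>+z. ennreal M * ennreal (kernel_at t x z) \<partial>rho)"
    proof (rule nn_integral_mono_AE)
      show "AE z in rho. ennreal (norm (f z * complex_of_real (kernel_at t x z))) \<le> ennreal M * ennreal (kernel_at t x z)"
        using M AE_space
      proof eventually_elim
        case (elim z)
        then show ?case
          using kernel_at_nonneg[OF t x, of z]
          by (auto simp: norm_mult ennreal_mult space_rho intro!: mult_right_mono ennreal_leI)
      qed
    qed
    also have "\<dots> = ennreal M" by (simp add: nn_integral_cmult nn_integral_kernel_at[OF x t])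
    finally show ?thesis .
  qed
  then show ?thesis using x f by (auto simp: heat_maximal_eq intro!: SUP_least)
qed

text \<open>Because \<open>f\<close> has mean zero, the constant \<open>kernel_at t x c\<close> may
  be subtracted from the kernel, so only its oscillation over the support counts. \<open>Q\<close>
  is the same for all \<open>t\<close>, hence bounds the supremum.\<close>

lemma heat_maximal_le_cancel:
  assumes f: "integrable rho f" and x: "x \<in> G" and f0: "(\<integral>z. f z \<partial>rho) = 0" and c: "c \<in> G"
    and Q: "\<And>t. 0 < t \<Longrightarrow> AE z in rho. f z \<noteq> 0 \<longrightarrow> \<bar>kernel_at t x z - kernel_at t x c\<bar> \<le> Q"
  shows "heat_maximal f x \<le> ennreal Q * (\<integral>\<^sup>+z. ennreal (cmod (f z)) \<partial>rho)"
proof -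
  have "ennreal (cmod (heat_avg f x t)) \<le> ennreal Q * (\<integral>\<^sup>+z. ennreal (cmod (f z)) \<partial>rho)" if t: "0 < t" for t
  proof -
    have fm [measurable]: "f \<in> borel_measurable rho" using f by simp
    have i: "integrable rho (\<lambda>z. f z * complex_of_real (kernel_at t x z - kernel_at t x c))"
    proof -
      have "integrable rho (\<lambda>z. f z * complex_of_real (kernel_at t x c))" using f by simp
      from Bochner_Integration.integrable_diff[OF integrable_kernel_at[OF f x t] this]
      show ?thesis by (simp add: right_diff_distrib)
    qed
    have "(\<integral>z. f z * complex_of_real (kernel_at t x z - kernel_at t x c) \<partial>rho)
        = heat_avg f x t - (\<integral>z. f z * complex_of_real (kernel_at t x c) \<partial>rho)"
      unfolding heat_avg_def
      by (subst Bochner_Integration.integral_diff[symmetric]) (use integrable_kernel_at[OF f x t] f in \<open>auto simp: algebra_simps\<close>)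
    then have "heat_avg f x t = (\<integral>z. f z * complex_of_real (kernel_at t x z - kernel_at t x c) \<partial>rho)"
      by (simp add: f0)
    then have "ennreal (cmod (heat_avg f x t)) \<le> (\<integral>\<^sup>+z. ennreal (norm (f z * complex_of_real (kernel_at t x z - kernel_at t x c))) \<partial>rho)"
      using integral_norm_bound_ennreal[OF i] by simp
    also have "\<dots> \<le> (\<integral>\<^sup>+z. ennreal Q * ennreal (cmod (f z)) \<partial>rho)"
    proof (rule nn_integral_mono_AE)
      show "AE z in rho. ennreal (norm (f z * complex_of_real (kernel_at t x z - kernel_at t x c))) \<le> ennreal Q * ennreal (cmod (f z))"
        using Q[OF t]
      proof eventually_elim
        case (elim z)
        have "norm (f z * complex_of_real (kernel_at t x z - kernel_at t x c)) = cmod (f z) * \<bar>kernel_at t x z - kernel_at t x c\<bar>"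
          by (simp add: norm_mult flip: of_real_diff)
        also have "ennreal \<dots> \<le> ennreal Q * ennreal (cmod (f z))"
          using elim by (cases "f z = 0")
            (auto simp: ennreal_mult mult.commute[of "ennreal Q"] intro!: mult_left_mono ennreal_leI)
        finally show ?case .
      qed
    qed
    also have "\<dots> = ennreal Q * (\<integral>\<^sup>+z. ennreal (cmod (f z)) \<partial>rho)"
      by (rule nn_integral_cmult) measurable
    finally show ?thesis .
  qed
  then show ?thesis using x f by (auto simp: heat_maximal_eq intro!: SUP_least)
qed

lemma heat_maximal_cmult:
  assumes "integrable rho f" "x \<in> G"
  shows "heat_maximal (\<lambda>z. c * f z) x = ennreal (cmod c) * heat_maximal f x"
proof -
  have "heat_avg (\<lambda>z. c * f z) x t = c * heat_avg f x t" for t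
    unfolding heat_avg_def by (simp add: mult.assoc)
  then have "heat_maximal (\<lambda>z. c * f z) x = (SUP t\<in>{0<..}. ennreal (cmod c) * ennreal (cmod (heat_avg f x t)))"
    using assms by (simp add: heat_maximal_eq norm_mult ennreal_mult)
  then show ?thesis
    using assms by (simp add: heat_maximal_eq SUP_mult_left_ennreal)
qed

text \<open>For fixed \<open>t\<close> and \<open>x\<close> the heat average is continuous in L1,
  with a constant depending on both. This does no harm: the limit in \<open>n\<close> is taken
  first, each term is then replaced by its maximal function, and the supremum over \<open>t\<close>
  comes last.\<close>

lemma heat_maximal_series:
  assumes f: "integrable rho f" and g: "\<And>j. integrable rho (g j)" and x: "x \<in> G"
    and lim: "(\<lambda>n. \<integral>z. cmod (f z - (\<Sum>j<n. g j z)) \<partial>rho) \<longlonglongrightarrow> 0"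
  shows "heat_maximal f x \<le> (\<Sum>j. heat_maximal (g j) x)"
proof -
  let ?S = "\<Sum>j. heat_maximal (g j) x"
  have "ennreal (cmod (heat_avg f x t)) \<le> ?S" if t: "0 < t" for t
  proof -
    define B where "B = t powr (- 3/2) * exp t / (snd (snd x))\<^sup>2"
    have avg: "heat_avg (\<lambda>z. f z - (\<Sum>j<n. g j z)) x t = heat_avg f x t - (\<Sum>j<n. heat_avg (g j) x t)" for n
      unfolding heat_avg_def
      using integrable_kernel_at[OF f x t] integrable_kernel_at[OF g x t]
      by (simp add: left_diff_distrib sum_distrib_right Bochner_Integration.integral_diff)
    have bd: "cmod (heat_avg f x t - (\<Sum>j<n. heat_avg (g j) x t)) \<le> B * (\<integral>z. cmod (f z - (\<Sum>j<n. g j z)) \<partial>rho)" for n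
    proof -
      let ?d = "\<lambda>z. f z - (\<Sum>j<n. g j z)"
      have d: "integrable rho ?d" using f g by simp
      have "cmod (heat_avg ?d x t) \<le> (\<integral>z. cmod (?d z * complex_of_real (kernel_at t x z)) \<partial>rho)"
        unfolding heat_avg_def by (rule integral_norm_bound)
      also have "\<dots> \<le> (\<integral>z. B * cmod (?d z) \<partial>rho)"
      proof (rule integral_mono)
        show "integrable rho (\<lambda>z. cmod (?d z * complex_of_real (kernel_at t x z)))"
          using integrable_kernel_at[OF d x t] by (rule integrable_norm)
        show "integrable rho (\<lambda>z. B * cmod (?d z))" using d by simp
        fix z assume "z \<in> space rho"
        then have z: "z \<in> G" by (simp add: space_rho)
        have "cmod (?d z) * kernel_at t x z \<le> cmod (?d z) * B"
          using kernel_at_bounded[OF t x z] unfolding B_def by (intro mult_left_mono) auto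
        then show "cmod (?d z * complex_of_real (kernel_at t x z)) \<le> B * cmod (?d z)"
          using kernel_at_nonneg[OF t x z] by (simp add: norm_mult mult_ac)
      qed
      finally show ?thesis unfolding avg by simp
    qed
    have "(\<lambda>n. heat_avg f x t - (\<Sum>j<n. heat_avg (g j) x t)) \<longlonglongrightarrow> 0"
    proof (rule Lim_null_comparison)
      show "\<forall>\<^sub>F n in sequentially. norm (heat_avg f x t - (\<Sum>j<n. heat_avg (g j) x t)) \<le> B * (\<integral>z. cmod (f z - (\<Sum>j<n. g j z)) \<partial>rho)"
        using bd by simp
      show "(\<lambda>n. B * (\<integral>z. cmod (f z - (\<Sum>j<n. g j z)) \<partial>rho)) \<longlonglongrightarrow> 0"
        using tendsto_mult_left[OF lim, of B] by simp
    qed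
    then have "(\<lambda>n. \<Sum>j<n. heat_avg (g j) x t) \<longlonglongrightarrow> heat_avg f x t"
      using tendsto_diff[OF tendsto_const[of "heat_avg f x t"]] by fastforce
    then have l: "(\<lambda>n. ennreal (cmod (\<Sum>j<n. heat_avg (g j) x t))) \<longlonglongrightarrow> ennreal (cmod (heat_avg f x t))"
      by (intro tendsto_ennrealI tendsto_norm)
    have "ennreal (cmod (\<Sum>j<n. heat_avg (g j) x t)) \<le> ?S" for n
    proof -
      have "ennreal (cmod (\<Sum>j<n. heat_avg (g j) x t)) \<le> ennreal (\<Sum>j<n. cmod (heat_avg (g j) x t))"
        by (intro ennreal_leI norm_sum)
      also have "\<dots> = (\<Sum>j<n. ennreal (cmod (heat_avg (g j) x t)))" by simp
      also have "\<dots> \<le> (\<Sum>j<n. heat_maximal (g j) x)"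
        using t x g by (intro sum_mono) (auto simp: heat_maximal_eq intro!: SUP_upper)
      also have "\<dots> \<le> ?S" by (intro sum_le_suminf) auto
      finally show ?thesis .
    qed
    then show ?thesis by (intro LIMSEQ_le_const2[OF l]) auto
  qed
  then show ?thesis using x f by (auto simp: heat_maximal_eq intro!: SUP_least)
qed

text \<open>The heat kernel acts by convolution from the right, so left translations commute with
  it. This is why every atom can be moved to the identity.\<close>

lemma heat_maximal_translate: "heat_maximal f (c \<cdot> x) = heat_maximal (\<lambda>z. f (c \<cdot> z)) x"
  by (simp add: heat_maximal_def Defs.convolution_def gmult_assoc)

section \<open>Pointwise kernel estimates\<close>

definition height :: "pt \<Rightarrow> real" where "height x = snd (snd x)"

definition horiz_norm_sq :: "pt \<Rightarrow> real" where "horiz_norm_sq x = (fst x)\<^sup>2 + (fst (snd x))\<^sup>2"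

text \<open>A Calderon-Zygmund set with centre \<open>c = (x1, x2, a)\<close>, side \<open>L\<close>
  and radius \<open>r\<close> becomes \<open>box_at_one (L / a) r\<close> under left translation by
  the inverse of \<open>c\<close>.\<close>

definition box_at_one :: "real \<Rightarrow> real \<Rightarrow> pt set" where
  "box_at_one L r = {z \<in> G. \<bar>fst z\<bar> \<le> L / 2 \<and> \<bar>fst (snd z)\<bar> \<le> L / 2 \<and> \<bar>ln (snd (snd z))\<bar> \<le> r}"

text \<open>Majorant of the oscillation of the kernel over a box around the identity. The first summand comes from
  the variation of the hyperbolic distance, the second from that of the Euclidean distances.\<close>

definition far_profile :: "real \<Rightarrow> real \<Rightarrow> pt \<Rightarrow> real" where
  "far_profile r L x = r * ((hyp_dist x gone + r) powr (- 3) / (dist x gone * dist x (mirror gone)))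
     + L * (\<bar>ln (snd (snd x))\<bar> + 1) powr (- 2) * ((fst x)\<^sup>2 + (fst (snd x))\<^sup>2 + L\<^sup>2) powr (- (3/2))"

lemma far_profile_measurable [measurable]: "far_profile r L \<in> borel_measurable borel"
  unfolding far_profile_def by measurable

lemma far_profile_nonneg: "0 \<le> r \<Longrightarrow> 0 \<le> L \<Longrightarrow> 0 \<le> far_profile r L x"
  by (auto simp: far_profile_def intro!: add_nonneg_nonneg mult_nonneg_nonneg divide_nonneg_nonneg)

text \<open>The first summand contributes \<open>r\<close> times \<open>pi / r\<close>, the second
  \<open>4 * pi\<close>. That \<open>r\<close> and \<open>L\<close> both cancel is the source of
  uniformity over all atoms.\<close>

lemma nn_integral_far_profile:
  assumes r: "0 < r" and L: "0 < L"
  shows "(\<integral>\<^sup>+x. ennreal (far_profile r L x) \<partial>rho) = ennreal (5 * pi)"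
proof -
  let ?p = "\<lambda>x. (hyp_dist x gone + r) powr (- 3) / (dist x gone * dist x (mirror gone))"
  let ?s = "\<lambda>x. L * (\<bar>ln (snd (snd x))\<bar> + 1) powr (- 2) * ((fst x)\<^sup>2 + (fst (snd x))\<^sup>2 + L\<^sup>2) powr (- (3/2))"
  have "(\<integral>\<^sup>+x. ennreal (far_profile r L x) \<partial>rho) = (\<integral>\<^sup>+x. ennreal r * ennreal (?p x) + ennreal (?s x) \<partial>rho)"
    unfolding far_profile_def using r L by (intro nn_integral_cong) (simp flip: ennreal_plus ennreal_mult)
  also have "\<dots> = ennreal r * (\<integral>\<^sup>+x. ennreal (?p x) \<partial>rho) + (\<integral>\<^sup>+x. ennreal (?s x) \<partial>rho)"
    by (subst nn_integral_add; (subst nn_integral_cmult)?) measurable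
  also have "(\<integral>\<^sup>+x. ennreal (?p x) \<partial>rho) = ennreal (2 * pi * r powr (1 - 2) / (2 * (2 - 1)))"
    using nn_integral_hyp_dist_powr[OF r, of 2] by simp
  also have "(\<integral>\<^sup>+x. ennreal (?s x) \<partial>rho) = ennreal (4 * pi)"
    by (rule nn_integral_log_power_weight[OF L])
  also have "ennreal r * ennreal (2 * pi * r powr (1 - 2) / (2 * (2 - 1))) = ennreal pi"
    using r by (simp add: powr_minus_divide flip: ennreal_mult)
  finally show ?thesis by (simp flip: ennreal_plus)
qed

lemma ln_perturb:
  assumes "\<bar>s' - s\<bar> \<le> s / 2" "0 < s"
  shows "\<bar>ln s' - ln s\<bar> \<le> 2 * \<bar>s' - s\<bar> / (s :: real)"
proof -
  have s': "s / 2 \<le> s'" "0 < s'" using assms by linarith+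
  have "ln s' - ln s \<le> (s' - s) / s"
    using ln_diff_le[of s' s] assms s' by simp
  also have "\<dots> \<le> 2 * \<bar>s' - s\<bar> / s"
    using assms abs_ge_self[of "s' - s"] abs_ge_zero[of "s' - s"]
    by (intro divide_right_mono) (simp_all del: abs_ge_self abs_ge_zero)
  finally have 1: "ln s' - ln s \<le> 2 * \<bar>s' - s\<bar> / s" .
  have "ln s - ln s' \<le> (s - s') / s'"
    using ln_diff_le[of s s'] assms s' by simp
  also have "\<dots> \<le> \<bar>s' - s\<bar> / (s / 2)"
    using assms s' by (intro frac_le) auto
  also have "\<dots> = 2 * \<bar>s' - s\<bar> / s" by simp
  finally show ?thesis using 1 by (rule_tac abs_leI) auto
qed

text \<open>Reflection is a Euclidean isometry, so \<open>E + E'\<close> moves by at most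
  \<open>2 * dist z gone\<close>; the other term is the change of log-height.\<close>

lemma hyp_dist_perturb:
  assumes G: "x \<in> G" "z \<in> G" and D: "4 * dist z gone \<le> dist x gone"
  shows "\<bar>hyp_dist x z - hyp_dist x gone\<bar> \<le> 8 * dist z gone / (dist x gone + dist x (mirror gone)) + \<bar>ln (snd (snd z))\<bar>"
proof -
  define S S0 where "S = dist x z + dist x (mirror z)" and "S0 = dist x gone + dist x (mirror gone)"
  have S0: "0 < S0" "2 * dist x gone \<le> S0"
    using dist_mirror_pos[OF G(1) gone_in_G] dist_less_mirror[OF G(1) gone_in_G] by (auto simp: S0_def intro: add_nonneg_pos)
  have a: "\<bar>dist x z - dist x gone\<bar> \<le> dist z gone"
    by (metis abs_dist_diff_le dist_commute)
  have "\<bar>dist x (mirror z) - dist x (mirror gone)\<bar> \<le> dist (mirror z) (mirror gone)"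
    by (metis abs_dist_diff_le dist_commute)
  then have b: "\<bar>dist x (mirror z) - dist x (mirror gone)\<bar> \<le> dist z gone" by (simp add: dist_mirror_mirror)
  from a b have S: "\<bar>S - S0\<bar> \<le> 2 * dist z gone" unfolding S_def S0_def by linarith
  then have "\<bar>ln S - ln S0\<bar> \<le> 2 * \<bar>S - S0\<bar> / S0"
    using S0 D by (intro ln_perturb) auto
  also have "\<dots> \<le> 2 * (2 * dist z gone) / S0"
    using S S0 by (intro divide_right_mono) auto
  finally have l: "\<bar>ln S - ln S0\<bar> \<le> 4 * dist z gone / S0" by simp
  have tri: "\<bar>2 * u - m\<bar> \<le> 2 * \<bar>u\<bar> + \<bar>m\<bar>" for u m :: real by linarith
  have "hyp_dist x z - hyp_dist x gone = 2 * (ln S - ln S0) - ln (snd (snd z))"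
    unfolding hyp_dist_def S_def S0_def by (simp add: gone_def)
  then have "\<bar>hyp_dist x z - hyp_dist x gone\<bar> \<le> 2 * \<bar>ln S - ln S0\<bar> + \<bar>ln (snd (snd z))\<bar>"
    by (simp only: tri)
  also have "\<dots> \<le> 2 * (4 * dist z gone / S0) + \<bar>ln (snd (snd z))\<bar>"
    using l by (intro add_right_mono mult_left_mono) auto
  finally show ?thesis by (simp add: S0_def)
qed

text \<open>This and the next two inequalities replace negative powers by the shifted ones of
  \<open>far_profile\<close>, which stay integrable when the estimate is extended to all of
  \<open>G\<close>.\<close>

lemma inv_cube_le:
  assumes "0 < r" "r \<le> (h::real)"
  shows "1 / h ^ 3 \<le> 8 * (h + r) powr (- 3)"
proof -
  have "(h + r) ^ 3 \<le> (2 * h) ^ 3" using assms by (intro power_mono) auto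
  then have "1 / h ^ 3 \<le> 8 * (1 / (h + r) ^ 3)"
    using assms by (simp add: field_simps)
  then show ?thesis using assms by (simp add: powr_minus_divide)
qed

lemma inv_square_le:
  assumes "1 \<le> h" "\<bar>v\<bar> \<le> (h::real)"
  shows "1 / h\<^sup>2 \<le> 4 * (\<bar>v\<bar> + 1) powr (- 2)"
proof -
  have "(\<bar>v\<bar> + 1)\<^sup>2 \<le> (2 * h)\<^sup>2" using assms by (intro power_mono) auto
  then have "1 / h\<^sup>2 \<le> 4 * (1 / (\<bar>v\<bar> + 1)\<^sup>2)"
    using assms by (simp add: field_simps)
  then show ?thesis by (simp add: powr_minus_divide)
qed

lemma inv_cube_norm_le:
  assumes "0 < w" "w \<le> 64 * E\<^sup>2" "E \<le> E'" "0 < (E::real)"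
  shows "1 / (E\<^sup>2 * E') \<le> 512 * w powr (- (3/2))"
proof -
  have "w powr (3/2) \<le> (64 * E\<^sup>2) powr (3/2)" using assms by (intro powr_mono2) auto
  also have "\<dots> = ((8 * E) powr 2) powr (3/2)" using assms by (simp add: power_mult_distrib)
  also have "\<dots> = (8 * E) powr 3" unfolding powr_powr by simp
  also have "\<dots> = 512 * (E\<^sup>2 * E)" using assms by (simp add: power_mult_distrib power3_eq_cube power2_eq_square)
  also have "\<dots> \<le> 512 * (E\<^sup>2 * E')" using assms by (intro mult_left_mono) auto
  finally have "w powr (3/2) \<le> 512 * (E\<^sup>2 * E')" .
  then show ?thesis using assms by (simp add: powr_minus_divide field_simps)
qed

lemma dist_gone_ge:
  assumes "x \<in> G"
  shows "horiz_norm_sq x \<le> (dist x gone)\<^sup>2" "horiz_norm_sq x \<le> (dist x (mirror gone))\<^sup>2" "height x \<le> dist x (mirror gone)"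
    "\<bar>height x - 1\<bar> \<le> dist x gone" "1 \<le> dist x (mirror gone)"
proof -
  obtain x1 x2 a where x: "x = (x1, x2, a)" by (metis surj_pair)
  have a: "0 < a" using assms by (simp add: x G_def)
  show "horiz_norm_sq x \<le> (dist x gone)\<^sup>2" "horiz_norm_sq x \<le> (dist x (mirror gone))\<^sup>2"
    by (auto simp: x horiz_norm_sq_def dist_gone)
  have "a\<^sup>2 \<le> x1\<^sup>2 + x2\<^sup>2 + (a + 1)\<^sup>2" "1\<^sup>2 \<le> x1\<^sup>2 + x2\<^sup>2 + (a + 1)\<^sup>2"
    using a by (auto simp: power2_sum intro!: add_increasing)
  then show "height x \<le> dist x (mirror gone)" "1 \<le> dist x (mirror gone)"
    unfolding x height_def dist_gone by (auto intro!: real_le_rsqrt)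
  show "\<bar>height x - 1\<bar> \<le> dist x gone"
    unfolding x height_def dist_gone by (auto intro!: real_le_rsqrt)
qed

lemma hyp_dist_gone_ge_ln: "x \<in> G \<Longrightarrow> \<bar>ln (height x)\<bar> \<le> hyp_dist x gone"
  using hyp_dist_ge_ln[OF _ gone_in_G, of x] by (simp add: gone_def height_def)

text \<open>Since the side is at least \<open>exp (2 * r)\<close>, the vertical extent of order
  \<open>exp r\<close> is smaller than the horizontal one.\<close>

lemma box_at_one_dist_large:
  assumes z: "z \<in> box_at_one L r" and r: "1 \<le> r" and L: "exp (2 * r) \<le> L"
  shows "dist z gone \<le> 2 * L"
proof -
  obtain z1 z2 b where e: "z = (z1, z2, b)" by (metis surj_pair)
  have b: "0 < b" and z1: "\<bar>z1\<bar> \<le> L / 2" and z2: "\<bar>z2\<bar> \<le> L / 2" and lb: "\<bar>ln b\<bar> \<le> r"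
    using z by (auto simp: e box_at_one_def G_def)
  have "b \<le> exp r" using lb b by (metis abs_le_D1 exp_le_cancel_iff exp_ln)
  moreover have "exp r \<le> exp (2 * r)" "1 \<le> exp r" using r by auto
  ultimately have "\<bar>b - 1\<bar> \<le> L" using L b by linarith
  moreover have "0 < L" using L less_le_trans[OF exp_gt_zero] by blast
  ultimately have "z1\<^sup>2 \<le> L\<^sup>2" "z2\<^sup>2 \<le> L\<^sup>2" "(b - 1)\<^sup>2 \<le> L\<^sup>2"
    using z1 z2 by (auto simp: abs_le_square_iff[symmetric])
  then have "z1\<^sup>2 + z2\<^sup>2 + (b - 1)\<^sup>2 \<le> (2 * L)\<^sup>2"
    unfolding power_mult_distrib by (simp; insert zero_le_power2[of L]; linarith)
  then show ?thesis unfolding e dist_gone using \<open>0 < L\<close> by (intro real_le_lsqrt) auto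
qed

text \<open>Horizontal distance \<open>8 L\<close> is four times the bound \<open>2 L\<close> for
  the distance from the identity to a point of the box, as \<open>kernel_at_diff\<close> requires.
  The final constant is \<open>32 * 1728 * 4096\<close>, rounded up.\<close>

lemma kernel_at_diff_large:
  assumes t: "0 < t" and x: "x \<in> G" and z: "z \<in> box_at_one L r" and r: "1 \<le> r" and L: "exp (2 * r) \<le> L"
    and q: "64 * L\<^sup>2 \<le> horiz_norm_sq x"
  shows "\<bar>kernel_at t x z - kernel_at t x gone\<bar> \<le> 10 ^ 9 * far_profile r L x"
proof -
  define E E' h where "E = dist x gone" and "E' = dist x (mirror gone)" and "h = hyp_dist x gone"
  have L0: "0 < L" using L less_le_trans[OF exp_gt_zero] by blast
  have zG: "z \<in> G" and lz: "\<bar>ln (snd (snd z))\<bar> \<le> r" using z by (auto simp: box_at_one_def)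
  have a: "0 < height x" using x by (auto simp: G_def height_def)
  have D: "dist z gone \<le> 2 * L" by (rule box_at_one_dist_large[OF z r L])
  have "(8 * L)\<^sup>2 \<le> E\<^sup>2" using q dist_gone_ge(1)[OF x] by (simp add: E_def power_mult_distrib)
  then have E8: "8 * L \<le> E" by (rule power2_le_imp_le) (simp add: E_def)
  have EE': "E < E'" unfolding E_def E'_def by (rule dist_less_mirror[OF x gone_in_G])
  have E0: "0 < E" "0 < E'" using E8 EE' L0 by auto
  have D4: "4 * dist z gone \<le> dist x gone" using D E8 by (simp add: E_def)
  have pert: "\<bar>hyp_dist x z - h\<bar> \<le> 2 * r"
  proof -
    have "8 * dist z gone / (E + E') \<le> 1"
      using D E8 EE' E0 by (simp add: divide_le_eq)
    then show ?thesis using hyp_dist_perturb[OF x zG D4] lz r unfolding E_def E'_def h_def by linarith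
  qed
  \<comment> \<open>A horizontal displacement \<open>8 L\<close> forces
    \<open>exp h >= E E' / a >= 8 L\<close>, because \<open>E'\<close> is at least the height
    \<open>a\<close>. With \<open>8 >= exp 2\<close> and \<open>L >= exp (2 * r)\<close> this makes
    \<open>h / 2\<close> exceed the variation \<open>1 + r\<close> of the distance over the
    box.\<close>
  have h2: "2 * r + 2 \<le> h"
  proof -
    have "exp (2 :: real) \<le> 8"
    proof -
      have "exp (2::real) = (exp 1)\<^sup>2" by (simp flip: exp_of_nat_mult)
      also have "\<dots> \<le> (272/100)\<^sup>2" using e_less_272 by (intro power_mono) auto
      finally show ?thesis by (simp add: power2_eq_square)
    qed
    have "exp (2 * r + 2) \<le> L * 8"
      using L \<open>exp 2 \<le> 8\<close> L0 unfolding exp_add by (intro mult_mono) auto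
    also have "\<dots> \<le> E * E' / height x"
      using mult_mono[OF E8 dist_gone_ge(3)[OF x]] a L0 E0 by (simp add: E'_def field_simps)
    also have "\<dots> \<le> (E + E')\<^sup>2 / (4 * height x)"
    proof -
      have "4 * (E * E') \<le> (E + E')\<^sup>2" using zero_le_power2[of "E - E'"] by (simp add: power2_eq_square algebra_simps)
      then show ?thesis using a by (simp add: field_simps)
    qed
    also have "\<dots> = exp h"
      unfolding h_def exp_hyp_dist[OF x gone_in_G] by (simp add: E_def E'_def height_def gone_def)
    finally show ?thesis by simp
  qed
  have hz: "hyp_dist x gone / 2 \<le> hyp_dist x z"
  proof -
    have "8 * dist z gone / (E + E') \<le> 1"
      using D E8 EE' E0 by (simp add: divide_le_eq)
    then have "\<bar>hyp_dist x z - h\<bar> \<le> 1 + r"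
      using hyp_dist_perturb[OF x zG D4] lz r unfolding E_def E'_def h_def by linarith
    then show ?thesis using h2 unfolding h_def by linarith
  qed
  have h0: "0 < h" using h2 r by linarith
  have "\<bar>kernel_at t x z - kernel_at t x gone\<bar> \<le> 32 * 1728 * (2 * r / (h ^ 3 * (E * E')) + dist z gone / (h\<^sup>2 * (E\<^sup>2 * E')))"
    using kernel_at_diff[OF t x zG gone_in_G _ D4 pert[unfolded h_def] hz] E0 unfolding E_def E'_def h_def by auto
  also have "\<dots> \<le> 32 * 1728 * (4096 * (r * ((h + r) powr (- 3) / (E * E')))
      + 4096 * (L * (\<bar>ln (height x)\<bar> + 1) powr (- 2) * (horiz_norm_sq x + L\<^sup>2) powr (- (3/2))))"
  proof (intro mult_left_mono add_mono)
    have "2 * r / (h ^ 3 * (E * E')) = 2 * r * (1 / h ^ 3) / (E * E')" by simp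
    also have "\<dots> \<le> 2 * r * (8 * (h + r) powr (- 3)) / (E * E')"
      using r h2 E0 by (intro divide_right_mono mult_left_mono inv_cube_le) auto
    also have "\<dots> \<le> 4096 * (r * ((h + r) powr (- 3) / (E * E')))"
      using r E0 by (simp add: divide_right_mono)
    finally show "2 * r / (h ^ 3 * (E * E')) \<le> 4096 * (r * ((h + r) powr (- 3) / (E * E')))" .
    have "dist z gone / (h\<^sup>2 * (E\<^sup>2 * E')) = dist z gone * (1 / h\<^sup>2) * (1 / (E\<^sup>2 * E'))" by simp
    also have "\<dots> \<le> (2 * L) * (4 * (\<bar>ln (height x)\<bar> + 1) powr (- 2)) * (512 * (horiz_norm_sq x + L\<^sup>2) powr (- (3/2)))"
    proof (intro mult_mono inv_square_le inv_cube_norm_le)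
      have "horiz_norm_sq x \<le> E\<^sup>2" using dist_gone_ge(1)[OF x] by (simp add: E_def)
      moreover have "0 \<le> L\<^sup>2" by simp
      ultimately show "horiz_norm_sq x + L\<^sup>2 \<le> 64 * E\<^sup>2" using q by linarith
      show "0 < horiz_norm_sq x + L\<^sup>2" using L0 by (auto simp: horiz_norm_sq_def intro!: add_nonneg_pos)
    qed (use D L0 h2 r hyp_dist_gone_ge_ln[OF x] E0 EE' in \<open>auto simp: h_def\<close>)
    finally show "dist z gone / (h\<^sup>2 * (E\<^sup>2 * E')) \<le> 4096 * (L * (\<bar>ln (height x)\<bar> + 1) powr (- 2) * (horiz_norm_sq x + L\<^sup>2) powr (- (3/2)))"
      by (simp add: mult_ac)
  qed auto
  also have "\<dots> = 32 * 1728 * 4096 * far_profile r L x"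
    unfolding far_profile_def by (simp add: E_def E'_def h_def height_def horiz_norm_sq_def algebra_simps)
  also have "\<dots> \<le> 10 ^ 9 * far_profile r L x"
    using r L0 by (intro mult_right_mono far_profile_nonneg) auto
  finally show ?thesis .
qed

section \<open>Estimates for boxes of small radius\<close>

lemma dist_gone_sinh:
  assumes x: "x \<in> G"
  shows "dist x gone = sqrt (height x) * (2 * sinh (hyp_dist x gone / 2))"
proof -
  define E E' h where "E = dist x gone" and "E' = dist x (mirror gone)" and "h = hyp_dist x gone"
  have a: "0 < height x" using x by (auto simp: G_def height_def)
  \<comment> \<open>Both half-exponentials are explicit, \<open>(E' + E) / (2 sqrt a)\<close> and
    \<open>(E' - E) / (2 sqrt a)\<close>, and \<open>E'\<close> drops out of their
    difference.\<close>
  have s: "sqrt (height x) * (exp (h / 2) - exp (- h / 2)) = E"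
  proof -
    have EE': "0 < E'" "E < E'" "0 \<le> E"
      unfolding E_def E'_def using dist_less_mirror[OF x gone_in_G] dist_mirror_pos[OF x gone_in_G] by auto
    have sq: "(exp (y / 2))\<^sup>2 = exp y" for y :: real
      by (simp add: power2_eq_square flip: exp_add)
    have "(exp (h / 2))\<^sup>2 = ((E + E') / (2 * sqrt (height x)))\<^sup>2"
      using exp_hyp_dist[OF x gone_in_G] a by (simp add: E_def E'_def h_def height_def gone_def power_divide power_mult_distrib sq)
    then have e1: "exp (h / 2) = (E + E') / (2 * sqrt (height x))"
      by (rule power2_eq_imp_eq) (use EE' a in simp_all)
    have "(exp (- h / 2))\<^sup>2 = exp (- h)" by (rule sq)
    also have "\<dots> = (E' - E)\<^sup>2 / (4 * height x * snd (snd gone))"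
      unfolding h_def E_def E'_def height_def by (rule exp_neg_hyp_dist[OF x gone_in_G])
    also have "\<dots> = ((E' - E) / (2 * sqrt (height x)))\<^sup>2"
      using a by (simp add: gone_def power_divide power_mult_distrib)
    finally have "(exp (- h / 2))\<^sup>2 = ((E' - E) / (2 * sqrt (height x)))\<^sup>2" .
    then have e2: "exp (- h / 2) = (E' - E) / (2 * sqrt (height x))"
      by (rule power2_eq_imp_eq) (use EE' a in simp_all)
    show ?thesis unfolding e1 e2 using a by (simp add: field_simps)
  qed
  then show ?thesis by (simp add: E_def h_def sinh_field_def algebra_simps)
qed

lemma hyp_dist_gone_le:
  assumes x: "x \<in> G"
  shows "sqrt (height x) * hyp_dist x gone \<le> dist x gone"
proof -
  have a: "0 < height x" using x by (auto simp: G_def height_def)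
  have "hyp_dist x gone \<le> 2 * sinh (hyp_dist x gone / 2)"
    using sinh_ge_self[of "hyp_dist x gone / 2"] hyp_dist_nonneg[OF x gone_in_G] by simp
  then show ?thesis
    unfolding dist_gone_sinh[OF x] using a by (intro mult_left_mono) auto
qed

text \<open>Origin of \<open>exp 9\<close>: each coordinate difference is at most
  \<open>exp 8 * r\<close>, the largest side of a small Calderon-Zygmund set at height one, and the
  diagonal costs \<open>sqrt 3 <= 2 <= exp 1\<close>.\<close>

lemma box_at_one_dist_small:
  assumes z: "z \<in> box_at_one (exp 8 * r) r" and r: "0 < r" "r \<le> 1"
  shows "dist z gone \<le> exp 9 * r"
proof -
  obtain z1 z2 b where e: "z = (z1, z2, b)" by (metis surj_pair)
  have b: "0 < b" and z1: "\<bar>z1\<bar> \<le> exp 8 * r / 2" and z2: "\<bar>z2\<bar> \<le> exp 8 * r / 2" and lb: "\<bar>ln b\<bar> \<le> r"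
    using z by (auto simp: e box_at_one_def G_def)
  have "b \<le> exp r" using lb b by (metis abs_le_D1 exp_le_cancel_iff exp_ln)
  moreover have "exp r \<le> 1 + r + r\<^sup>2" using r by (intro exp_bound) auto
  moreover have "r\<^sup>2 \<le> r" using r by (simp add: power2_eq_square mult_left_le)
  moreover have "exp (- r) \<le> b" using lb b by (metis abs_le_D2 exp_le_cancel_iff exp_ln minus_le_iff)
  moreover have "1 - r \<le> exp (- r)" using exp_ge_add_one_self[of "- r"] by simp
  ultimately have b1: "\<bar>b - 1\<bar> \<le> 2 * r" using r by (simp add: abs_le_iff)
  have "9 \<le> exp (8 :: real)" using exp_ge_add_one_self[of 8] by simp
  then have "2 * r \<le> exp 8 * r" using r by (intro mult_right_mono) auto
  moreover have "0 \<le> exp 8 * r" using r by simp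
  ultimately have "\<bar>z1\<bar> \<le> exp 8 * r" "\<bar>z2\<bar> \<le> exp 8 * r" "\<bar>b - 1\<bar> \<le> exp 8 * r" using b1 z1 z2 by linarith+
  then have "z1\<^sup>2 \<le> (exp 8 * r)\<^sup>2" "z2\<^sup>2 \<le> (exp 8 * r)\<^sup>2" "(b - 1)\<^sup>2 \<le> (exp 8 * r)\<^sup>2"
    using r by (auto simp: abs_le_square_iff[symmetric])
  then have "z1\<^sup>2 + z2\<^sup>2 + (b - 1)\<^sup>2 \<le> 3 * (exp 8 * r)\<^sup>2" by linarith
  also have "\<dots> \<le> (2 * (exp 8 * r))\<^sup>2" by (simp add: power_mult_distrib)
  also have "\<dots> \<le> (exp 1 * (exp 8 * r))\<^sup>2"
    using r exp_ge_add_one_self[of 1] by (intro power_mono mult_right_mono) auto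
  also have "exp 1 * (exp 8 * r) = exp 9 * r" by (simp flip: exp_add mult.assoc)
  finally show ?thesis unfolding e dist_gone using r by (intro real_le_lsqrt) auto
qed

text \<open>The distance to \<open>x\<close> varies over the box by at most
  \<open>9 * exp 9 * r\<close>: eight parts from the Euclidean distances, using
  \<open>E + E' >= 1\<close>, and one from the heights. The threshold \<open>18 * exp 9 * r\<close>
  is twice that, so the distance is at most halved.\<close>

lemma small_box_far:
  assumes x: "x \<in> G" and z: "z \<in> box_at_one (exp 8 * r) r" and r: "0 < r" "16 * exp 9 * r \<le> 1"
    and h: "18 * exp 9 * r \<le> hyp_dist x gone"
  shows "4 * dist z gone \<le> dist x gone" "\<bar>hyp_dist x z - hyp_dist x gone\<bar> \<le> 9 * exp 9 * r"
    "hyp_dist x gone / 2 \<le> hyp_dist x z" "x \<noteq> gone"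
proof -
  define P :: real where "P = exp 9"
  have P: "1 \<le> P" by (simp add: P_def)
  have zG: "z \<in> G" and lz: "\<bar>ln (snd (snd z))\<bar> \<le> r" using z by (auto simp: box_at_one_def)
  have "r * 1 \<le> r * P" using P r by (intro mult_left_mono) auto
  then have rP: "r \<le> P * r" by (simp add: mult.commute)
  have Pr: "16 * (P * r) \<le> 1" "18 * (P * r) \<le> hyp_dist x gone" using r h by (simp_all add: P_def mult.assoc)
  have D: "dist z gone \<le> P * r"
    unfolding P_def by (rule box_at_one_dist_small[OF z r(1)]) (use rP Pr in linarith)
  have a: "0 < height x" using x by (auto simp: G_def height_def)
  show D4: "4 * dist z gone \<le> dist x gone"
  \<comment> \<open>Hyperbolic distance controls Euclidean distance only up to the factor
    \<open>sqrt (height x)\<close>, which is useless near the boundary plane; there the vertical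
    separation alone is at least \<open>3/4\<close>.\<close>
  proof (cases "height x \<ge> 1/4")
    case True
    then have "1/2 \<le> sqrt (height x)" by (intro real_le_rsqrt) (simp add: power2_eq_square)
    then have "1/2 * hyp_dist x gone \<le> sqrt (height x) * hyp_dist x gone"
      using hyp_dist_nonneg[OF x gone_in_G] by (intro mult_right_mono) auto
    also have "\<dots> \<le> dist x gone" by (rule hyp_dist_gone_le[OF x])
    finally show ?thesis using Pr D r rP by linarith
  next
    case False
    then have "3/4 \<le> dist x gone" using dist_gone_ge(4)[OF x] by linarith
    then show ?thesis using Pr D r by linarith
  qed
  have xg: "0 < hyp_dist x gone" using Pr r P by (smt (verit) mult_pos_pos)
  then show "x \<noteq> gone" by (auto simp: hyp_dist_def gone_def dist_mirror_pt dist_pt)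
  have S: "1 \<le> dist x gone + dist x (mirror gone)"
    using dist_gone_ge(5)[OF x] zero_le_dist[of x gone] by linarith
  have "8 * dist z gone / (dist x gone + dist x (mirror gone)) \<le> 8 * (P * r) / 1"
    using S D r P by (intro frac_le) auto
  then show pert: "\<bar>hyp_dist x z - hyp_dist x gone\<bar> \<le> 9 * exp 9 * r"
    using hyp_dist_perturb[OF x zG D4] lz rP unfolding P_def[symmetric] by linarith
  then show "hyp_dist x gone / 2 \<le> hyp_dist x z"
    using Pr unfolding P_def[symmetric] by linarith
qed

text \<open>The profile is taken with \<open>L = 1\<close>, not with the true width of order
  \<open>r\<close>. For \<open>h <= 1\<close> the second error term is absorbed by the first, since
  \<open>E >= h / 2\<close>; for \<open>h > 1\<close> the crude bound
  \<open>dist z gone <= exp 9\<close> is enough.\<close>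

lemma kernel_at_diff_small:
  assumes t: "0 < t" and x: "x \<in> G" and z: "z \<in> box_at_one (exp 8 * r) r" and r: "0 < r" "16 * exp 9 * r \<le> 1"
    and h: "18 * exp 9 * r \<le> hyp_dist x gone"
  shows "\<bar>kernel_at t x z - kernel_at t x gone\<bar> \<le> 10 ^ 9 * exp 9 * far_profile r 1 x"
proof -
  define P :: real where "P = exp 9"
  define E E' h0 where "E = dist x gone" and "E' = dist x (mirror gone)" and "h0 = hyp_dist x gone"
  have P: "1 \<le> P" by (simp add: P_def)
  have "r * 1 \<le> r * P" using P r by (intro mult_left_mono) auto
  then have rP: "r \<le> P * r" by (simp add: mult.commute)
  have Pr: "16 * (P * r) \<le> 1" "18 * (P * r) \<le> h0" using r h by (simp_all add: P_def h0_def mult.assoc)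
  have rh: "r \<le> h0" "0 < h0" using Pr rP r by linarith+
  have zG: "z \<in> G" using z by (auto simp: box_at_one_def)
  have a: "0 < height x" using x by (auto simp: G_def height_def)
  have D: "dist z gone \<le> P * r"
    unfolding P_def by (rule box_at_one_dist_small[OF z r(1)]) (use rP Pr in linarith)
  note far = small_box_far[OF x z r h]
  have EE': "E < E'" unfolding E_def E'_def by (rule dist_less_mirror[OF x gone_in_G])
  have "0 < E" using far(4) by (simp add: E_def)
  then have E0: "0 < E" "0 < E'" using EE' by linarith+
  let ?A = "r * ((h0 + r) powr (- 3) / (E * E'))"
  let ?B = "(\<bar>ln (height x)\<bar> + 1) powr (- 2) * (horiz_norm_sq x + 1) powr (- (3/2))"
  have AB: "0 \<le> ?A" "0 \<le> ?B" using r E0 by auto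
  have num: "16 * u \<le> 32 * u + 2048 * w" "2048 * w \<le> 32 * u + 2048 * w"
    "72 * u + (32 * u + 2048 * w) \<le> 2048 * u + 2048 * w" if "0 \<le> u" "0 \<le> w" for u w :: real
    using that by linarith+
  have cube: "1 / h0 ^ 3 \<le> 8 * (h0 + r) powr (- 3)" by (rule inv_cube_le[OF r(1) rh(1)])
  have 1: "9 * P * r / (h0 ^ 3 * (E * E')) \<le> P * (72 * ?A)"
  proof -
    have "9 * P * r / (h0 ^ 3 * (E * E')) = 9 * P * r * (1 / h0 ^ 3) / (E * E')" by simp
    also have "\<dots> \<le> 9 * P * r * (8 * (h0 + r) powr (- 3)) / (E * E')"
      using r P E0 cube by (intro divide_right_mono mult_left_mono) auto
    finally show ?thesis by (simp add: mult_ac)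
  qed
  have 2: "dist z gone / (h0\<^sup>2 * (E\<^sup>2 * E')) \<le> P * (32 * ?A + 2048 * ?B)"
  proof (cases "h0 \<le> 1")
    case True
    \<comment> \<open>A point within distance one has height at least
      \<open>exp (- 1) >= 1/4\<close>, so \<open>E\<close> and \<open>h\<close> are comparable
      there.\<close>
    have "exp (- 1) \<le> height x"
      using hyp_dist_gone_ge_ln[OF x] True a by (metis abs_le_D2 exp_le_cancel_iff exp_ln h0_def minus_le_iff order_trans)
    moreover have "1 / 4 \<le> exp (- 1 :: real)"
      using e_less_272 by (simp add: exp_minus field_simps)
    ultimately have "1/2 \<le> sqrt (height x)" by (intro real_le_rsqrt) (simp add: power2_eq_square)
    then have "1/2 * h0 \<le> sqrt (height x) * h0" using rh by (intro mult_right_mono) auto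
    also have "\<dots> \<le> E" unfolding h0_def E_def by (rule hyp_dist_gone_le[OF x])
    finally have hE: "h0 / 2 \<le> E" by simp
    have "dist z gone / (h0\<^sup>2 * (E\<^sup>2 * E')) \<le> P * r / (h0\<^sup>2 * ((h0 / 2 * E) * E'))"
      using D hE rh E0 P r by (intro frac_le mult_left_mono mult_right_mono) (auto simp: power2_eq_square)
    also have "\<dots> = 2 * P * r * (1 / h0 ^ 3) / (E * E')" using rh by (simp add: power2_eq_square power3_eq_cube mult_ac)
    also have "\<dots> \<le> 2 * P * r * (8 * (h0 + r) powr (- 3)) / (E * E')"
      using r P E0 cube by (intro divide_right_mono mult_left_mono) auto
    also have "\<dots> = P * (16 * ?A)" by (simp add: mult_ac)
    also have "\<dots> \<le> P * (32 * ?A + 2048 * ?B)" using num[OF AB] P by (intro mult_left_mono) auto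
    finally show ?thesis .
  next
    case False
    have E14: "1/4 \<le> E"
    proof (cases "height x \<ge> 1/4")
      case True
      then have "1/2 \<le> sqrt (height x)" by (intro real_le_rsqrt) (simp add: power2_eq_square)
      then have "1/2 * h0 \<le> sqrt (height x) * h0" using rh by (intro mult_right_mono) auto
      also have "\<dots> \<le> E" unfolding h0_def E_def by (rule hyp_dist_gone_le[OF x])
      finally show ?thesis using False by simp
    next
      case False
      then show ?thesis using dist_gone_ge(4)[OF x] unfolding E_def by linarith
    qed
    then have "(1/4)\<^sup>2 \<le> E\<^sup>2" by (intro power_mono) auto
    then have w: "horiz_norm_sq x + 1 \<le> 64 * E\<^sup>2" using dist_gone_ge(1)[OF x] by (simp add: E_def power2_eq_square)
    have "dist z gone / (h0\<^sup>2 * (E\<^sup>2 * E')) = dist z gone * (1 / h0\<^sup>2) * (1 / (E\<^sup>2 * E'))" by simp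
    also have "\<dots> \<le> P * (4 * (\<bar>ln (height x)\<bar> + 1) powr (- 2)) * (512 * (horiz_norm_sq x + 1) powr (- (3/2)))"
    proof (intro mult_mono inv_square_le inv_cube_norm_le w)
      have "r \<le> 1" using Pr rP by linarith
      then have "P * r \<le> P * 1" using P by (intro mult_left_mono) auto
      then show "dist z gone \<le> P" using D by simp
      show "0 < horiz_norm_sq x + 1" by (auto simp: horiz_norm_sq_def intro!: add_nonneg_pos)
    qed (use P False hyp_dist_gone_ge_ln[OF x] E0 EE' in \<open>auto simp: h0_def\<close>)
    also have "\<dots> = P * (2048 * ?B)" by (simp add: mult_ac)
    also have "\<dots> \<le> P * (32 * ?A + 2048 * ?B)" using num[OF AB] P by (intro mult_left_mono) auto
    finally show ?thesis .
  qed
  have "\<bar>kernel_at t x z - kernel_at t x gone\<bar> \<le> 32 * 1728 * (9 * P * r / (h0 ^ 3 * (E * E')) + dist z gone / (h0\<^sup>2 * (E\<^sup>2 * E')))"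
    using kernel_at_diff[OF t x zG gone_in_G far(4,1,2,3)] unfolding P_def h0_def E_def E'_def .
  also have "\<dots> \<le> 32 * 1728 * (P * (72 * ?A) + P * (32 * ?A + 2048 * ?B))"
    using 1 2 by (intro mult_left_mono add_mono) auto
  also have "\<dots> \<le> 32 * 1728 * (P * (2048 * ?A + 2048 * ?B))"
    unfolding distrib_left[of P, symmetric] using num(3)[OF AB] P by (intro mult_left_mono) auto
  also have "\<dots> = 32 * 1728 * 2048 * (P * far_profile r 1 x)"
    unfolding far_profile_def by (simp add: E_def E'_def h0_def height_def horiz_norm_sq_def algebra_simps)
  also have "\<dots> \<le> 10 ^ 9 * (P * far_profile r 1 x)"
    using r P far_profile_nonneg[of r 1 x] by (intro mult_right_mono mult_nonneg_nonneg) auto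
  finally show ?thesis by (simp add: P_def mult.assoc)
qed

text \<open>Size bound for use without cancellation. Moving \<open>z\<close> to the identity loses
  at most a factor two in each of \<open>h\<close>, \<open>E\<close> and \<open>E'\<close>, and
  \<open>h\<close> enters squared: hence \<open>16\<close>.\<close>

lemma kernel_at_le_small:
  assumes t: "0 < t" and x: "x \<in> G" and z: "z \<in> box_at_one (exp 8 * r) r" and r: "0 < r" "16 * exp 9 * r \<le> 1"
    and h: "18 * exp 9 * r \<le> hyp_dist x gone"
  shows "kernel_at t x z \<le> 16 * 1728 / ((hyp_dist x gone)\<^sup>2 * (dist x gone * dist x (mirror gone)))"
proof -
  have zG: "z \<in> G" using z by (auto simp: box_at_one_def)
  note far = small_box_far[OF x z r h]
  define E E' F F' where "E = dist x z" and "E' = dist x (mirror z)"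
    and "F = dist x gone" and "F' = dist x (mirror gone)"
  have F: "0 < F" "F < F'" using far(4) dist_less_mirror[OF x gone_in_G] by (auto simp: F_def F'_def)
  have "\<bar>E - F\<bar> \<le> dist z gone" unfolding E_def F_def
    by (metis abs_dist_diff_le dist_commute)
  then have E: "F / 2 \<le> E" using far(1) F unfolding F_def by linarith
  have "\<bar>E' - F'\<bar> \<le> dist (mirror z) (mirror gone)" unfolding E'_def F'_def
    by (metis abs_dist_diff_le dist_commute)
  then have E': "F' / 2 \<le> E'" using far(1) F unfolding dist_mirror_mirror F_def by linarith
  have h0: "0 < hyp_dist x gone" by (rule hyp_dist_pos[OF x gone_in_G far(4)])
  have "x \<noteq> z" using E F by (auto simp: E_def)
  then have "kernel_at t x z \<le> 1728 / ((hyp_dist x z)\<^sup>2 * (E * E'))"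
    unfolding E_def E'_def by (rule kernel_at_le[OF t x zG])
  also have "\<dots> \<le> 1728 / ((hyp_dist x gone / 2)\<^sup>2 * (F / 2 * (F' / 2)))"
    using E E' F far(3) h0 by (intro divide_left_mono mult_mono power_mono mult_pos_pos) auto
  also have "\<dots> = 16 * 1728 / ((hyp_dist x gone)\<^sup>2 * (F * F'))"
    by (simp add: power_divide)
  finally show ?thesis by (simp add: F_def F'_def)
qed

section \<open>The maximal function far from the support\<close>

definition horiz_dist_sq :: "pt \<Rightarrow> pt \<Rightarrow> real" where
  "horiz_dist_sq z x = (fst x - fst z)\<^sup>2 + (fst (snd x) - fst (snd z))\<^sup>2"

lemma horiz_dist_sq_gone: "horiz_dist_sq gone x = horiz_norm_sq x"
  by (simp add: horiz_dist_sq_def horiz_norm_sq_def gone_def)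

lemma proj_compose_measurable:
  assumes "f \<in> borel_measurable M"
  shows "(\<lambda>w. fst (f w :: pt)) \<in> borel_measurable M" "(\<lambda>w. fst (snd (f w :: pt))) \<in> borel_measurable M"
    "(\<lambda>w. snd (snd (f w :: pt))) \<in> borel_measurable M"
  using assms by (auto intro: measurable_compose[OF _ proj_measurable(1)]
      measurable_compose[OF _ proj_measurable(2)] measurable_compose[OF _ proj_measurable(3)])

lemma horiz_dist_sq_measurable [measurable (raw)]:
  assumes "f \<in> borel_measurable M" "g \<in> borel_measurable M"
  shows "(\<lambda>w. horiz_dist_sq (f w) (g w)) \<in> borel_measurable M"
  unfolding horiz_dist_sq_def
  by (intro borel_measurable_add borel_measurable_power borel_measurable_diff proj_compose_measurable assms)

lemma horiz_norm_sq_measurable [measurable (raw)]: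
  "f \<in> borel_measurable M \<Longrightarrow> (\<lambda>w. horiz_norm_sq (f w)) \<in> borel_measurable M"
  unfolding horiz_norm_sq_def
  by (intro borel_measurable_add borel_measurable_power proj_compose_measurable)

lemma height_measurable [measurable (raw)]:
  "f \<in> borel_measurable M \<Longrightarrow> (\<lambda>w. height (f w)) \<in> borel_measurable M"
  unfolding height_def by (rule proj_compose_measurable)

lemma rho_measurable_borel: "f \<in> measurable M rho \<Longrightarrow> f \<in> borel_measurable M"
proof -
  assume f: "f \<in> measurable M rho"
  have "id \<in> measurable rho borel" by measurable
  from measurable_compose[OF f this] show ?thesis by simp
qed

lemma nn_integral_rho_product':
  fixes \<phi> \<psi> :: "real \<Rightarrow> ennreal"
  assumes [measurable]: "\<phi> \<in> borel_measurable borel" "\<psi> \<in> borel_measurable borel"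
  shows "(\<integral>\<^sup>+x. \<phi> (ln (height x)) * \<psi> (horiz_dist_sq z x) \<partial>rho)
    = ennreal pi * (\<integral>\<^sup>+v. \<phi> v \<partial>lborel) * (\<integral>\<^sup>+q. \<psi> q * indicator {0..} q \<partial>lborel)"
  using nn_integral_rho_product[OF assms, of "fst z" "fst (snd z)"] by (simp add: height_def horiz_dist_sq_def)

text \<open>A cylinder instead of a hyperbolic ball: its horizontal radius \<open>8 L\<close> is the
  threshold of \<open>kernel_at_diff_large\<close>, and its log-height \<open>T\<close> can be
  chosen separately.\<close>

definition core :: "real \<Rightarrow> real \<Rightarrow> pt set" where
  "core L T = {x \<in> G. horiz_norm_sq x \<le> 64 * L\<^sup>2 \<and> \<bar>ln (height x)\<bar> \<le> T}"

text \<open>Outside \<open>core L T\<close>, cancellation is needed only where \<open>64 L\<^sup>2 \<le> horiz_norm_sq x\<close>; the parts below and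
  above the core are handled by the following size bounds.\<close>

definition low_kernel :: "real \<Rightarrow> real \<Rightarrow> pt \<Rightarrow> pt \<Rightarrow> ennreal" where
  "low_kernel L T z x = ennreal 6912 * ((ennreal (1 / (ln (height x))\<^sup>2) * indicator {..-T} (ln (height x)))
     * (ennreal (1 / (horiz_dist_sq z x + (height z)\<^sup>2 / 4)) * indicator {..81 * L\<^sup>2} (horiz_dist_sq z x)))"

definition high_kernel :: "real \<Rightarrow> real \<Rightarrow> pt \<Rightarrow> ennreal" where
  "high_kernel L T x = (ennreal (6912 * exp (- 2 * ln (height x))) * indicator {T..} (ln (height x)))
     * indicator {..64 * L\<^sup>2} (horiz_norm_sq x)"

lemma box_at_one_height:
  assumes "z \<in> box_at_one L r"
  shows "exp (- r) \<le> height z" "height z \<le> exp r" "0 < height z"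
proof -
  have b: "0 < height z" "\<bar>ln (height z)\<bar> \<le> r" using assms by (auto simp: box_at_one_def G_def height_def)
  then show "exp (- r) \<le> height z" "height z \<le> exp r" "0 < height z"
    by (metis abs_le_D2 exp_le_cancel_iff exp_ln minus_le_iff, metis abs_le_D1 exp_le_cancel_iff exp_ln, blast)
qed

lemma exp_neg_one_le: "exp (- 1 :: real) \<le> 1 / 2"
  using exp_ge_add_one_self[of 1] by (simp add: exp_minus divide_simps)

lemma dist_sq_horiz_dist_sq: "(dist x z)\<^sup>2 = horiz_dist_sq z x + (height x - height z)\<^sup>2"
  by (cases x; cases z) (simp add: dist_pt_sq horiz_dist_sq_def height_def)

lemma kernel_at_le_dist_sq:
  assumes t: "0 < t" and G: "x \<in> G" "z \<in> G" and w: "0 < w" "w \<le> (dist x z)\<^sup>2" and k: "0 < k" "k \<le> hyp_dist x z"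
  shows "kernel_at t x z \<le> 1728 / (k\<^sup>2 * w)"
proof -
  have xz: "x \<noteq> z" using w by auto
  have "dist x z * dist x z \<le> dist x z * dist x (mirror z)"
    using dist_less_mirror[OF G] by (intro mult_left_mono) auto
  then have w': "w \<le> dist x z * dist x (mirror z)" using w by (simp add: power2_eq_square)
  have "kernel_at t x z \<le> 1728 / ((hyp_dist x z)\<^sup>2 * (dist x z * dist x (mirror z)))"
    by (rule kernel_at_le[OF t G xz])
  also have "\<dots> \<le> 1728 / (k\<^sup>2 * w)"
    using w w' k by (intro divide_left_mono mult_mono power_mono mult_pos_pos) auto
  finally show ?thesis .
qed

text \<open>Below the core, \<open>height x <= height z / 2\<close>, so the vertical gap contributes
  at least \<open>(height z)^2 / 4\<close> to \<open>E^2\<close>; and \<open>T >= 2 r\<close> gives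
  \<open>h >= |ln (height x)| / 2\<close>. The last factor, squared, makes
  \<open>6912 = 4 * 1728\<close>.\<close>

lemma kernel_at_le_low:
  assumes t: "0 < t" and x: "x \<in> G" and z: "z \<in> box_at_one L r" and r: "1 \<le> r" and T: "2 * r \<le> T"
    and q: "horiz_norm_sq x \<le> 64 * L\<^sup>2" and v: "ln (height x) < - T"
  shows "ennreal (kernel_at t x z) \<le> low_kernel L T z x"
proof -
  have zG: "z \<in> G" using z by (simp add: box_at_one_def)
  have z12: "\<bar>fst z\<bar> \<le> L / 2" "\<bar>fst (snd z)\<bar> \<le> L / 2" and lz: "\<bar>ln (height z)\<bar> \<le> r" using z by (auto simp: box_at_one_def height_def)
  have a: "0 < height x" using x by (auto simp: G_def height_def)
  note b = box_at_one_height[OF z]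
  have "height x \<le> exp (- r + - 1)"
    using v T r a by (metis add_mono_thms_linordered_semiring(1) exp_le_cancel_iff exp_ln less_eq_real_def minus_le_iff mult_2 neg_le_iff_le order_trans minus_add_distrib)
  also have "\<dots> \<le> exp (- r) * (1/2)"
    unfolding exp_add using exp_neg_one_le by (intro mult_left_mono) auto
  finally have ab: "height x \<le> height z / 2" using b by simp
  have "(height z / 2)\<^sup>2 \<le> (height z - height x)\<^sup>2" using ab b by (intro power_mono) auto
  then have w: "horiz_dist_sq z x + (height z)\<^sup>2 / 4 \<le> (dist x z)\<^sup>2"
    unfolding dist_sq_horiz_dist_sq by (simp add: power_divide power2_commute)
  have h0: "0 \<le> horiz_dist_sq z x" by (simp add: horiz_dist_sq_def)
  have w0: "0 < horiz_dist_sq z x + (height z)\<^sup>2 / 4" using b h0 by (intro add_nonneg_pos) auto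
  have k: "- ln (height x) / 2 \<le> hyp_dist x z"
    using hyp_dist_ge_ln[OF x zG] lz v T unfolding height_def by linarith
  have k0: "0 < - ln (height x) / 2" using v T r by linarith
  have "kernel_at t x z \<le> 1728 / ((- ln (height x) / 2)\<^sup>2 * (horiz_dist_sq z x + (height z)\<^sup>2 / 4))"
    by (rule kernel_at_le_dist_sq[OF t x zG w0 w k0 k])
  also have "\<dots> = 6912 * ((1 / (ln (height x))\<^sup>2) * (1 / (horiz_dist_sq z x + (height z)\<^sup>2 / 4)))"
    by (simp add: power_divide)
  finally have le: "kernel_at t x z \<le> 6912 * ((1 / (ln (height x))\<^sup>2) * (1 / (horiz_dist_sq z x + (height z)\<^sup>2 / 4)))" .
  have "horiz_dist_sq z x \<le> 81 * L\<^sup>2"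
  proof -
    \<comment> \<open>Weights chosen so that \<open>9/8 * 64 + 9 * (1/4 + 1/4) <= 81\<close>:
      horizontally \<open>x\<close> is within \<open>9 L\<close> of \<open>z\<close>.\<close>
    have *: "(y - u)\<^sup>2 \<le> 9/8 * y\<^sup>2 + 9 * u\<^sup>2" for y u :: real
      using zero_le_power2[of "y / 8 + u"] by (simp add: power2_eq_square algebra_simps)
    have "(fst z)\<^sup>2 \<le> (L / 2)\<^sup>2" "(fst (snd z))\<^sup>2 \<le> (L / 2)\<^sup>2"
      using z12 by (metis abs_ge_zero power2_abs power_mono)+
    moreover have "horiz_dist_sq z x \<le> 9/8 * horiz_norm_sq x + 9 * ((fst z)\<^sup>2 + (fst (snd z))\<^sup>2)"
      unfolding horiz_dist_sq_def horiz_norm_sq_def distrib_left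
      using add_mono[OF *[of "fst x" "fst z"] *[of "fst (snd x)" "fst (snd z)"]] by (simp add: add_ac)
    moreover have "(L / 2)\<^sup>2 = L\<^sup>2 / 4" by (simp add: power_divide)
    moreover have "h \<le> 81 * l" if "h \<le> 9/8 * s + 9 * (u + w)" "u \<le> m" "w \<le> m" "m = l / 4" "s \<le> 64 * l" "0 \<le> l"
      for h s u w m l :: real using that by argo
    ultimately show ?thesis using q zero_le_power2 by metis
  qed
  then have "low_kernel L T z x = ennreal 6912 * (ennreal (1 / (ln (height x))\<^sup>2) * ennreal (1 / (horiz_dist_sq z x + (height z)\<^sup>2 / 4)))"
    using v unfolding low_kernel_def by simp
  also have "\<dots> = ennreal (6912 * ((1 / (ln (height x))\<^sup>2) * (1 / (horiz_dist_sq z x + (height z)\<^sup>2 / 4))))"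
    using w0 by (simp only: ennreal_mult'' mult_nonneg_nonneg zero_le_divide_1_iff zero_le_power2 less_imp_le)
  finally have "low_kernel L T z x = ennreal (6912 * ((1 / (ln (height x))\<^sup>2) * (1 / (horiz_dist_sq z x + (height z)\<^sup>2 / 4))))" .
  then show ?thesis using le by (simp only: ennreal_leI)
qed

text \<open>Above the core no decay in \<open>h\<close> is needed: \<open>h >= 1\<close> holds, and
  the inverse square of the height is already integrable upwards against the bounded horizontal
  area.\<close>

lemma kernel_at_le_high:
  assumes t: "0 < t" and x: "x \<in> G" and z: "z \<in> box_at_one L r" and r: "1 \<le> r" and T: "2 * r \<le> T"
    and q: "horiz_norm_sq x \<le> 64 * L\<^sup>2" and v: "T < ln (height x)"
  shows "ennreal (kernel_at t x z) \<le> high_kernel L T x"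
proof -
  have zG: "z \<in> G" using z by (simp add: box_at_one_def)
  have lz: "\<bar>ln (height z)\<bar> \<le> r" using z by (auto simp: box_at_one_def height_def)
  have a: "0 < height x" using x by (auto simp: G_def height_def)
  note b = box_at_one_height[OF z]
  have "height z \<le> exp (ln (height x) + - 1)"
    using b(2) v T r by (intro order_trans[OF b(2)]) simp
  also have "\<dots> \<le> height x * (1/2)"
    unfolding exp_add exp_ln[OF a] using exp_neg_one_le a by (intro mult_left_mono) auto
  finally have ab: "height z \<le> height x / 2" by simp
  have "(height x / 2)\<^sup>2 \<le> (height x - height z)\<^sup>2" using ab a by (intro power_mono) auto
  then have w: "(height x)\<^sup>2 / 4 \<le> (dist x z)\<^sup>2"
    unfolding dist_sq_horiz_dist_sq by (simp add: power_divide horiz_dist_sq_def add_increasing)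
  have k: "1 \<le> hyp_dist x z"
    using hyp_dist_ge_ln[OF x zG] lz v T r unfolding height_def by linarith
  have "kernel_at t x z \<le> 1728 / (1\<^sup>2 * ((height x)\<^sup>2 / 4))"
    by (rule kernel_at_le_dist_sq[OF t x zG _ w _ k]) (use a in auto)
  also have "\<dots> = 6912 * exp (- 2 * ln (height x))"
  proof -
    have "exp (- 2 * ln (height x)) = 1 / (height x)\<^sup>2"
      using a by (simp add: exp_minus exp_of_nat_mult[of 2, simplified] inverse_eq_divide)
    then show ?thesis by simp
  qed
  finally show ?thesis using v q unfolding high_kernel_def by (simp add: ennreal_leI)
qed

lemma nn_integral_inverse_square:
  assumes "0 < T"
  shows "(\<integral>\<^sup>+v. ennreal (1 / v\<^sup>2) * indicator {..-T} v \<partial>lborel) = ennreal (1 / T)"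
proof -
  have "(\<integral>\<^sup>+v. ennreal (1 / v\<^sup>2) * indicator {..-T} v \<partial>lborel) = (\<integral>\<^sup>+v. ennreal (1 / v\<^sup>2) * indicator {T..} v \<partial>lborel)"
    by (subst nn_integral_real_affine[where c="-1" and t=0]) (auto intro!: nn_integral_cong simp: indicator_def)
  also have "\<dots> = 0 - (- (1 / T))"
  proof (rule nn_integral_FTC_atLeast)
    fix v assume "T \<le> v"
    then show "((\<lambda>v. - (1 / v)) has_real_derivative 1 / v\<^sup>2) (at v)"
      using assms by (auto intro!: derivative_eq_intros simp: power2_eq_square)
  qed (auto, real_asymp)
  finally show ?thesis by simp
qed

text \<open>Horizontally the integral of \<open>1 / (q + \<beta>)\<close> grows only
  logarithmically, and heights in the box are at least \<open>exp (- r)\<close>. When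
  \<open>L <= exp (8 * r)\<close> the logarithm is of order \<open>r\<close>, and the vertical tail
  \<open>1 / T\<close> compensates for it once \<open>T\<close> is of order
  \<open>r\<close>.\<close>

lemma nn_integral_low_kernel:
  assumes T: "0 < T" and z: "z \<in> box_at_one L r"
  shows "(\<integral>\<^sup>+x. low_kernel L T z x \<partial>rho) \<le> ennreal (6912 * pi * ln (1 + 324 * L\<^sup>2 * exp (2 * r)) / T)"
proof -
  define \<beta> where "\<beta> = (height z)\<^sup>2 / 4"
  note b = box_at_one_height[OF z]
  have \<beta>: "0 < \<beta>" using b by (simp add: \<beta>_def)
  have "(\<integral>\<^sup>+x. low_kernel L T z x \<partial>rho) = ennreal 6912 * (\<integral>\<^sup>+x. (ennreal (1 / (ln (height x))\<^sup>2) * indicator {..-T} (ln (height x)))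
     * (ennreal (1 / (horiz_dist_sq z x + \<beta>)) * indicator {..81 * L\<^sup>2} (horiz_dist_sq z x)) \<partial>rho)"
    unfolding low_kernel_def \<beta>_def[symmetric] by (rule nn_integral_cmult) measurable
  also have "\<dots> = ennreal 6912 * (ennreal pi * (\<integral>\<^sup>+v. ennreal (1 / v\<^sup>2) * indicator {..-T} v \<partial>lborel)
     * (\<integral>\<^sup>+q. ennreal (1 / (q + \<beta>)) * indicator {..81 * L\<^sup>2} q * indicator {0..} q \<partial>lborel))"
    by (subst nn_integral_rho_product'[of "\<lambda>v. ennreal (1 / v\<^sup>2) * indicator {..-T} v"
          "\<lambda>q. ennreal (1 / (q + \<beta>)) * indicator {..81 * L\<^sup>2} q"]) auto
  also have "(\<integral>\<^sup>+q. ennreal (1 / (q + \<beta>)) * indicator {..81 * L\<^sup>2} q * indicator {0..} q \<partial>lborel)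
      = (\<integral>\<^sup>+q. ennreal (1 / (q + \<beta>)) * indicator {0..81 * L\<^sup>2} q \<partial>lborel)"
    by (intro nn_integral_cong) (auto simp: indicator_def)
  also have "\<dots> = ln (81 * L\<^sup>2 + \<beta>) - ln (0 + \<beta>)"
  proof (rule nn_integral_FTC_Icc)
    fix q :: real assume "q \<in> {0..81 * L\<^sup>2}"
    then show "((\<lambda>q. ln (q + \<beta>)) has_real_derivative 1 / (q + \<beta>)) (at q)" "0 \<le> 1 / (q + \<beta>)"
      using \<beta> by (auto intro!: derivative_eq_intros)
  qed auto
  also have "\<dots> = ln (1 + 81 * L\<^sup>2 / \<beta>)"
  proof -
    have "1 + 81 * L\<^sup>2 / \<beta> = (81 * L\<^sup>2 + \<beta>) / \<beta>" using \<beta> by (simp add: field_simps)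
    moreover have "0 < 81 * L\<^sup>2 + \<beta>" using \<beta> by (intro add_nonneg_pos) auto
    ultimately show ?thesis using \<beta> by (simp add: ln_div)
  qed
  also have "(\<integral>\<^sup>+v. ennreal (1 / v\<^sup>2) * indicator {..-T} v \<partial>lborel) = ennreal (1 / T)"
    by (rule nn_integral_inverse_square[OF T])
  also have "ennreal 6912 * (ennreal pi * ennreal (1 / T) * ennreal (ln (1 + 81 * L\<^sup>2 / \<beta>)))
      = ennreal (6912 * pi * ln (1 + 81 * L\<^sup>2 / \<beta>) / T)"
  proof -
    have "0 \<le> ln (1 + 81 * L\<^sup>2 / \<beta>)" using \<beta> by simp
    then have "ennreal 6912 * (ennreal pi * ennreal (1 / T) * ennreal (ln (1 + 81 * L\<^sup>2 / \<beta>)))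
        = ennreal (6912 * (pi * (1 / T) * ln (1 + 81 * L\<^sup>2 / \<beta>)))"
      using T by (simp only: ennreal_mult'' mult_nonneg_nonneg pi_ge_zero zero_le_divide_1_iff less_imp_le)
    then show ?thesis by (simp add: mult.assoc)
  qed
  also have "\<dots> \<le> ennreal (6912 * pi * ln (1 + 324 * L\<^sup>2 * exp (2 * r)) / T)"
  proof -
    have "(exp (- r))\<^sup>2 \<le> (height z)\<^sup>2" using b by (intro power_mono) auto
    then have "1 \<le> (height z)\<^sup>2 * exp (2 * r)"
      by (simp add: exp_minus field_simps flip: exp_of_nat_mult)
    then have "81 * L\<^sup>2 * 4 * 1 \<le> 81 * L\<^sup>2 * 4 * ((height z)\<^sup>2 * exp (2 * r))"
      by (intro mult_left_mono) auto
    then have "81 * L\<^sup>2 / \<beta> \<le> 324 * L\<^sup>2 * exp (2 * r)"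
      using b unfolding \<beta>_def by (simp add: divide_le_eq mult_ac)
    then have "ln (1 + 81 * L\<^sup>2 / \<beta>) \<le> ln (1 + 324 * L\<^sup>2 * exp (2 * r))"
      using \<beta> by (subst ln_le_cancel_iff) (auto intro!: add_pos_nonneg)
    then show ?thesis using T by (intro ennreal_leI divide_right_mono mult_left_mono) auto
  qed
  finally show ?thesis .
qed

lemma nn_integral_high_kernel:
  "(\<integral>\<^sup>+x. high_kernel L T x \<partial>rho) = ennreal (6912 * 32 * pi * L\<^sup>2 * exp (- 2 * T))"
proof -
  have "(\<integral>\<^sup>+x. high_kernel L T x \<partial>rho)
    = ennreal pi * (\<integral>\<^sup>+v. ennreal (6912 * exp (- 2 * v)) * indicator {T..} v \<partial>lborel)
      * (\<integral>\<^sup>+q. indicator {..64 * L\<^sup>2} q * indicator {0..} q \<partial>lborel)"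
    unfolding high_kernel_def horiz_dist_sq_gone[symmetric]
    by (rule nn_integral_rho_product'[of "\<lambda>v. ennreal (6912 * exp (- 2 * v)) * indicator {T..} v"
          "indicator {..64 * L\<^sup>2}"]) auto
  also have "(\<integral>\<^sup>+v. ennreal (6912 * exp (- 2 * v)) * indicator {T..} v \<partial>lborel) = 0 - (- 3456 * exp (- 2 * T))"
  proof (rule nn_integral_FTC_atLeast)
    show "((\<lambda>v. - 3456 * exp (- 2 * v)) has_real_derivative 6912 * exp (- 2 * v)) (at v)" for v
      by (auto intro!: derivative_eq_intros)
  qed (auto, real_asymp)
  also have "(\<integral>\<^sup>+q. indicator {..64 * L\<^sup>2} q * indicator {0..} q \<partial>lborel) = (\<integral>\<^sup>+q. indicator {0..64 * L\<^sup>2} q \<partial>lborel)"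
    by (intro nn_integral_cong) (auto simp: indicator_def)
  also have "\<dots> = ennreal (64 * L\<^sup>2)" by simp
  also have "ennreal pi * ennreal (0 - (- 3456 * exp (- 2 * T))) * ennreal (64 * L\<^sup>2)
      = ennreal (pi * (0 - (- 3456 * exp (- 2 * T))) * (64 * L\<^sup>2))"
    by (subst ennreal_mult''[symmetric], simp)+ simp
  finally show ?thesis by (simp add: mult_ac)
qed

lemma core_measurable [measurable]: "core L T \<in> sets borel"
proof -
  have "core L T = G \<inter> {x \<in> space borel. horiz_norm_sq x \<le> 64 * L\<^sup>2} \<inter> {x \<in> space borel. \<bar>ln (height x)\<bar> \<le> T}"
    by (auto simp: core_def)
  also have "\<dots> \<in> sets borel" by measurable
  finally show ?thesis .
qed

text \<open>\<open>L\<close>, \<open>r\<close> and \<open>T\<close> are kept apart because there are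
  two uses: atoms take \<open>T = 9 * r\<close> with \<open>L\<close> between exponentials of
  \<open>r\<close>, whereas the test functions have \<open>r = 1\<close>, arbitrarily large
  \<open>L\<close>, and \<open>T = ln L\<close>. The three constants belong to the horizontal, lower
  and upper parts of the complement.\<close>

lemma heat_maximal_off_core:
  assumes B: "integrable rho B" "(\<integral>z. B z \<partial>rho) = 0" and supp: "AE z in rho. B z \<noteq> 0 \<longrightarrow> z \<in> box_at_one L r"
    and r: "1 \<le> r" and L: "exp (2 * r) \<le> L" and T: "2 * r \<le> T"
  shows "(\<integral>\<^sup>+x. heat_maximal B x * indicator (- core L T) x \<partial>rho)
    \<le> ennreal (5 * 10 ^ 9 * pi + 6912 * pi * ln (1 + 324 * L\<^sup>2 * exp (2 * r)) / T + 6912 * 32 * pi * L\<^sup>2 * exp (- 2 * T))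
      * (\<integral>\<^sup>+z. ennreal (cmod (B z)) \<partial>rho)"
proof -
  let ?N = "\<integral>\<^sup>+z. ennreal (cmod (B z)) \<partial>rho"
  have L0: "0 < L" using L less_le_trans[OF exp_gt_zero] by blast
  have T0: "0 < T" using T r by linarith
  have [measurable]: "B \<in> borel_measurable rho" using B by simp
  interpret P: pair_sigma_finite rho rho ..
  have pm: "fst \<in> borel_measurable (rho \<Otimes>\<^sub>M rho)" "snd \<in> borel_measurable (rho \<Otimes>\<^sub>M rho)"
    by (auto intro: rho_measurable_borel measurable_fst measurable_snd)
  note [measurable] = horiz_dist_sq_measurable[OF pm] horiz_dist_sq_measurable[OF pm(2,1)] height_measurable[OF pm(1)] height_measurable[OF pm(2)]
  have lk1: "(\<lambda>p. low_kernel L T (snd p) (fst p)) \<in> borel_measurable (rho \<Otimes>\<^sub>M rho)"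
    unfolding low_kernel_def by measurable
  have lk2: "(\<lambda>x. low_kernel L T z x) \<in> borel_measurable rho" for z
    unfolding low_kernel_def by measurable
  have hk: "high_kernel L T \<in> borel_measurable rho"
    unfolding high_kernel_def by measurable
  note [measurable] = lk1 lk2 hk
  have [measurable]: "(\<lambda>p. B (snd p)) \<in> borel_measurable (rho \<Otimes>\<^sub>M rho)" by measurable
  have Bk: "(\<lambda>(x, z). ennreal (cmod (B z)) * low_kernel L T z x) \<in> borel_measurable (rho \<Otimes>\<^sub>M rho)"
    unfolding split_beta' by (intro borel_measurable_times_ennreal lk1) measurable
  have borel_measurable_ennreal_far_profile: "(\<lambda>x. ennreal (10 ^ 9 * far_profile r L x)) \<in> borel_measurable rho"
    by measurable
  have m1: "(\<lambda>x. ennreal (10 ^ 9 * far_profile r L x) * ?N) \<in> borel_measurable rho"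
    by (intro borel_measurable_times_ennreal) measurable
  have m2: "(\<lambda>x. \<integral>\<^sup>+z. ennreal (cmod (B z)) * low_kernel L T z x \<partial>rho) \<in> borel_measurable rho"
    by (rule rho.borel_measurable_nn_integral[OF Bk])
  have m3: "(\<lambda>x. high_kernel L T x * ?N) \<in> borel_measurable rho"
    by (intro borel_measurable_times_ennreal hk) measurable
  have pt: "heat_maximal B x * indicator (- core L T) x
      \<le> ennreal (10 ^ 9 * far_profile r L x) * ?N + (\<integral>\<^sup>+z. ennreal (cmod (B z)) * low_kernel L T z x \<partial>rho) + high_kernel L T x * ?N"
    if x: "x \<in> G" for x
  proof -
    have i: "heat_maximal B x * indicator (- core L T) x \<le> heat_maximal B x"
      by (simp add: indicator_def)
    have sums: "u \<le> u + v + w" "v \<le> u + v + w" "w \<le> u + v + w" for u v w :: ennreal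
      by (simp_all add: add_increasing add_increasing2 add.assoc)
    consider "x \<in> core L T" | "64 * L\<^sup>2 \<le> horiz_norm_sq x" | "horiz_norm_sq x \<le> 64 * L\<^sup>2" "ln (height x) < - T" | "horiz_norm_sq x \<le> 64 * L\<^sup>2" "T < ln (height x)"
      using x unfolding core_def by fastforce
    then show ?thesis
    proof cases
      case 1
      then show ?thesis by simp
    next
      case 2
      have "heat_maximal B x \<le> ennreal (10 ^ 9 * far_profile r L x) * ?N"
      proof (rule heat_maximal_le_cancel[OF B(1) x B(2) gone_in_G])
        fix t :: real assume "0 < t"
        note kernel_at_diff_large[OF this x _ r L 2]
        with supp show "AE z in rho. B z \<noteq> 0 \<longrightarrow> \<bar>kernel_at t x z - kernel_at t x gone\<bar> \<le> 10 ^ 9 * far_profile r L x"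
          by (auto elim!: eventually_mono)
      qed
      from order_trans[OF i order_trans[OF this sums(1)]] show ?thesis .
    next
      case 3
      have "heat_maximal B x \<le> (\<integral>\<^sup>+z. ennreal (cmod (B z)) * low_kernel L T z x \<partial>rho)"
      proof (rule heat_maximal_le_kernel[OF B(1) x])
        fix t :: real assume "0 < t"
        note kernel_at_le_low[OF this x _ r T 3]
        with supp show "AE z in rho. B z \<noteq> 0 \<longrightarrow> ennreal (kernel_at t x z) \<le> low_kernel L T z x"
          by (auto elim!: eventually_mono)
      qed
      from order_trans[OF i order_trans[OF this sums(2)]] show ?thesis .
    next
      case 4
      have "heat_maximal B x \<le> (\<integral>\<^sup>+z. ennreal (cmod (B z)) * high_kernel L T x \<partial>rho)"
      proof (rule heat_maximal_le_kernel[OF B(1) x])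
        fix t :: real assume "0 < t"
        note kernel_at_le_high[OF this x _ r T 4]
        with supp show "AE z in rho. B z \<noteq> 0 \<longrightarrow> ennreal (kernel_at t x z) \<le> high_kernel L T x"
          by (auto elim!: eventually_mono)
      qed
      also have "\<dots> = high_kernel L T x * ?N" by (simp add: nn_integral_multc mult.commute[of "high_kernel L T x"])
      finally have "heat_maximal B x \<le> high_kernel L T x * ?N" .
      from order_trans[OF i order_trans[OF this sums(3)]] show ?thesis .
    qed
  qed
  have "(\<integral>\<^sup>+x. heat_maximal B x * indicator (- core L T) x \<partial>rho)
     \<le> (\<integral>\<^sup>+x. ennreal (10 ^ 9 * far_profile r L x) * ?N + (\<integral>\<^sup>+z. ennreal (cmod (B z)) * low_kernel L T z x \<partial>rho) + high_kernel L T x * ?N \<partial>rho)"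
    by (intro nn_integral_mono pt) (simp add: space_rho)
  also have "\<dots> = (\<integral>\<^sup>+x. ennreal (10 ^ 9 * far_profile r L x) * ?N \<partial>rho)
      + (\<integral>\<^sup>+x. \<integral>\<^sup>+z. ennreal (cmod (B z)) * low_kernel L T z x \<partial>rho \<partial>rho) + (\<integral>\<^sup>+x. high_kernel L T x * ?N \<partial>rho)"
    by (simp only: nn_integral_add[OF borel_measurable_add[OF m1 m2] m3] nn_integral_add[OF m1 m2])
  also have "(\<integral>\<^sup>+x. ennreal (10 ^ 9 * far_profile r L x) * ?N \<partial>rho) = ennreal (5 * 10 ^ 9 * pi) * ?N"
  proof -
    have "(\<integral>\<^sup>+x. ennreal (10 ^ 9 * far_profile r L x) \<partial>rho) = ennreal (10 ^ 9) * (\<integral>\<^sup>+x. ennreal (far_profile r L x) \<partial>rho)"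
      by (subst nn_integral_cmult[symmetric]) (auto intro!: nn_integral_cong simp: ennreal_mult')
    also have "(\<integral>\<^sup>+x. ennreal (far_profile r L x) \<partial>rho) = ennreal (5 * pi)"
      by (rule nn_integral_far_profile) (use r L0 in auto)
    also have "ennreal (10 ^ 9) * ennreal (5 * pi) = ennreal (10 ^ 9 * (5 * pi))"
      by (rule ennreal_mult''[symmetric]) simp
    also have "10 ^ 9 * (5 * pi) = 5 * 10 ^ 9 * pi" by simp
    finally show ?thesis by (simp only: nn_integral_multc[OF borel_measurable_ennreal_far_profile])
  qed
  also have "(\<integral>\<^sup>+x. high_kernel L T x * ?N \<partial>rho) = ennreal (6912 * 32 * pi * L\<^sup>2 * exp (- 2 * T)) * ?N"
    by (simp only: nn_integral_multc[OF hk] nn_integral_high_kernel)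
  \<comment> \<open>Unlike the other two majorants this one depends on \<open>z\<close>; the
    integral over \<open>x\<close> is done first, for each \<open>z\<close> in the support.\<close>
  also have "(\<integral>\<^sup>+x. \<integral>\<^sup>+z. ennreal (cmod (B z)) * low_kernel L T z x \<partial>rho \<partial>rho)
      = (\<integral>\<^sup>+z. \<integral>\<^sup>+x. ennreal (cmod (B z)) * low_kernel L T z x \<partial>rho \<partial>rho)"
    by (rule P.Fubini'[OF Bk, symmetric])
  also have "\<dots> \<le> (\<integral>\<^sup>+z. ennreal (6912 * pi * ln (1 + 324 * L\<^sup>2 * exp (2 * r)) / T) * ennreal (cmod (B z)) \<partial>rho)"
  proof (rule nn_integral_mono_AE)
    show "AE z in rho. (\<integral>\<^sup>+x. ennreal (cmod (B z)) * low_kernel L T z x \<partial>rho)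
        \<le> ennreal (6912 * pi * ln (1 + 324 * L\<^sup>2 * exp (2 * r)) / T) * ennreal (cmod (B z))"
      using supp
    proof eventually_elim
      case (elim z)
      show ?case
      proof (cases "B z = 0")
        case False
        then show ?thesis
          using elim nn_integral_low_kernel[OF T0, of z L r] lk2[of z]
          by (simp add: nn_integral_cmult) (simp add: mult.commute[of "ennreal (cmod _)"] mult_right_mono)
      qed simp
    qed
  qed
  also have "\<dots> = ennreal (6912 * pi * ln (1 + 324 * L\<^sup>2 * exp (2 * r)) / T) * ?N"
    by (rule nn_integral_cmult) measurable
  finally have "(\<integral>\<^sup>+x. heat_maximal B x * indicator (- core L T) x \<partial>rho)
     \<le> ennreal (5 * 10 ^ 9 * pi) * ?N + ennreal (6912 * pi * ln (1 + 324 * L\<^sup>2 * exp (2 * r)) / T) * ?N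
       + ennreal (6912 * 32 * pi * L\<^sup>2 * exp (- 2 * T)) * ?N"
    by (auto intro: add_mono)
  also have "\<dots> = ennreal (5 * 10 ^ 9 * pi + 6912 * pi * ln (1 + 324 * L\<^sup>2 * exp (2 * r)) / T + 6912 * 32 * pi * L\<^sup>2 * exp (- 2 * T)) * ?N"
    using T0 by (simp add: distrib_right[symmetric] flip: ennreal_plus)
  finally show ?thesis .
qed

section \<open>The maximal function of an atom\<close>

lemma core_sets: "core L T \<in> sets rho"
  by (simp add: sets_rho_iff core_measurable) (auto simp: core_def)

lemma emeasure_core:
  assumes "0 \<le> T"
  shows "emeasure rho (core L T) = ennreal (128 * pi * L\<^sup>2 * T)"
proof -
  have "emeasure rho (core L T) = (\<integral>\<^sup>+x. indicator (core L T) x \<partial>rho)"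
    using core_sets by simp
  also have "\<dots> = (\<integral>\<^sup>+x. indicator {-T..T} (ln (height x)) * indicator {..64 * L\<^sup>2} (horiz_dist_sq gone x) \<partial>rho)"
    by (intro nn_integral_cong) (auto simp: core_def space_rho indicator_def horiz_dist_sq_gone abs_le_iff)
  also have "\<dots> = ennreal pi * (\<integral>\<^sup>+v. indicator {-T..T} v \<partial>lborel) * (\<integral>\<^sup>+q. indicator {..64 * L\<^sup>2} q * indicator {0..} q \<partial>lborel)"
    by (rule nn_integral_rho_product') auto
  also have "(\<integral>\<^sup>+q. indicator {..64 * L\<^sup>2} q * indicator {0..} q \<partial>lborel) = (\<integral>\<^sup>+q. indicator {0..64 * L\<^sup>2} q \<partial>lborel)"
    by (intro nn_integral_cong) (auto simp: indicator_def)
  also have "ennreal pi * (\<integral>\<^sup>+v. indicator {-T..T} v \<partial>lborel) * (\<integral>\<^sup>+q. indicator {0..64 * L\<^sup>2} q \<partial>lborel)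
      = ennreal pi * ennreal (2 * T) * ennreal (64 * L\<^sup>2)"
    using assms by simp
  also have "\<dots> = ennreal (pi * (2 * T) * (64 * L\<^sup>2))"
    using assms by (simp only: ennreal_mult'' mult_nonneg_nonneg zero_le_power2 zero_le_numeral)
  finally show ?thesis by (simp add: mult_ac)
qed

lemma nn_integral_heat_maximal_core:
  assumes B: "integrable rho B" and M: "AE z in rho. cmod (B z) \<le> M" "0 \<le> M" and T: "0 \<le> T"
  shows "(\<integral>\<^sup>+x. heat_maximal B x * indicator (core L T) x \<partial>rho) \<le> ennreal (M * (128 * pi * L\<^sup>2 * T))"
proof -
  have "(\<integral>\<^sup>+x. heat_maximal B x * indicator (core L T) x \<partial>rho) \<le> (\<integral>\<^sup>+x. ennreal M * indicator (core L T) x \<partial>rho)"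
    by (intro nn_integral_mono mult_right_mono heat_maximal_le_bound[OF B _ M(1)]) (auto simp: space_rho)
  also have "\<dots> = ennreal M * ennreal (128 * pi * L\<^sup>2 * T)"
    using core_sets by (simp add: nn_integral_cmult_indicator emeasure_core[OF T])
  also have "\<dots> = ennreal (M * (128 * pi * L\<^sup>2 * T))"
    using M by (simp add: ennreal_mult')
  finally show ?thesis .
qed

lemma nn_integral_split_set:
  assumes [measurable]: "f \<in> borel_measurable rho" "S \<in> sets borel"
  shows "(\<integral>\<^sup>+x. f x \<partial>rho) = (\<integral>\<^sup>+x. f x * indicator S x \<partial>rho) + (\<integral>\<^sup>+x. f x * indicator (- S) x \<partial>rho)"
proof -
  have "(\<integral>\<^sup>+x. f x \<partial>rho) = (\<integral>\<^sup>+x. f x * indicator S x + f x * indicator (- S) x \<partial>rho)"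
    by (intro nn_integral_cong) (auto simp: indicator_def)
  also have "\<dots> = (\<integral>\<^sup>+x. f x * indicator S x \<partial>rho) + (\<integral>\<^sup>+x. f x * indicator (- S) x \<partial>rho)"
    by (rule nn_integral_add) measurable
  finally show ?thesis .
qed

text \<open>The choice \<open>T = 9 * r\<close> balances three demands: the core still has volume of
  order \<open>r * L^2\<close>, like the box; the logarithmic term divided by \<open>T\<close> stays
  bounded; and \<open>T\<close> exceeds \<open>ln L <= 8 * r\<close>, which bounds
  \<open>L^2 * exp (- 2 * T)\<close>.\<close>

lemma heat_maximal_large_atom:
  assumes B: "integrable rho B" "(\<integral>z. B z \<partial>rho) = 0" and supp: "AE z in rho. B z \<noteq> 0 \<longrightarrow> z \<in> box_at_one L r"
    and r: "1 \<le> r" and L: "exp (2 * r) \<le> L" "L \<le> exp (8 * r)"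
    and H: "0 \<le> H" "AE z in rho. cmod (B z) \<le> H / (r * L\<^sup>2)"
    and N: "(\<integral>\<^sup>+z. ennreal (cmod (B z)) \<partial>rho) \<le> 1"
  shows "(\<integral>\<^sup>+x. heat_maximal B x \<partial>rho) \<le> ennreal (1152 * pi * H + (5 * 10 ^ 9 * pi + 6912 * pi * 38 + 6912 * 32 * pi))"
proof -
  have L0: "0 < L" using L(1) less_le_trans[OF exp_gt_zero] by blast
  have "(\<integral>\<^sup>+x. heat_maximal B x \<partial>rho) = (\<integral>\<^sup>+x. heat_maximal B x * indicator (core L (9 * r)) x \<partial>rho)
     + (\<integral>\<^sup>+x. heat_maximal B x * indicator (- core L (9 * r)) x \<partial>rho)"
    by (rule nn_integral_split_set[OF heat_maximal_measurable[OF B(1)] core_measurable])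
  also have "(\<integral>\<^sup>+x. heat_maximal B x * indicator (core L (9 * r)) x \<partial>rho) \<le> ennreal (H / (r * L\<^sup>2) * (128 * pi * L\<^sup>2 * (9 * r)))"
    using H r by (intro nn_integral_heat_maximal_core B) auto
  also have "H / (r * L\<^sup>2) * (128 * pi * L\<^sup>2 * (9 * r)) = 1152 * pi * H"
    using r L0 by (simp add: field_simps)
  also have "(\<integral>\<^sup>+x. heat_maximal B x * indicator (- core L (9 * r)) x \<partial>rho)
      \<le> ennreal (5 * 10 ^ 9 * pi + 6912 * pi * ln (1 + 324 * L\<^sup>2 * exp (2 * r)) / (9 * r) + 6912 * 32 * pi * L\<^sup>2 * exp (- 2 * (9 * r)))
      * (\<integral>\<^sup>+z. ennreal (cmod (B z)) \<partial>rho)"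
    by (rule heat_maximal_off_core[OF B supp r L(1)]) (use r in auto)
  also have "\<dots> \<le> ennreal (5 * 10 ^ 9 * pi + 6912 * pi * 38 + 6912 * 32 * pi) * 1"
  proof (rule mult_mono[OF ennreal_leI N])
    have "L\<^sup>2 \<le> (exp (8 * r))\<^sup>2" using L L0 by (intro power_mono) auto
    also have "(exp (8 * r))\<^sup>2 = exp (16 * r)" by (simp flip: exp_of_nat_mult)
    finally have L2: "L\<^sup>2 \<le> exp (16 * r)" .
    have "L\<^sup>2 * exp (2 * r) \<le> exp (16 * r) * exp (2 * r)" using L2 by (intro mult_right_mono) auto
    also have "\<dots> = exp (18 * r)" by (simp flip: exp_add)
    finally have "1 + 324 * L\<^sup>2 * exp (2 * r) \<le> 1 + 324 * exp (18 * r)" by simp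
    also have "\<dots> \<le> exp (18 * r) + 324 * exp (18 * r)" using r by simp
    finally have "1 + 324 * L\<^sup>2 * exp (2 * r) \<le> 325 * exp (18 * r)" by simp
    then have "ln (1 + 324 * L\<^sup>2 * exp (2 * r)) \<le> ln (325 * exp (18 * r))"
      by (subst ln_le_cancel_iff) (auto intro!: add_pos_nonneg)
    also have "\<dots> = ln 325 + 18 * r" by (simp add: ln_mult)
    also have "\<dots> \<le> 324 + 18 * r" using ln_le_minus_one[of 325] by simp
    also have "\<dots> \<le> 342 * r" using r by simp
    finally have l: "ln (1 + 324 * L\<^sup>2 * exp (2 * r)) \<le> 342 * r" .
    have "6912 * pi * ln (1 + 324 * L\<^sup>2 * exp (2 * r)) / (9 * r) \<le> 6912 * pi * (342 * r) / (9 * r)"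
      using l r by (intro divide_right_mono mult_left_mono) auto
    also have "\<dots> = 6912 * pi * 38" using r by simp
    finally have 1: "6912 * pi * ln (1 + 324 * L\<^sup>2 * exp (2 * r)) / (9 * r) \<le> 6912 * pi * 38" .
    have "L\<^sup>2 * exp (- 2 * (9 * r)) \<le> exp (16 * r) * exp (- 2 * (9 * r))"
      using L2 by (intro mult_right_mono) auto
    also have "\<dots> \<le> 1" using r by (simp flip: exp_add)
    finally have "6912 * 32 * pi * (L\<^sup>2 * exp (- 2 * (9 * r))) \<le> 6912 * 32 * pi * 1"
      by (intro mult_left_mono) auto
    then have "6912 * 32 * pi * L\<^sup>2 * exp (- 2 * (9 * r)) \<le> 6912 * 32 * pi"
      by (simp only: mult.assoc mult_1_right)
    with 1 show "5 * 10 ^ 9 * pi + 6912 * pi * ln (1 + 324 * L\<^sup>2 * exp (2 * r)) / (9 * r) + 6912 * 32 * pi * L\<^sup>2 * exp (- 2 * (9 * r))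
      \<le> 5 * 10 ^ 9 * pi + 6912 * pi * 38 + 6912 * 32 * pi"
      by (intro add_mono order_refl)
  qed auto
  finally show ?thesis using H by (simp add: add_mono flip: ennreal_plus)
qed

text \<open>By \<open>dist_gone_sinh\<close>, \<open>E <= exp h * h\<close>, and
  \<open>exp 2 <= 8\<close>; so a hyperbolic ball of radius \<open>R\<close> lies in the horizontal
  disc of radius \<open>8 R\<close>.\<close>

lemma small_ball_core:
  assumes x: "x \<in> G" and R: "hyp_dist x gone < R" "R \<le> 2"
  shows "x \<in> core R R"
proof -
  have a: "0 < height x" using x by (auto simp: G_def height_def)
  let ?h = "hyp_dist x gone"
  have h: "0 \<le> ?h" by (rule hyp_dist_nonneg[OF x gone_in_G])
  have v: "\<bar>ln (height x)\<bar> \<le> ?h" by (rule hyp_dist_gone_ge_ln[OF x])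
  have "height x \<le> exp ?h" using v a by (metis abs_le_D1 exp_le_cancel_iff exp_ln)
  then have "sqrt (height x) \<le> sqrt (exp ?h)" by simp
  also have "sqrt (exp ?h) = exp (?h / 2)"
    by (rule real_sqrt_unique) (auto simp flip: exp_of_nat_mult)
  finally have s: "sqrt (height x) \<le> exp (?h / 2)" .
  have "2 * sinh (?h / 2) = exp (?h / 2) * (1 - exp (- ?h))"
    by (simp add: sinh_field_def right_diff_distrib flip: exp_add)
  also have "\<dots> \<le> exp (?h / 2) * ?h"
    using exp_ge_add_one_self[of "- ?h"] by (intro mult_left_mono) auto
  finally have "dist x gone \<le> exp (?h / 2) * (exp (?h / 2) * ?h)"
    unfolding dist_gone_sinh[OF x] using s h a by (rule_tac mult_mono) auto
  also have "\<dots> = exp ?h * ?h" by (simp flip: exp_add mult.assoc)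
  also have "\<dots> \<le> 8 * R"
  proof (intro mult_mono)
    have "exp ?h \<le> exp 2" using R by simp
    also have "exp (2::real) = (exp 1)\<^sup>2" by (simp flip: exp_of_nat_mult)
    also have "\<dots> \<le> (272/100)\<^sup>2" using e_less_272 by (intro power_mono) auto
    finally show "exp ?h \<le> 8" by (simp add: power2_eq_square)
  qed (use R h in auto)
  finally have "(dist x gone)\<^sup>2 \<le> (8 * R)\<^sup>2" by (intro power_mono) auto
  then have "horiz_norm_sq x \<le> 64 * R\<^sup>2" using dist_gone_ge(1)[OF x] by (simp add: power_mult_distrib)
  then show ?thesis using x v R by (simp add: core_def)
qed

text \<open>The locally Euclidean regime in dimension three: the sup norm \<open>r^-3\<close> is
  balanced by a core of volume of order \<open>r^3\<close>, whose size \<open>R\<close> is the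
  threshold of \<open>kernel_at_diff_small\<close>.\<close>

lemma heat_maximal_small_atom:
  assumes B: "integrable rho B" "(\<integral>z. B z \<partial>rho) = 0" and supp: "AE z in rho. B z \<noteq> 0 \<longrightarrow> z \<in> box_at_one (exp 8 * r) r"
    and r: "0 < r" "16 * exp 9 * r \<le> 1"
    and M: "AE z in rho. cmod (B z) \<le> 1 / r ^ 3"
    and N: "(\<integral>\<^sup>+z. ennreal (cmod (B z)) \<partial>rho) \<le> 1"
  shows "(\<integral>\<^sup>+x. heat_maximal B x \<partial>rho) \<le> ennreal (128 * pi * (18 * exp 9) ^ 3 + 10 ^ 9 * exp 9 * (5 * pi))"
proof -
  define R where "R = 18 * exp 9 * r"
  have "exp 9 * r \<le> 1 / 16" using r by simp
  then have R: "0 < R" "R \<le> 2" using r unfolding R_def mult.assoc by (simp, linarith)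
  have [measurable]: "heat_maximal B \<in> borel_measurable rho" by (rule heat_maximal_measurable[OF B(1)])
  have pt: "heat_maximal B x * indicator (- core R R) x \<le> ennreal (10 ^ 9 * exp 9) * ennreal (far_profile r 1 x)" if x: "x \<in> G" for x
  proof (cases "x \<in> core R R")
    case False
    then have h: "18 * exp 9 * r \<le> hyp_dist x gone"
      using small_ball_core[OF x, of R] R unfolding R_def by fastforce
    have "heat_maximal B x \<le> ennreal (10 ^ 9 * exp 9 * far_profile r 1 x) * (\<integral>\<^sup>+z. ennreal (cmod (B z)) \<partial>rho)"
    proof (rule heat_maximal_le_cancel[OF B(1) x B(2) gone_in_G])
      fix t :: real assume "0 < t"
      note kernel_at_diff_small[OF this x _ r h]
      with supp show "AE z in rho. B z \<noteq> 0 \<longrightarrow> \<bar>kernel_at t x z - kernel_at t x gone\<bar> \<le> 10 ^ 9 * exp 9 * far_profile r 1 x"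
        by (auto elim!: eventually_mono)
    qed
    also have "\<dots> \<le> ennreal (10 ^ 9 * exp 9 * far_profile r 1 x) * 1"
      using N by (intro mult_left_mono) auto
    also have "\<dots> = ennreal (10 ^ 9 * exp 9) * ennreal (far_profile r 1 x)"
      using r by (simp only: mult_1_right) (rule ennreal_mult, auto intro: far_profile_nonneg)
    finally show ?thesis using False by (simp add: indicator_def)
  qed simp
  have "(\<integral>\<^sup>+x. heat_maximal B x \<partial>rho) = (\<integral>\<^sup>+x. heat_maximal B x * indicator (core R R) x \<partial>rho)
     + (\<integral>\<^sup>+x. heat_maximal B x * indicator (- core R R) x \<partial>rho)"
    by (rule nn_integral_split_set) measurable
  also have "(\<integral>\<^sup>+x. heat_maximal B x * indicator (core R R) x \<partial>rho) \<le> ennreal (1 / r ^ 3 * (128 * pi * R\<^sup>2 * R))"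
    using M r R by (intro nn_integral_heat_maximal_core B) auto
  also have "1 / r ^ 3 * (128 * pi * R\<^sup>2 * R) = 128 * pi * (18 * exp 9) ^ 3"
    using r by (simp add: R_def power2_eq_square power3_eq_cube)
  also have "(\<integral>\<^sup>+x. heat_maximal B x * indicator (- core R R) x \<partial>rho) \<le> (\<integral>\<^sup>+x. ennreal (10 ^ 9 * exp 9) * ennreal (far_profile r 1 x) \<partial>rho)"
    by (intro nn_integral_mono pt) (simp add: space_rho)
  also have "\<dots> = ennreal (10 ^ 9 * exp 9) * ennreal (5 * pi)"
    using nn_integral_far_profile[OF r(1), of 1] by (subst nn_integral_cmult) auto
  also have "\<dots> = ennreal (10 ^ 9 * exp 9 * (5 * pi))"
    by (rule ennreal_mult''[symmetric]) simp
  finally show ?thesis by (simp add: add_mono ennreal_plus[symmetric] del: ennreal_plus)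
qed

section \<open>Reduction to the identity by left translation\<close>

lemma rho_left_translate':
  assumes c: "c \<in> G"
  shows "rho = distr (density rho (\<lambda>_. ennreal ((height c)\<^sup>2))) rho (\<lambda>z. c \<cdot> z)"
  using c rho_left_translate[of "height c" "fst c" "fst (snd c)"] by (cases c) (auto simp: height_def G_def)

lemma nn_integral_left_translate:
  assumes c: "c \<in> G" and f: "f \<in> borel_measurable rho"
  shows "(\<integral>\<^sup>+z. f z \<partial>rho) = ennreal ((height c)\<^sup>2) * (\<integral>\<^sup>+z. f (c \<cdot> z) \<partial>rho)"
proof -
  note m = left_translate_measurable[OF c]
  have fc: "(\<lambda>z. f (c \<cdot> z)) \<in> borel_measurable rho" using measurable_compose[OF m f] .
  have "(\<integral>\<^sup>+z. f z \<partial>rho) = (\<integral>\<^sup>+z. f z \<partial>distr (density rho (\<lambda>_. ennreal ((height c)\<^sup>2))) rho (\<lambda>z. c \<cdot> z))"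
    by (subst rho_left_translate'[OF c]) (rule refl)
  also have "\<dots> = (\<integral>\<^sup>+z. ennreal ((height c)\<^sup>2) * f (c \<cdot> z) \<partial>rho)"
    using m f fc by (subst nn_integral_distr) (auto simp: nn_integral_density)
  finally show ?thesis using fc by (simp add: nn_integral_cmult)
qed

lemma integral_left_translate:
  fixes f :: "pt \<Rightarrow> complex"
  assumes c: "c \<in> G" and f: "integrable rho f"
  shows "integrable rho (\<lambda>z. f (c \<cdot> z))" "(\<integral>z. f z \<partial>rho) = (height c)\<^sup>2 *\<^sub>R (\<integral>z. f (c \<cdot> z) \<partial>rho)"
proof -
  have a: "0 < height c" using c by (auto simp: G_def height_def)
  note m = left_translate_measurable[OF c]
  have fm [measurable]: "f \<in> borel_measurable rho" using f by simp
  have fc: "(\<lambda>z. f (c \<cdot> z)) \<in> borel_measurable rho" using measurable_compose[OF m fm] .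
  have "(\<integral>\<^sup>+z. ennreal (cmod (f z)) \<partial>rho) = ennreal ((height c)\<^sup>2) * (\<integral>\<^sup>+z. ennreal (cmod (f (c \<cdot> z))) \<partial>rho)"
    using fm by (intro nn_integral_left_translate[OF c]) measurable
  then have "ennreal ((height c)\<^sup>2) * (\<integral>\<^sup>+z. ennreal (cmod (f (c \<cdot> z))) \<partial>rho) < \<infinity>"
    using f by (simp add: integrable_iff_bounded)
  then have "(\<integral>\<^sup>+z. ennreal (cmod (f (c \<cdot> z))) \<partial>rho) < \<infinity>"
    using a by (auto simp: ennreal_mult_less_top)
  then show i: "integrable rho (\<lambda>z. f (c \<cdot> z))" using fc by (simp add: integrable_iff_bounded)
  have "(\<integral>z. f z \<partial>rho) = (\<integral>z. f z \<partial>distr (density rho (\<lambda>_. ennreal ((height c)\<^sup>2))) rho (\<lambda>z. c \<cdot> z))"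
    by (subst rho_left_translate'[OF c]) (rule refl)
  also have "\<dots> = (\<integral>z. f (c \<cdot> z) \<partial>density rho (\<lambda>_. ennreal ((height c)\<^sup>2)))"
    by (rule integral_distr) (use m fm in auto)
  also have "\<dots> = (\<integral>z. (height c)\<^sup>2 *\<^sub>R f (c \<cdot> z) \<partial>rho)"
    by (rule integral_density) (use fc in auto)
  finally show "(\<integral>z. f z \<partial>rho) = (height c)\<^sup>2 *\<^sub>R (\<integral>z. f (c \<cdot> z) \<partial>rho)" by simp
qed

lemma AE_left_translate:
  assumes c: "c \<in> G" and P: "AE z in rho. P z"
  shows "AE z in rho. P (c \<cdot> z)"
proof -
  have a: "0 < height c" using c by (auto simp: G_def height_def)
  have "AE z in distr (density rho (\<lambda>_. ennreal ((height c)\<^sup>2))) rho (\<lambda>z. c \<cdot> z). P z"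
    using P by (subst (asm) rho_left_translate'[OF c])
  moreover have "(\<lambda>z. c \<cdot> z) \<in> measurable (density rho (\<lambda>_. ennreal ((height c)\<^sup>2))) rho"
    using left_translate_measurable[OF c] by simp
  ultimately have "AE z in density rho (\<lambda>_. ennreal ((height c)\<^sup>2)). P (c \<cdot> z)"
    by (rule AE_distrD[rotated])
  then have "AE z in rho. 0 < ennreal ((height c)\<^sup>2) \<longrightarrow> P (c \<cdot> z)"
    by (subst (asm) AE_density) simp_all
  then show ?thesis using a by simp
qed

lemma emeasure_box_rho:
  assumes "0 < a" "0 \<le> L" "0 \<le> r"
  shows "emeasure rho ({x1 - L/2 .. x1 + L/2} \<times> {x2 - L/2 .. x2 + L/2} \<times> {a * exp (- r) .. a * exp r}) = ennreal (2 * r * L\<^sup>2)"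
    (is "emeasure rho ?R = _")
proof -
  have pos: "0 < b" if "a * exp (- r) \<le> b" for b
    using that assms(1) by (smt (verit) exp_gt_zero mult_pos_pos)
  have "?R \<in> sets rho"
    unfolding sets_rho_iff by (auto simp: G_def pos intro!: borel_closed closed_Times)
  then have "emeasure rho ?R = (\<integral>\<^sup>+v. \<integral>\<^sup>+y1. \<integral>\<^sup>+y2. indicator ?R (y1, y2, exp v) \<partial>lborel \<partial>lborel \<partial>lborel)"
    by (rule emeasure_rho)
  also have "\<dots> = (\<integral>\<^sup>+v. \<integral>\<^sup>+y1. \<integral>\<^sup>+y2. indicator {ln a - r..ln a + r} v * (indicator {x1 - L/2 .. x1 + L/2} y1 * indicator {x2 - L/2 .. x2 + L/2} y2) \<partial>lborel \<partial>lborel \<partial>lborel)"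
  proof (intro nn_integral_cong)
    fix v y1 y2 :: real
    have "a * exp (- r) \<le> exp v \<longleftrightarrow> ln a - r \<le> v" "exp v \<le> a * exp r \<longleftrightarrow> v \<le> ln a + r"
      using assms(1) by (metis exp_ln exp_add exp_le_cancel_iff diff_conv_add_uminus)+
    then show "indicator ?R (y1, y2, exp v) = (indicator {ln a - r..ln a + r} v * (indicator {x1 - L/2 .. x1 + L/2} y1 * indicator {x2 - L/2 .. x2 + L/2} y2) :: ennreal)"
      by (auto simp: indicator_def)
  qed
  also have "\<dots> = ennreal (2 * r) * (ennreal L * ennreal L)"
    using assms by (simp add: nn_integral_cmult nn_integral_multc)
  also have "\<dots> = ennreal (2 * r * L\<^sup>2)"
    using assms by (simp add: power2_eq_square ennreal_mult)
  finally show ?thesis .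
qed

lemma atom_bound:
  assumes "atom A"
  obtains x1 x2 a L r where "0 < a" "0 < L" "0 < r"
    "r < 1 \<Longrightarrow> exp 2 * a * r \<le> L \<and> L < exp 8 * a * r" "1 \<le> r \<Longrightarrow> a * exp (2 * r) \<le> L \<and> L < a * exp (8 * r)"
    "AE z in rho. A z \<noteq> 0 \<longrightarrow> z \<in> {x1 - L/2 .. x1 + L/2} \<times> {x2 - L/2 .. x2 + L/2} \<times> {a * exp (- r) .. a * exp r}"
    "AE z in rho. cmod (A z) \<le> 1 / (2 * r * L\<^sup>2)"
    "(\<integral>\<^sup>+z. ennreal (cmod (A z)) \<partial>rho) \<le> 1"
proof -
  obtain R where R: "CZ_set R" "AE x in rho. x \<notin> R \<longrightarrow> A x = 0"
    "esssup rho (\<lambda>x. ennreal (cmod (A x))) \<le> inverse (emeasure rho R)" and A: "integrable rho A"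
    using assms by (auto simp: atom_def)
  from R(1) obtain x1 x2 a L r where c: "(x1, x2, a) \<in> G" "0 < L" "0 < r"
    "r < 1 \<longrightarrow> exp 2 * a * r \<le> L \<and> L < exp 8 * a * r" "1 \<le> r \<longrightarrow> a * exp (2 * r) \<le> L \<and> L < a * exp (8 * r)"
    and Re: "R = {x1 - L/2 .. x1 + L/2} \<times> {x2 - L/2 .. x2 + L/2} \<times> {a * exp (- r) .. a * exp r}"
    unfolding CZ_set_def by blast
  have a: "0 < a" using c by (simp add: G_def)
  have eR: "emeasure rho R = ennreal (2 * r * L\<^sup>2)"
    unfolding Re using a c by (intro emeasure_box_rho) auto
  have p: "0 < 2 * r * L\<^sup>2" using c by simp
  have inv: "inverse (emeasure rho R) = ennreal (1 / (2 * r * L\<^sup>2))"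
    unfolding eR using p by (simp add: inverse_ennreal inverse_eq_divide)
  have bd: "AE z in rho. ennreal (cmod (A z)) \<le> inverse (emeasure rho R)"
  proof -
    have "AE z in rho. ennreal (cmod (A z)) \<le> esssup rho (\<lambda>x. ennreal (cmod (A x)))" by (rule esssup_AE)
    then show ?thesis by eventually_elim (rule order_trans[OF _ R(3)])
  qed
  then have bd': "AE z in rho. cmod (A z) \<le> 1 / (2 * r * L\<^sup>2)"
    unfolding inv using p by (auto elim!: eventually_mono simp: ennreal_le_iff)
  \<comment> \<open>Non-measurable sets have \<open>emeasure\<close> zero by convention, so a
    positive value certifies measurability.\<close>
  have Rs: "R \<in> sets rho"
    using eR p by (metis emeasure_notin_sets ennreal_eq_0_iff not_le)
  have "(\<integral>\<^sup>+z. ennreal (cmod (A z)) \<partial>rho) \<le> (\<integral>\<^sup>+z. inverse (emeasure rho R) * indicator R z \<partial>rho)"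
    by (rule nn_integral_mono_AE) (use bd R(2) in \<open>eventually_elim, auto simp: indicator_def\<close>)
  also have "\<dots> = inverse (emeasure rho R) * emeasure rho R"
    using Rs by (simp add: nn_integral_cmult_indicator)
  also have "\<dots> = 1"
    unfolding inv unfolding eR using p by (subst ennreal_mult[symmetric]) auto
  finally have "(\<integral>\<^sup>+z. ennreal (cmod (A z)) \<partial>rho) \<le> 1" .
  moreover have "AE z in rho. A z \<noteq> 0 \<longrightarrow> z \<in> R" using R(2) by eventually_elim auto
  ultimately show thesis using that[of a L r x1 x2] a c bd' unfolding Re by blast
qed

text \<open>An intermediate radius \<open>eps < r < 1\<close> is treated as radius one, at the price of the constant \<open>H\<close>:
  for such \<open>r\<close> the box is too large for \<open>kernel_at_diff_small\<close>.\<close>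

lemma heat_maximal_atom:
  obtains C :: real where "0 < C" "\<And>A. atom A \<Longrightarrow> (\<integral>\<^sup>+x. heat_maximal A x \<partial>rho) \<le> ennreal C"
proof
  \<comment> \<open>The largest radius that \<open>heat_maximal_small_atom\<close> admits.\<close>
  define eps :: real where "eps = 1 / (16 * exp 9)"
  have eps: "0 < eps" by (simp add: eps_def)
  \<comment> \<open>For \<open>eps < r < 1\<close> the sup norm is below \<open>eps^-3\<close> and
    the support is enlarged to side \<open>exp 8\<close> and radius one; \<open>exp 16\<close> is
    the square of that side.\<close>
  define H where "H = 1 + exp 16 / eps ^ 3"
  have H: "1 \<le> H" "exp 16 / eps ^ 3 \<le> H" using eps by (auto simp: H_def)
  define C1 where "C1 = 1152 * pi * H + (5 * 10 ^ 9 * pi + 6912 * pi * 38 + 6912 * 32 * pi)"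
  define C2 where "C2 = 128 * pi * (18 * exp 9) ^ 3 + 10 ^ 9 * exp 9 * (5 * pi :: real)"
  have C12: "0 < C1" "0 < C2" using H by (auto simp: C1_def C2_def intro!: add_pos_pos add_nonneg_pos)
  then show "0 < C1 + C2" by simp
  fix A assume A: "atom A"
  then have Ai: "integrable rho A" "(\<integral>z. A z \<partial>rho) = 0" by (auto simp: atom_def)
  obtain x1 x2 a L r where p: "0 < a" "0 < L" "0 < r"
    and small: "r < 1 \<Longrightarrow> exp 2 * a * r \<le> L \<and> L < exp 8 * a * r" and large: "1 \<le> r \<Longrightarrow> a * exp (2 * r) \<le> L \<and> L < a * exp (8 * r)"
    and supp: "AE z in rho. A z \<noteq> 0 \<longrightarrow> z \<in> {x1 - L/2 .. x1 + L/2} \<times> {x2 - L/2 .. x2 + L/2} \<times> {a * exp (- r) .. a * exp r}"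
    and bd: "AE z in rho. cmod (A z) \<le> 1 / (2 * r * L\<^sup>2)"
    and N: "(\<integral>\<^sup>+z. ennreal (cmod (A z)) \<partial>rho) \<le> 1"
    by (rule atom_bound[OF A]) (rule that)
  define c where "c = (x1, x2, a)"
  have c: "c \<in> G" "height c = a" using p by (auto simp: c_def G_def height_def)
  \<comment> \<open>The factor \<open>a^2\<close> is the scaling of \<open>rho\<close> under left
    translation; it preserves the L1 norm of the atom and of its maximal function.\<close>
  define B where "B z = complex_of_real (a\<^sup>2) * A (c \<cdot> z)" for z
  have Bi: "integrable rho B" unfolding B_def using integral_left_translate(1)[OF c(1) Ai(1)] by simp
  have B0: "(\<integral>z. B z \<partial>rho) = 0"
    using integral_left_translate(2)[OF c(1) Ai(1)] Ai(2) by (simp add: B_def c scaleR_conv_of_real)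
  have BN: "(\<integral>\<^sup>+z. ennreal (cmod (B z)) \<partial>rho) \<le> 1"
  proof -
    have [measurable]: "A \<in> borel_measurable rho" using Ai by simp
    have [measurable]: "(\<lambda>z. A (c \<cdot> z)) \<in> borel_measurable rho" using integral_left_translate(1)[OF c(1) Ai(1)] by simp
    have "(\<integral>\<^sup>+z. ennreal (cmod (B z)) \<partial>rho) = (\<integral>\<^sup>+z. ennreal (a\<^sup>2) * ennreal (cmod (A (c \<cdot> z))) \<partial>rho)"
      by (simp add: B_def norm_mult ennreal_mult norm_power)
    also have "\<dots> = (\<integral>\<^sup>+z. ennreal (cmod (A z)) \<partial>rho)"
      using nn_integral_left_translate[OF c(1), of "\<lambda>z. ennreal (cmod (A z))"] by (simp add: c nn_integral_cmult)
    finally show ?thesis using N by simp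
  qed
  have Bbd: "AE z in rho. cmod (B z) \<le> 1 / (2 * r * (L / a)\<^sup>2)"
    using AE_left_translate[OF c(1) bd]
  proof eventually_elim
    case (elim z)
    have "cmod (B z) \<le> a\<^sup>2 * (1 / (2 * r * L\<^sup>2))"
      unfolding B_def norm_mult using elim by (intro mult_mono) (auto simp: norm_power)
    then show ?case using p by (simp add: power_divide)
  qed
  have Bsupp: "AE z in rho. B z \<noteq> 0 \<longrightarrow> z \<in> box_at_one (L / a) r"
    using AE_left_translate[OF c(1) supp] AE_space
  proof eventually_elim
    case (elim z)
    show ?case
    proof
      assume "B z \<noteq> 0"
      then have m: "c \<cdot> z \<in> {x1 - L/2 .. x1 + L/2} \<times> {x2 - L/2 .. x2 + L/2} \<times> {a * exp (- r) .. a * exp r}"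
        using elim by (auto simp: B_def)
      obtain z1 z2 b where z: "z = (z1, z2, b)" by (metis surj_pair)
      have b: "0 < b" using elim by (simp add: z space_rho G_def)
      from m have "\<bar>a * z1\<bar> \<le> L / 2" "\<bar>a * z2\<bar> \<le> L / 2" "exp (- r) \<le> b" "b \<le> exp r"
        using p by (auto simp: z c_def abs_le_iff)
      moreover from this(3,4) b have "\<bar>ln b\<bar> \<le> r"
        by (metis abs_leI exp_le_cancel_iff exp_ln minus_le_iff)
      ultimately show "z \<in> box_at_one (L / a) r"
        using p b by (simp add: box_at_one_def z G_def abs_mult field_simps)
    qed
  qed
  have eq: "(\<integral>\<^sup>+x. heat_maximal A x \<partial>rho) = (\<integral>\<^sup>+x. heat_maximal B x \<partial>rho)"
  proof -
    have "(\<integral>\<^sup>+x. heat_maximal B x \<partial>rho) = (\<integral>\<^sup>+x. ennreal (a\<^sup>2) * heat_maximal A (c \<cdot> x) \<partial>rho)"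
      unfolding heat_maximal_translate B_def
      using heat_maximal_cmult[OF integral_left_translate(1)[OF c(1) Ai(1)], of _ "complex_of_real (a\<^sup>2)"]
      by (intro nn_integral_cong) (simp add: space_rho norm_power)
    also have "\<dots> = ennreal (a\<^sup>2) * (\<integral>\<^sup>+x. heat_maximal A (c \<cdot> x) \<partial>rho)"
      using measurable_compose[OF left_translate_measurable[OF c(1)] heat_maximal_measurable[OF Ai(1)]]
      by (rule nn_integral_cmult)
    also have "\<dots> = (\<integral>\<^sup>+x. heat_maximal A x \<partial>rho)"
      using nn_integral_left_translate[OF c(1) heat_maximal_measurable[OF Ai(1)]] by (simp add: c)
    finally show ?thesis ..
  qed
  have le: "u \<le> ennreal (C1 + C2)" if "u \<le> ennreal C1 \<or> u \<le> ennreal C2" for u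
    using that C12 by (auto elim!: order_trans intro: ennreal_leI)
  have box_at_one_mono: "box_at_one L r \<subseteq> box_at_one L' r'" if "L \<le> L'" "r \<le> r'" for L L' r r' :: real
    using that by (auto simp: box_at_one_def)
  have Lr: "exp 2 * r \<le> L / a" "L / a \<le> exp 8 * r" if "r < 1"
    using small[OF that] p by (auto simp: field_simps)
  have Bbd3: "AE z in rho. cmod (B z) \<le> 1 / r ^ 3" if "r < 1"
  proof -
    have "r * 1 \<le> r * exp 2" using p by (intro mult_left_mono) auto
    then have "r \<le> L / a" using Lr(1)[OF that] by (simp add: mult.commute)
    then have "r * r\<^sup>2 \<le> 2 * r * (L / a)\<^sup>2" using p by (intro mult_mono power_mono) auto
    then have le3: "1 / (2 * r * (L / a)\<^sup>2) \<le> 1 / r ^ 3"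
      using p by (intro divide_left_mono) (auto simp: power3_eq_cube power2_eq_square)
    show ?thesis using Bbd by eventually_elim (rule order_trans[OF _ le3])
  qed
  consider "1 \<le> r" | "eps < r" "r < 1" | "r \<le> eps" "r < 1" using eps by linarith
  then show "(\<integral>\<^sup>+x. heat_maximal A x \<partial>rho) \<le> ennreal (C1 + C2)"
  proof cases
    case 1
    have L': "exp (2 * r) \<le> L / a" "L / a \<le> exp (8 * r)" using large[OF 1] p by (auto simp: field_simps)
    have "AE z in rho. cmod (B z) \<le> H / (r * (L / a)\<^sup>2)"
      using Bbd
    proof eventually_elim
      case (elim z)
      have "1 / (2 * r * (L / a)\<^sup>2) = (1/2) / (r * (L / a)\<^sup>2)" by simp
      also have "\<dots> \<le> H / (r * (L / a)\<^sup>2)" using H p by (intro divide_right_mono) auto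
      finally show ?case using elim by simp
    qed
    then show ?thesis unfolding eq
      using H by (intro le disjI1, unfold C1_def) (rule heat_maximal_large_atom[OF Bi B0 Bsupp 1 L' _ _ BN], auto)
  next
    case 2
    have "L / a \<le> exp 8 * 1" using Lr(2)[OF 2(2)] 2 by (meson exp_ge_zero less_imp_le mult_left_mono order_trans)
    then have s2: "AE z in rho. B z \<noteq> 0 \<longrightarrow> z \<in> box_at_one (exp 8) 1"
      using Bsupp box_at_one_mono[of "L / a" "exp 8" r 1] 2 by (auto elim!: eventually_mono)
    have b2: "AE z in rho. cmod (B z) \<le> H / (1 * (exp 8)\<^sup>2)"
      using Bbd3[OF 2(2)]
    proof eventually_elim
      case (elim z)
      have "1 / r ^ 3 \<le> 1 / eps ^ 3" using 2 eps by (intro divide_left_mono power_mono) auto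
      also have "\<dots> = (exp 16 / eps ^ 3) / (1 * (exp 8)\<^sup>2)" by (simp flip: exp_of_nat_mult)
      also have "\<dots> \<le> H / (1 * (exp 8)\<^sup>2)" using H by (intro divide_right_mono) auto
      finally show ?case using elim by simp
    qed
    show ?thesis unfolding eq
      by (intro le disjI1, unfold C1_def) (rule heat_maximal_large_atom[OF Bi B0 s2 _ _ _ _ b2 BN], use H in auto)
  next
    case 3
    have s3: "AE z in rho. B z \<noteq> 0 \<longrightarrow> z \<in> box_at_one (exp 8 * r) r"
      using Bsupp box_at_one_mono[of "L / a" "exp 8 * r" r r] Lr(2)[OF 3(2)] by (auto elim!: eventually_mono)
    have r3: "16 * exp 9 * r \<le> 1" using 3 by (simp add: eps_def field_simps)
    show ?thesis unfolding eq
      by (intro le disjI2, unfold C2_def) (rule heat_maximal_small_atom[OF Bi B0 s3 p(3) r3 Bbd3[OF 3(2)] BN])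
  qed
qed

lemma heat_maximal_decomposition:
  assumes C: "0 < C" "\<And>A. atom A \<Longrightarrow> (\<integral>\<^sup>+x. heat_maximal A x \<partial>rho) \<le> ennreal C"
    and f: "integrable rho f" and d: "atomic_decomposition f l A"
  shows "(\<integral>\<^sup>+x. heat_maximal f x \<partial>rho) \<le> ennreal (C * (\<Sum>j. cmod (l j)))"
proof -
  have A: "atom (A j)" "integrable rho (A j)" for j using d by (auto simp: atomic_decomposition_def atom_def)
  have s: "summable (\<lambda>j. cmod (l j))" using d by (simp add: atomic_decomposition_def)
  have "(\<integral>\<^sup>+x. heat_maximal f x \<partial>rho) \<le> (\<integral>\<^sup>+x. (\<Sum>j. ennreal (cmod (l j)) * heat_maximal (A j) x) \<partial>rho)"
  proof (rule nn_integral_mono)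
    fix x assume "x \<in> space rho"
    then have x: "x \<in> G" by (simp add: space_rho)
    have "heat_maximal f x \<le> (\<Sum>j. heat_maximal (\<lambda>z. l j * A j z) x)"
      using d A by (intro heat_maximal_series[OF f _ x]) (auto simp: atomic_decomposition_def)
    then show "heat_maximal f x \<le> (\<Sum>j. ennreal (cmod (l j)) * heat_maximal (A j) x)"
      by (simp add: heat_maximal_cmult[OF A(2) x])
  qed
  also have "\<dots> = (\<Sum>j. \<integral>\<^sup>+x. ennreal (cmod (l j)) * heat_maximal (A j) x \<partial>rho)"
    by (intro nn_integral_suminf borel_measurable_times_ennreal heat_maximal_measurable[OF A(2)]) simp
  also have "\<dots> = (\<Sum>j. ennreal (cmod (l j)) * (\<integral>\<^sup>+x. heat_maximal (A j) x \<partial>rho))"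
    using heat_maximal_measurable[OF A(2)] by (simp add: nn_integral_cmult)
  also have "\<dots> \<le> (\<Sum>j. ennreal (C * cmod (l j)))"
  proof (intro suminf_le)
    show "ennreal (cmod (l j)) * (\<integral>\<^sup>+x. heat_maximal (A j) x \<partial>rho) \<le> ennreal (C * cmod (l j))" for j
      using mult_left_mono[OF C(2)[OF A(1)], of "ennreal (cmod (l j))" j] C(1)
      by (simp add: ennreal_mult mult.commute)
  qed auto
  also have "\<dots> = ennreal (\<Sum>j. C * cmod (l j))"
    using C s by (intro suminf_ennreal2 summable_mult) auto
  also have "(\<Sum>j. C * cmod (l j)) = C * (\<Sum>j. cmod (l j))"
    by (rule suminf_mult[OF s])
  finally show ?thesis .
qed

lemma H1_heat_maximal:
  obtains C :: real where "0 < C"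
    "\<And>f. f \<in> H1 \<Longrightarrow> in_L1 (heat_maximal f) \<and> L1_norm (heat_maximal f) \<le> ennreal (C * H1_norm f)"
proof -
  obtain C :: real where C: "0 < C" "\<And>A. atom A \<Longrightarrow> (\<integral>\<^sup>+x. heat_maximal A x \<partial>rho) \<le> ennreal C"
    using heat_maximal_atom by blast
  have "in_L1 (heat_maximal f) \<and> L1_norm (heat_maximal f) \<le> ennreal (C * H1_norm f)" if "f \<in> H1" for f
  proof -
    have f: "integrable rho f" and ex: "\<exists>l A. atomic_decomposition f l A" using that by (auto simp: H1_def)
    let ?S = "{\<Sum>j. cmod (l j) | l A. atomic_decomposition f l A}"
    have ne: "?S \<noteq> {}" using ex by blast
    have le: "L1_norm (heat_maximal f) \<le> ennreal (C * s)" if "s \<in> ?S" for s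
      using that heat_maximal_decomposition[OF C f] by (auto simp: L1_norm_def)
    then have fin: "L1_norm (heat_maximal f) < \<infinity>" using ne by (force intro: le_less_trans)
    \<comment> \<open>\<open>H1_norm\<close> is a real infimum, so the bound for each decomposition
      is first turned into a real lower bound \<open>m / C\<close>.\<close>
    define m where "m = enn2real (L1_norm (heat_maximal f))"
    have m: "L1_norm (heat_maximal f) = ennreal m" "0 \<le> m" using fin by (auto simp: m_def)
    have "m / C \<le> s" if "s \<in> ?S" for s
    proof -
      have "0 \<le> s" using that by (auto simp: atomic_decomposition_def intro!: suminf_nonneg)
      then have "m \<le> C * s" using le[OF that] C(1) unfolding m by (simp add: ennreal_le_iff)
      then show ?thesis using C(1) by (simp add: divide_le_eq mult.commute)
    qed
    then have "m / C \<le> H1_norm f" unfolding H1_norm_def using ne by (intro cInf_greatest) auto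
    then have "m \<le> C * H1_norm f" using C(1) by (simp add: divide_le_eq mult.commute)
    then show ?thesis
      using fin heat_maximal_measurable[OF f] unfolding m by (auto simp: in_L1_def m intro: ennreal_leI)
  qed
  with C(1) show thesis using that by blast
qed

section \<open>A family of functions of bounded mean oscillation\<close>

text \<open>If the interval is far from the origin relative to its length, the logarithm varies by
  at most \<open>ln 2\<close>. Otherwise it lies in \<open>[- 2 L, 2 L]\<close>, and the deficit
  below \<open>ln (1 + 2 * L)\<close> integrates exactly to
  \<open>2 * (2 * L - ln (1 + 2 * L))\<close>.\<close>

lemma log_oscillation:
  fixes x0 L :: real
  assumes L: "0 < L"
  obtains m where "(\<integral>\<^sup>+y. ennreal \<bar>ln (1 + \<bar>y\<bar>) - m\<bar> * indicator {x0 - L/2..x0 + L/2} y \<partial>lborel) \<le> ennreal (4 * L)"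
proof (cases "L \<le> \<bar>x0\<bar>")
  case True
  have "\<bar>ln (1 + \<bar>y\<bar>) - ln (1 + \<bar>x0\<bar>)\<bar> \<le> 4" if y: "y \<in> {x0 - L/2..x0 + L/2}" for y
  proof -
    have "\<bar>y - x0\<bar> \<le> L / 2" unfolding abs_le_iff using y by (auto simp: field_simps)
    then have "\<bar>y - x0\<bar> \<le> \<bar>x0\<bar> / 2" using True by linarith
    then have "1 + \<bar>x0\<bar> \<le> 2 * (1 + \<bar>y\<bar>)" "1 + \<bar>y\<bar> \<le> 2 * (1 + \<bar>x0\<bar>)" by (smt (verit) field_sum_of_halves)+
    moreover have "ln u \<le> ln 2 + ln w" if "0 < u" "0 < w" "u \<le> 2 * w" for u w :: real
    proof -
      have "ln u \<le> ln (2 * w)" using that by simp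
      also have "\<dots> = ln 2 + ln w" using that by (simp add: ln_mult)
      finally show ?thesis .
    qed
    ultimately have "ln (1 + \<bar>x0\<bar>) \<le> ln 2 + ln (1 + \<bar>y\<bar>)" "ln (1 + \<bar>y\<bar>) \<le> ln 2 + ln (1 + \<bar>x0\<bar>)"
      by (simp_all add: add_pos_nonneg)
    moreover have "ln 2 \<le> (1 :: real)" using ln_le_minus_one[of 2] by simp
    ultimately show ?thesis by (simp add: abs_le_iff)
  qed
  then have "(\<integral>\<^sup>+y. ennreal \<bar>ln (1 + \<bar>y\<bar>) - ln (1 + \<bar>x0\<bar>)\<bar> * indicator {x0 - L/2..x0 + L/2} y \<partial>lborel)
     \<le> (\<integral>\<^sup>+y. ennreal 4 * indicator {x0 - L/2..x0 + L/2} y \<partial>lborel)"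
    by (intro nn_integral_mono) (auto simp: indicator_def intro!: ennreal_leI simp del: ennreal_numeral)
  also have "\<dots> = ennreal 4 * ennreal L"
    using L by (subst nn_integral_cmult_indicator) auto
  also have "\<dots> = ennreal (4 * L)" by (rule ennreal_mult''[symmetric]) (use L in simp)
  finally show ?thesis by (rule that)
next
  case False
  have "(\<integral>\<^sup>+y. ennreal \<bar>ln (1 + \<bar>y\<bar>) - ln (1 + 2 * L)\<bar> * indicator {x0 - L/2..x0 + L/2} y \<partial>lborel)
     \<le> (\<integral>\<^sup>+y. ennreal (ln (1 + 2 * L) - ln (1 + \<bar>y\<bar>)) * indicator {0..2 * L} \<bar>y\<bar> \<partial>lborel)"
  proof (intro nn_integral_mono)
    fix y :: real
    show "ennreal \<bar>ln (1 + \<bar>y\<bar>) - ln (1 + 2 * L)\<bar> * indicator {x0 - L/2..x0 + L/2} y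
      \<le> ennreal (ln (1 + 2 * L) - ln (1 + \<bar>y\<bar>)) * indicator {0..2 * L} \<bar>y\<bar>"
    proof (cases "y \<in> {x0 - L/2..x0 + L/2}")
      case True
      then have y: "\<bar>y\<bar> \<le> 2 * L" using False L by (auto simp: abs_le_iff abs_less_iff)
      then have "ln (1 + \<bar>y\<bar>) \<le> ln (1 + 2 * L)" using L by (subst ln_le_cancel_iff) auto
      then show ?thesis using True y by simp
    qed simp
  qed
  also have "\<dots> = 2 * (\<integral>\<^sup>+y. ennreal (ln (1 + 2 * L) - ln (1 + y)) * indicator {0..2 * L} y * indicator {0..} y \<partial>lborel)"
    by (rule nn_integral_even) measurable
  also have "(\<integral>\<^sup>+y. ennreal (ln (1 + 2 * L) - ln (1 + y)) * indicator {0..2 * L} y * indicator {0..} y \<partial>lborel)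
     = (\<integral>\<^sup>+y. ennreal (ln (1 + 2 * L) - ln (1 + y)) * indicator {0..2 * L} y \<partial>lborel)"
    by (intro nn_integral_cong) (auto simp: indicator_def)
  also have "\<dots> = ((2 * L) * ln (1 + 2 * L) - ((1 + 2 * L) * ln (1 + 2 * L) - 2 * L))
      - (0 * ln (1 + 2 * L) - ((1 + 0) * ln (1 + 0) - 0))"
  proof (rule nn_integral_FTC_Icc)
    fix y :: real assume y: "y \<in> {0..2 * L}"
    then show "((\<lambda>y. y * ln (1 + 2 * L) - ((1 + y) * ln (1 + y) - y)) has_real_derivative ln (1 + 2 * L) - ln (1 + y)) (at y)"
      by (auto intro!: derivative_eq_intros)
    show "0 \<le> ln (1 + 2 * L) - ln (1 + y)" using y L by (simp add: ln_le_cancel_iff)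
  qed (use L in auto)
  also have "\<dots> = ennreal (2 * L - ln (1 + 2 * L))" by (simp add: algebra_simps)
  also have "2 * ennreal (2 * L - ln (1 + 2 * L)) \<le> 2 * ennreal (2 * L)"
    using L by (intro mult_left_mono ennreal_leI) auto
  also have "\<dots> = ennreal (4 * L)" using L ennreal_mult''[of "2 * L" 2] by simp
  finally show ?thesis by (rule that)
qed

text \<open>The truncation at \<open>N\<close> makes the function bounded, hence pairable with L1.
  Being a contraction, \<open>min _ N\<close> does not increase oscillations, so all bounds are
  uniform in \<open>N\<close>.\<close>

definition log_bmo :: "real \<Rightarrow> pt \<Rightarrow> real" where
  "log_bmo N z = min (ln (1 + \<bar>fst z\<bar>)) N"

lemma log_bmo_measurable [measurable]: "log_bmo N \<in> borel_measurable borel"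
  unfolding log_bmo_def by measurable

lemma log_bmo_bounds: "0 \<le> N \<Longrightarrow> 0 \<le> log_bmo N z" "log_bmo N z \<le> N"
  by (auto simp: log_bmo_def)

lemma integrable_mult_log_bmo:
  assumes "integrable rho f" "0 \<le> N"
  shows "integrable rho (\<lambda>z. f z * complex_of_real (log_bmo N z))"
proof (rule Bochner_Integration.integrable_bound)
  have [measurable]: "f \<in> borel_measurable rho" using assms by simp
  show "(\<lambda>z. f z * complex_of_real (log_bmo N z)) \<in> borel_measurable rho" by measurable
  show "integrable rho (\<lambda>z. N * cmod (f z))" using assms by simp
  show "AE z in rho. norm (f z * complex_of_real (log_bmo N z)) \<le> norm (N * cmod (f z))"
    using assms(2) log_bmo_bounds[of N]
    by (auto simp: norm_mult abs_mult mult.commute[of N] intro!: AE_I2 mult_left_mono)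
qed

text \<open>The function depends on \<open>fst z\<close> alone, so its oscillation over a box is a
  one-dimensional one, and the normalisation of the atom divides by the volume. Zero mean allows
  subtraction of \<open>min m N\<close>.\<close>

lemma atom_log_bmo:
  assumes A: "atom A" and N: "0 \<le> N"
  shows "cmod (\<integral>z. A z * complex_of_real (log_bmo N z) \<partial>rho) \<le> 4"
proof -
  have Ai: "integrable rho A" "(\<integral>z. A z \<partial>rho) = 0" using A by (auto simp: atom_def)
  have [measurable]: "A \<in> borel_measurable rho" using Ai by simp
  obtain x1 x2 a L r where p: "0 < a" "0 < L" "0 < r"
    and "r < 1 \<Longrightarrow> exp 2 * a * r \<le> L \<and> L < exp 8 * a * r" and "1 \<le> r \<Longrightarrow> a * exp (2 * r) \<le> L \<and> L < a * exp (8 * r)"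
    and supp: "AE z in rho. A z \<noteq> 0 \<longrightarrow> z \<in> {x1 - L/2 .. x1 + L/2} \<times> {x2 - L/2 .. x2 + L/2} \<times> {a * exp (- r) .. a * exp r}"
    and bd: "AE z in rho. cmod (A z) \<le> 1 / (2 * r * L\<^sup>2)"
    and "(\<integral>\<^sup>+z. ennreal (cmod (A z)) \<partial>rho) \<le> 1"
    by (rule atom_bound[OF A]) (rule that)
  obtain m where m: "(\<integral>\<^sup>+y. ennreal \<bar>ln (1 + \<bar>y\<bar>) - m\<bar> * indicator {x1 - L/2..x1 + L/2} y \<partial>lborel) \<le> ennreal (4 * L)"
    using log_oscillation[OF p(2)] .
  let ?\<phi> = "\<lambda>y. ennreal \<bar>ln (1 + \<bar>y\<bar>) - m\<bar> * indicator {x1 - L/2..x1 + L/2} y"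
  let ?F = "\<lambda>z::pt. ?\<phi> (fst z) * (indicator {x2 - L/2..x2 + L/2} (fst (snd z)) * indicator {ln a - r..ln a + r} (ln (snd (snd z)))) :: ennreal"
  have F: "(\<integral>\<^sup>+z. ?F z \<partial>rho) \<le> ennreal (2 * r * L\<^sup>2 * 4)"
  proof -
    have "(\<integral>\<^sup>+z. ?F z \<partial>rho) = (\<integral>\<^sup>+v. \<integral>\<^sup>+y1. \<integral>\<^sup>+y2. ?\<phi> y1 * (indicator {x2 - L/2..x2 + L/2} y2 * indicator {ln a - r..ln a + r} v) \<partial>lborel \<partial>lborel \<partial>lborel)"
      by (subst nn_integral_rho) auto
    also have "\<dots> = (\<integral>\<^sup>+y. ?\<phi> y \<partial>lborel) * (ennreal L * ennreal (2 * r))"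
      using p by (simp add: nn_integral_cmult nn_integral_multc)
    also have "\<dots> \<le> ennreal (4 * L) * (ennreal L * ennreal (2 * r))"
      using m by (intro mult_right_mono) auto
    also have "\<dots> = ennreal (4 * L * (L * (2 * r)))"
      using p by (simp only: ennreal_mult'' mult_nonneg_nonneg less_imp_le zero_le_numeral)
    also have "4 * L * (L * (2 * r)) = 2 * r * L\<^sup>2 * 4" by (simp add: power2_eq_square)
    finally show ?thesis .
  qed
  let ?m = "min m N"
  have i: "integrable rho (\<lambda>z. A z * complex_of_real (log_bmo N z) - A z * complex_of_real ?m)"
    using integrable_mult_log_bmo[OF Ai(1) N] Ai(1) by (intro Bochner_Integration.integrable_diff) auto
  have "(\<integral>z. A z * complex_of_real (log_bmo N z) \<partial>rho) = (\<integral>z. A z * complex_of_real (log_bmo N z) - A z * complex_of_real ?m \<partial>rho)"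
    using integrable_mult_log_bmo[OF Ai(1) N] Ai by (subst Bochner_Integration.integral_diff) auto
  then have "ennreal (cmod (\<integral>z. A z * complex_of_real (log_bmo N z) \<partial>rho))
      \<le> (\<integral>\<^sup>+z. ennreal (norm (A z * complex_of_real (log_bmo N z) - A z * complex_of_real ?m)) \<partial>rho)"
    using integral_norm_bound_ennreal[OF i] by simp
  also have "\<dots> \<le> (\<integral>\<^sup>+z. ennreal (1 / (2 * r * L\<^sup>2)) * ?F z \<partial>rho)"
  proof (rule nn_integral_mono_AE)
    show "AE z in rho. ennreal (norm (A z * complex_of_real (log_bmo N z) - A z * complex_of_real ?m)) \<le> ennreal (1 / (2 * r * L\<^sup>2)) * ?F z"
      using supp bd AE_space
    proof eventually_elim
      case (elim z)
      show ?case
      proof (cases "A z = 0")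
        case False
        obtain z1 z2 b where z: "z = (z1, z2, b)" by (metis surj_pair)
        have b: "0 < b" using elim by (simp add: z space_rho G_def)
        have m3: "z1 \<in> {x1 - L/2 .. x1 + L/2}" "z2 \<in> {x2 - L/2 .. x2 + L/2}" "a * exp (- r) \<le> b" "b \<le> a * exp r"
          using elim False by (auto simp: z)
        have "ln (a * exp (- r)) \<le> ln b" "ln b \<le> ln (a * exp r)" using m3 b p by (auto simp: ln_le_cancel_iff)
        then have m4: "ln b \<in> {ln a - r..ln a + r}" using p by (auto simp: ln_mult)
        have "norm (A z * complex_of_real (log_bmo N z) - A z * complex_of_real ?m) = cmod (A z) * \<bar>log_bmo N z - ?m\<bar>"
          by (simp flip: right_diff_distrib of_real_diff add: norm_mult)
        also have "\<dots> \<le> 1 / (2 * r * L\<^sup>2) * \<bar>ln (1 + \<bar>z1\<bar>) - m\<bar>"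
          using elim p by (intro mult_mono) (auto simp: log_bmo_def z min_def)
        finally have "ennreal (norm (A z * complex_of_real (log_bmo N z) - A z * complex_of_real ?m))
            \<le> ennreal (1 / (2 * r * L\<^sup>2)) * ennreal \<bar>ln (1 + \<bar>z1\<bar>) - m\<bar>"
          by (subst ennreal_mult''[symmetric]) (auto intro: ennreal_leI)
        then show ?thesis using m3 m4 by (simp add: z)
      qed simp
    qed
  qed
  also have "\<dots> = ennreal (1 / (2 * r * L\<^sup>2)) * (\<integral>\<^sup>+z. ?F z \<partial>rho)"
    by (rule nn_integral_cmult) measurable
  also have "\<dots> \<le> ennreal (1 / (2 * r * L\<^sup>2)) * ennreal (2 * r * L\<^sup>2 * 4)"
    using F by (intro mult_left_mono) auto
  also have "\<dots> = ennreal (1 / (2 * r * L\<^sup>2) * (2 * r * L\<^sup>2 * 4))"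
    using p by (intro ennreal_mult''[symmetric]) auto
  also have "1 / (2 * r * L\<^sup>2) * (2 * r * L\<^sup>2 * 4) = 4" using p by simp
  finally show ?thesis by (simp add: ennreal_le_iff flip: ennreal_numeral)
qed

text \<open>Boundedness of \<open>log_bmo N\<close> makes the pairing continuous in L1. This is
  applied both to atomic decompositions and to the series that lies outside
  \<open>H1\<close>.\<close>

lemma L1_limit_log_bmo:
  assumes f: "integrable rho f" and g: "\<And>j. integrable rho (g j)" and N: "0 \<le> N"
    and lim: "(\<lambda>n. \<integral>z. cmod (f z - (\<Sum>j<n. g j z)) \<partial>rho) \<longlonglongrightarrow> 0"
  shows "(\<lambda>n. \<Sum>j<n. \<integral>z. g j z * complex_of_real (log_bmo N z) \<partial>rho)
    \<longlonglongrightarrow> (\<integral>z. f z * complex_of_real (log_bmo N z) \<partial>rho)"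
proof -
  let ?I = "\<lambda>h. \<integral>z. h z * complex_of_real (log_bmo N z) \<partial>rho"
  have bd: "cmod (?I f - (\<Sum>j<n. ?I (g j))) \<le> N * (\<integral>z. cmod (f z - (\<Sum>j<n. g j z)) \<partial>rho)" for n
  proof -
    let ?d = "\<lambda>z. f z - (\<Sum>j<n. g j z)"
    have d: "integrable rho ?d" using f g by simp
    have "?I f - (\<Sum>j<n. ?I (g j)) = ?I ?d"
      using integrable_mult_log_bmo[OF f N] integrable_mult_log_bmo[OF g N]
      by (simp add: left_diff_distrib sum_distrib_right Bochner_Integration.integral_diff)
    then have "cmod (?I f - (\<Sum>j<n. ?I (g j))) \<le> (\<integral>z. cmod (?d z * complex_of_real (log_bmo N z)) \<partial>rho)"
      using integral_norm_bound[of rho "\<lambda>z. ?d z * complex_of_real (log_bmo N z)"] by simp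
    also have "\<dots> \<le> (\<integral>z. N * cmod (?d z) \<partial>rho)"
    proof (rule integral_mono)
      show "integrable rho (\<lambda>z. cmod (?d z * complex_of_real (log_bmo N z)))"
        using integrable_mult_log_bmo[OF d N] by (rule integrable_norm)
      show "integrable rho (\<lambda>z. N * cmod (?d z))" using d by simp
      show "cmod (?d z * complex_of_real (log_bmo N z)) \<le> N * cmod (?d z)" for z
        using log_bmo_bounds[of N z] N by (auto simp: norm_mult mult.commute[of N] intro!: mult_left_mono)
    qed
    finally show ?thesis by simp
  qed
  have "(\<lambda>n. ?I f - (\<Sum>j<n. ?I (g j))) \<longlonglongrightarrow> 0"
  proof (rule Lim_null_comparison)
    show "\<forall>\<^sub>F n in sequentially. norm (?I f - (\<Sum>j<n. ?I (g j))) \<le> N * (\<integral>z. cmod (f z - (\<Sum>j<n. g j z)) \<partial>rho)"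
      using bd by simp
    show "(\<lambda>n. N * (\<integral>z. cmod (f z - (\<Sum>j<n. g j z)) \<partial>rho)) \<longlonglongrightarrow> 0"
      using tendsto_mult_left[OF lim, of N] by simp
  qed
  from tendsto_diff[OF tendsto_const[of "?I f"] this] show ?thesis by simp
qed

text \<open>The duality bound: it forces a lower bound on every admissible coefficient sum, with a
  constant that does not involve \<open>N\<close>.\<close>

lemma decomposition_log_bmo:
  assumes f: "integrable rho f" and d: "atomic_decomposition f l A" and N: "0 \<le> N"
  shows "cmod (\<integral>z. f z * complex_of_real (log_bmo N z) \<partial>rho) \<le> 4 * (\<Sum>j. cmod (l j))"
proof -
  have A: "atom (A j)" "integrable rho (A j)" for j using d by (auto simp: atomic_decomposition_def atom_def)
  have s: "summable (\<lambda>j. cmod (l j))" using d by (simp add: atomic_decomposition_def)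
  have "(\<lambda>n. \<Sum>j<n. \<integral>z. l j * A j z * complex_of_real (log_bmo N z) \<partial>rho)
    \<longlonglongrightarrow> (\<integral>z. f z * complex_of_real (log_bmo N z) \<partial>rho)"
    using d A by (intro L1_limit_log_bmo[OF f _ N]) (auto simp: atomic_decomposition_def)
  then have "(\<lambda>n. cmod (\<Sum>j<n. \<integral>z. l j * A j z * complex_of_real (log_bmo N z) \<partial>rho))
    \<longlonglongrightarrow> cmod (\<integral>z. f z * complex_of_real (log_bmo N z) \<partial>rho)"
    by (rule tendsto_norm)
  moreover have "cmod (\<Sum>j<n. \<integral>z. l j * A j z * complex_of_real (log_bmo N z) \<partial>rho) \<le> 4 * (\<Sum>j. cmod (l j))" for n
  proof -
    have "cmod (\<Sum>j<n. \<integral>z. l j * A j z * complex_of_real (log_bmo N z) \<partial>rho)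
        \<le> (\<Sum>j<n. cmod (l j) * cmod (\<integral>z. A j z * complex_of_real (log_bmo N z) \<partial>rho))"
      by (rule order_trans[OF norm_sum]) (simp add: mult.assoc norm_mult)
    also have "\<dots> \<le> (\<Sum>j<n. cmod (l j) * 4)"
      by (intro sum_mono mult_left_mono atom_log_bmo A N) auto
    also have "\<dots> = 4 * (\<Sum>j<n. cmod (l j))" by (simp add: sum_distrib_left mult.commute)
    also have "\<dots> \<le> 4 * (\<Sum>j. cmod (l j))" by (intro mult_left_mono sum_le_suminf s) auto
    finally show ?thesis .
  qed
  ultimately show ?thesis by (intro LIMSEQ_le_const2) auto
qed

section \<open>The converse inequality\<close>

text \<open>The extremal radius for the small-box estimates; their threshold
  \<open>18 * exp 9 * r\<close> then equals \<open>9/8\<close>.\<close>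

definition small_radius :: real where "small_radius = 1 / (16 * exp 9)"

definition small_box :: "pt set" where "small_box = box_at_one (exp 8 * small_radius) small_radius"

definition bump :: "real \<Rightarrow> pt \<Rightarrow> real" where
  "bump X z = indicator small_box ((- X, 0, 1) \<cdot> z)"

definition test_fun :: "real \<Rightarrow> pt \<Rightarrow> complex" where
  "test_fun X z = complex_of_real (bump 0 z) - complex_of_real (bump X z)"

definition small_mass :: real where "small_mass = 2 * small_radius * (exp 8 * small_radius)\<^sup>2"

lemma small_radius: "0 < small_radius" "16 * exp 9 * small_radius = 1" "small_radius \<le> 1 / 16" "exp 8 * small_radius \<le> 1 / 16"
proof -
  show "0 < small_radius" "16 * exp 9 * small_radius = 1" by (simp_all add: small_radius_def)
  have "1 \<le> exp (9::real)" "exp 8 \<le> exp (9::real)" by simp_all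
  then show "small_radius \<le> 1 / 16" "exp 8 * small_radius \<le> 1 / 16" by (simp_all add: small_radius_def field_simps)
qed

lemma small_mass_pos: "0 < small_mass"
  using small_radius by (simp add: small_mass_def)

text \<open>The unsimplified \<open>0 - _\<close> and \<open>1 * _\<close> match the form of
  \<open>emeasure_box_rho\<close>.\<close>

lemma small_box_eq: "small_box = {0 - exp 8 * small_radius / 2 .. 0 + exp 8 * small_radius / 2} \<times> {0 - exp 8 * small_radius / 2 .. 0 + exp 8 * small_radius / 2} \<times> {1 * exp (- small_radius) .. 1 * exp small_radius}"
proof -
  have ln_iff: "0 < b \<and> \<bar>ln b\<bar> \<le> small_radius \<longleftrightarrow> exp (- small_radius) \<le> b \<and> b \<le> exp small_radius" for b
  proof
    assume "exp (- small_radius) \<le> b \<and> b \<le> exp small_radius"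
    moreover from this have "0 < b" using less_le_trans[OF exp_gt_zero] by blast
    ultimately show "0 < b \<and> \<bar>ln b\<bar> \<le> small_radius"
      by (metis abs_leI exp_le_cancel_iff exp_ln minus_le_iff)
  next
    assume "0 < b \<and> \<bar>ln b\<bar> \<le> small_radius"
    then show "exp (- small_radius) \<le> b \<and> b \<le> exp small_radius"
      by (metis abs_le_D1 abs_le_D2 exp_le_cancel_iff exp_ln minus_le_iff)
  qed
  have abs: "\<bar>y\<bar> \<le> c \<longleftrightarrow> y \<in> {0 - c .. 0 + c}" for y c :: real
    by (auto simp: abs_le_iff)
  show ?thesis
  proof (rule set_eqI)
    fix z :: pt
    obtain z1 z2 b where z: "z = (z1, z2, b)" by (metis surj_pair)
    have "z \<in> small_box \<longleftrightarrow> \<bar>z1\<bar> \<le> exp 8 * small_radius / 2 \<and> \<bar>z2\<bar> \<le> exp 8 * small_radius / 2 \<and> (0 < b \<and> \<bar>ln b\<bar> \<le> small_radius)"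
      unfolding small_box_def box_at_one_def G_def z by (simp only: mem_Collect_eq prod.case fst_conv snd_conv) blast
    then show "z \<in> small_box \<longleftrightarrow> z \<in> {0 - exp 8 * small_radius / 2 .. 0 + exp 8 * small_radius / 2} \<times> {0 - exp 8 * small_radius / 2 .. 0 + exp 8 * small_radius / 2} \<times> {1 * exp (- small_radius) .. 1 * exp small_radius}"
      unfolding z ln_iff unfolding abs mem_Times_iff fst_conv snd_conv mult_1_left atLeastAtMost_iff[of b] .
  qed
qed

lemma small_box_borel [measurable]: "small_box \<in> sets borel"
  unfolding small_box_eq by (intro borel_closed closed_Times) auto

lemma small_box_G: "small_box \<subseteq> G" by (auto simp: small_box_def box_at_one_def)

lemma small_box_sets: "small_box \<in> sets rho"
  using small_box_borel small_box_G by (simp add: sets_rho_iff)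

lemma emeasure_small_box: "emeasure rho small_box = ennreal small_mass"
  unfolding small_box_eq small_mass_def using small_radius by (intro emeasure_box_rho) auto

lemma shift_G: "(X, 0, 1) \<in> G" by (simp add: G_def)

lemma shift_cancel: "(- X, 0, 1) \<cdot> ((X, 0, 1) \<cdot> z) = z"
  by (cases z) simp

lemma bump_0: "bump 0 z = indicator small_box z"
  by (cases z) (simp add: bump_def)

lemma bump_shift: "bump X ((X, 0, 1) \<cdot> z) = bump 0 z"
  by (simp only: bump_def shift_cancel) (cases z, simp)

lemma bump_measurable [measurable]: "bump X \<in> borel_measurable borel"
  unfolding bump_def[abs_def]
  by (rule measurable_compose[OF gmult_left_measurable borel_measurable_indicator]) (rule small_box_borel)

lemma bump_bounds: "0 \<le> bump X z" "bump X z \<le> 1"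
  by (auto simp: bump_def indicator_def)

lemma bump_nonzero:
  assumes "bump X z \<noteq> 0"
  shows "\<bar>fst z - X\<bar> \<le> 1 / 32" "\<bar>fst (snd z)\<bar> \<le> 1 / 32" "\<bar>ln (snd (snd z))\<bar> \<le> small_radius" "z \<in> G"
proof -
  have "(- X, 0, 1) \<cdot> z \<in> small_box" using assms by (auto simp: bump_def indicator_def split: if_splits)
  then show "\<bar>fst z - X\<bar> \<le> 1 / 32" "\<bar>fst (snd z)\<bar> \<le> 1 / 32" "\<bar>ln (snd (snd z))\<bar> \<le> small_radius" "z \<in> G"
    using small_radius(4) by (cases z; auto simp: small_box_def box_at_one_def G_def algebra_simps)+
qed

lemma nn_integral_bump: "(\<integral>\<^sup>+z. ennreal (bump X z) \<partial>rho) = ennreal small_mass"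
proof -
  have "(\<integral>\<^sup>+z. ennreal (bump X z) \<partial>rho) = (\<integral>\<^sup>+z. ennreal (bump 0 z) \<partial>rho)"
    using nn_integral_left_translate[OF shift_G, of "\<lambda>z. ennreal (bump X z)" X]
    by (simp add: bump_shift height_def)
  also have "\<dots> = (\<integral>\<^sup>+z. indicator small_box z \<partial>rho)"
    by (intro nn_integral_cong) (auto simp: bump_0 indicator_def)
  finally show ?thesis using small_box_sets by (simp add: emeasure_small_box)
qed

lemma integrable_bump: "integrable rho (bump X)"
  by (rule integrableI_bounded) (auto simp: nn_integral_bump bump_bounds)

lemma integral_bump: "(\<integral>z. bump X z \<partial>rho) = small_mass"
  using nn_integral_bump[of X] small_mass_pos by (subst integral_eq_nn_integral) (auto simp: bump_bounds)

lemma integrable_test_fun: "integrable rho (test_fun X)"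
  unfolding test_fun_def[abs_def]
  using integrable_bump by (intro Bochner_Integration.integrable_diff integrable_of_real)

lemma integral_test_fun: "(\<integral>z. test_fun X z \<partial>rho) = 0"
  unfolding test_fun_def
  using integrable_bump by (subst Bochner_Integration.integral_diff) (auto simp: integral_bump intro!: integrable_of_real)

lemma test_fun_le: "cmod (test_fun X z) \<le> 1"
proof -
  have "cmod (test_fun X z) = \<bar>bump 0 z - bump X z\<bar>"
    unfolding test_fun_def by (simp flip: of_real_diff)
  then show ?thesis using bump_bounds[of 0 z] bump_bounds[of X z] by linarith
qed

lemma test_fun_le_sum: "cmod (test_fun X z) \<le> bump 0 z + bump X z"
proof -
  have "cmod (test_fun X z) = \<bar>bump 0 z - bump X z\<bar>"
    unfolding test_fun_def by (simp flip: of_real_diff)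
  then show ?thesis using bump_bounds[of 0 z] bump_bounds[of X z] by linarith
qed

lemma test_fun_norm: "(\<integral>\<^sup>+z. ennreal (cmod (test_fun X z)) \<partial>rho) \<le> ennreal (2 * small_mass)"
proof -
  have "(\<integral>\<^sup>+z. ennreal (cmod (test_fun X z)) \<partial>rho) \<le> (\<integral>\<^sup>+z. ennreal (bump 0 z) + ennreal (bump X z) \<partial>rho)"
    by (intro nn_integral_mono) (auto simp: bump_bounds test_fun_le_sum simp flip: ennreal_plus intro!: ennreal_leI)
  also have "\<dots> = ennreal small_mass + ennreal small_mass"
    by (subst nn_integral_add) (auto simp: nn_integral_bump)
  finally show ?thesis using small_mass_pos by (simp flip: ennreal_plus)
qed

lemma test_fun_supp:
  assumes X: "1 \<le> X" and "test_fun X z \<noteq> 0"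
  shows "\<bar>fst z\<bar> \<le> 2 * X" "\<bar>fst (snd z)\<bar> \<le> 2 * X" "\<bar>ln (snd (snd z))\<bar> \<le> 1" "z \<in> G"
proof -
  have "bump 0 z \<noteq> 0 \<or> bump X z \<noteq> 0" using assms(2) by (auto simp: test_fun_def)
  then show "\<bar>fst z\<bar> \<le> 2 * X" "\<bar>fst (snd z)\<bar> \<le> 2 * X" "\<bar>ln (snd (snd z))\<bar> \<le> 1" "z \<in> G"
    using bump_nonzero[of 0 z] bump_nonzero[of X z] X small_radius(3) by linarith+
qed

lemma test_fun_box_at_one:
  assumes "1 \<le> X"
  shows "AE z in rho. test_fun X z \<noteq> 0 \<longrightarrow> z \<in> box_at_one (4 * X) 1"
  using test_fun_supp[OF assms] by (auto simp: box_at_one_def intro!: AE_I2)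

text \<open>A multiple of a single atom: with \<open>r = ln L / 4\<close> the side is
  \<open>L = exp (4 * r)\<close>, inside the admissible range from \<open>exp (2 * r)\<close> to
  \<open>exp (8 * r)\<close>, and \<open>X >= exp 4\<close> ensures \<open>r >= 1\<close>. The
  coefficient is huge, but only membership is needed.\<close>

lemma test_fun_H1:
  assumes X: "exp 4 \<le> X"
  shows "test_fun X \<in> H1"
proof -
  define L where "L = 4 * X"
  define r where "r = ln L / 4"
  have X1: "1 \<le> X" using X exp_ge_add_one_self[of 4] by simp
  have L: "exp 4 \<le> L" "0 < L" using X X1 by (auto simp: L_def)
  have "4 \<le> ln L" using L by (metis exp_le_cancel_iff exp_ln)
  then have r: "1 \<le> r" by (simp add: r_def)
  have e4: "exp (4 * r) = L" using L by (simp add: r_def)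
  have e2: "exp (2 * r) \<le> L" "L < exp (8 * r)" unfolding e4[symmetric] using r by auto
  define R where "R = {0 - L/2 .. 0 + L/2} \<times> {0 - L/2 .. 0 + L/2} \<times> {1 * exp (- r) .. 1 * exp r}"
  have CZ: "CZ_set R"
    unfolding CZ_set_def R_def
    by (intro exI[of _ 0] exI[of _ 0] exI[of _ 1] exI[of _ L] exI[of _ r]) (use L r e2 in \<open>auto simp: G_def\<close>)
  define \<mu> where "\<mu> = 2 * r * L\<^sup>2"
  have \<mu>: "0 < \<mu>" using r L by (simp add: \<mu>_def)
  have eR: "emeasure rho R = ennreal \<mu>"
    unfolding R_def \<mu>_def using r L by (intro emeasure_box_rho) auto
  define A where "A z = complex_of_real (1 / \<mu>) * test_fun X z" for z
  have [measurable]: "test_fun X \<in> borel_measurable rho" using integrable_test_fun[of X] by simp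
  have "atom A"
    unfolding atom_def
  proof (intro conjI exI[of _ R])
    show "integrable rho A" unfolding A_def using integrable_test_fun by simp
    show "(\<integral>z. A z \<partial>rho) = 0" unfolding A_def by (simp add: integral_test_fun)
    show "CZ_set R" by (rule CZ)
    show "AE z in rho. z \<notin> R \<longrightarrow> A z = 0"
    proof (rule AE_I2, rule impI, rule ccontr)
      fix z assume "z \<notin> R" "A z \<noteq> 0"
      then have "test_fun X z \<noteq> 0" by (auto simp: A_def)
      note s = test_fun_supp[OF X1 this]
      obtain z1 z2 b where z: "z = (z1, z2, b)" by (metis surj_pair)
      have b: "0 < b" "\<bar>ln b\<bar> \<le> r" using s r by (auto simp: z G_def)
      then have "exp (- r) \<le> b" "b \<le> exp r"
        by (metis abs_le_D2 exp_le_cancel_iff exp_ln minus_le_iff, metis abs_le_D1 exp_le_cancel_iff exp_ln)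
      then have "z \<in> R" using s by (auto simp: R_def z L_def abs_le_iff)
      with \<open>z \<notin> R\<close> show False by simp
    qed
    have "ennreal (cmod (A z)) \<le> inverse (emeasure rho R)" for z
    proof -
      have "cmod (A z) \<le> 1 / \<mu>"
        unfolding A_def norm_mult using \<mu> test_fun_le[of X z] by (simp add: norm_divide divide_right_mono)
      then show ?thesis unfolding eR using \<mu> by (simp add: inverse_ennreal inverse_eq_divide ennreal_leI)
    qed
    then show "esssup rho (\<lambda>x. ennreal (cmod (A x))) \<le> inverse (emeasure rho R)"
      unfolding A_def by (intro esssup_I) auto
  qed
  have "atomic_decomposition (test_fun X) (\<lambda>j. if j = 0 then complex_of_real \<mu> else 0) (\<lambda>j. A)"
    unfolding atomic_decomposition_def
  proof (intro conjI allI)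
    show "atom A" by fact
    show "summable (\<lambda>j. cmod (if j = 0 then complex_of_real \<mu> else 0))"
      by (rule summable_finite[of "{0}"]) auto
    have "(\<integral>z. cmod (test_fun X z - (\<Sum>j<Suc n. (if j = 0 then complex_of_real \<mu> else 0) * A z)) \<partial>rho) = 0" for n
    proof -
      have "(\<Sum>j<Suc n. (if j = 0 then complex_of_real \<mu> else 0) * A z) = test_fun X z" for z
        using \<mu> by (subst sum.remove[of _ 0]) (auto simp: A_def)
      then show ?thesis by simp
    qed
    then show "(\<lambda>n. \<integral>z. cmod (test_fun X z - (\<Sum>j<n. (if j = 0 then complex_of_real \<mu> else 0) * A z)) \<partial>rho) \<longlonglongrightarrow> 0"
      by - (rule LIMSEQ_imp_Suc, simp only: tendsto_const)
  qed
  then show ?thesis using integrable_test_fun by (auto simp: H1_def)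
qed

lemma integrable_bump_log_bmo:
  assumes "0 \<le> N"
  shows "integrable rho (\<lambda>z. bump X z * log_bmo N z)"
proof (rule Bochner_Integration.integrable_bound)
  show "integrable rho (\<lambda>z. N * bump X z)" using integrable_bump by simp
  show "AE z in rho. norm (bump X z * log_bmo N z) \<le> norm (N * bump X z)"
    using assms log_bmo_bounds[of N] bump_bounds[of X]
    by (auto simp: abs_mult mult.commute[of N] intro!: AE_I2 mult_left_mono)
qed measurable

text \<open>On the far bump \<open>1 + |x1| >= X\<close>, on the near one the logarithm is at most
  one. The result is recorded as a real number with a sign, not as a modulus, so that later the
  contributions of different separations cannot cancel.\<close>

lemma test_fun_log_bmo:
  assumes X: "1 \<le> X" and N: "0 \<le> N"
  obtains y where "(\<integral>z. test_fun X z * complex_of_real (log_bmo N z) \<partial>rho) = - complex_of_real y"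
    "small_mass * (min (ln X) N - 1) \<le> y"
proof
  let ?y = "(\<integral>z. bump X z * log_bmo N z \<partial>rho) - (\<integral>z. bump 0 z * log_bmo N z \<partial>rho)"
  have "(\<integral>z. test_fun X z * complex_of_real (log_bmo N z) \<partial>rho)
      = (\<integral>z. complex_of_real (bump 0 z * log_bmo N z - bump X z * log_bmo N z) \<partial>rho)"
    by (simp add: test_fun_def left_diff_distrib)
  also have "\<dots> = complex_of_real (\<integral>z. bump 0 z * log_bmo N z - bump X z * log_bmo N z \<partial>rho)"
    by (rule integral_complex_of_real)
  also have "(\<integral>z. bump 0 z * log_bmo N z - bump X z * log_bmo N z \<partial>rho) = - ?y"
    using integrable_bump_log_bmo[OF N] by (subst Bochner_Integration.integral_diff) auto
  finally show "(\<integral>z. test_fun X z * complex_of_real (log_bmo N z) \<partial>rho) = - complex_of_real ?y" by simp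
  have 1: "small_mass * min (ln X) N \<le> (\<integral>z. bump X z * log_bmo N z \<partial>rho)"
  proof -
    have "small_mass * min (ln X) N = (\<integral>z. min (ln X) N * bump X z \<partial>rho)" by (simp add: integral_bump)
    also have "\<dots> \<le> (\<integral>z. bump X z * log_bmo N z \<partial>rho)"
    proof (rule integral_mono)
      show "integrable rho (\<lambda>z. min (ln X) N * bump X z)" using integrable_bump by simp
      show "integrable rho (\<lambda>z. bump X z * log_bmo N z)" by (rule integrable_bump_log_bmo[OF N])
      fix z assume "z \<in> space rho"
      show "min (ln X) N * bump X z \<le> bump X z * log_bmo N z"
      proof (cases "bump X z = 0")
        case False
        have "X \<le> 1 + \<bar>fst z\<bar>" using bump_nonzero(1)[OF False] by linarith
        then have "ln X \<le> ln (1 + \<bar>fst z\<bar>)" using X by (subst ln_le_cancel_iff) auto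
        then have "min (ln X) N \<le> log_bmo N z" by (auto simp: log_bmo_def min_def)
        from mult_left_mono[OF this bump_bounds(1)] show ?thesis by (simp add: mult.commute)
      qed simp
    qed
    finally show ?thesis .
  qed
  have 2: "(\<integral>z. bump 0 z * log_bmo N z \<partial>rho) \<le> small_mass"
  proof -
    have "(\<integral>z. bump 0 z * log_bmo N z \<partial>rho) \<le> (\<integral>z. bump 0 z \<partial>rho)"
    proof (rule integral_mono)
      show "integrable rho (bump 0)" by (rule integrable_bump)
      show "integrable rho (\<lambda>z. bump 0 z * log_bmo N z)" by (rule integrable_bump_log_bmo[OF N])
      fix z assume "z \<in> space rho"
      show "bump 0 z * log_bmo N z \<le> bump 0 z"
      proof (cases "bump 0 z = 0")
        case False
        have "ln (1 + \<bar>fst z\<bar>) \<le> \<bar>fst z\<bar>" by (rule ln_add_one_self_le_self) simp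
        then have "log_bmo N z \<le> 1" using bump_nonzero(1)[OF False] by (simp add: log_bmo_def min_def)
        from mult_left_mono[OF this bump_bounds(1)] show ?thesis by simp
      qed simp
    qed
    then show ?thesis by (simp add: integral_bump)
  qed
  from 1 2 show "small_mass * (min (ln X) N - 1) \<le> ?y" by (simp add: right_diff_distrib)
qed

lemma test_fun_H1_norm:
  assumes X: "exp 4 \<le> X"
  shows "small_mass * (ln X - 1) / 4 \<le> H1_norm (test_fun X)"
proof -
  have X1: "1 \<le> X" using X exp_ge_add_one_self[of 4] by simp
  then have N: "0 \<le> ln X" by simp
  obtain y where y: "(\<integral>z. test_fun X z * complex_of_real (log_bmo (ln X) z) \<partial>rho) = - complex_of_real y"
    "small_mass * (min (ln X) (ln X) - 1) \<le> y"
    using test_fun_log_bmo[OF X1 N] .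
  show ?thesis
    unfolding H1_norm_def
  proof (rule cInf_greatest)
    show "{\<Sum>j. cmod (l j) |l A. atomic_decomposition (test_fun X) l A} \<noteq> {}"
      using test_fun_H1[OF X] by (auto simp: H1_def)
    fix s assume "s \<in> {\<Sum>j. cmod (l j) |l A. atomic_decomposition (test_fun X) l A}"
    then obtain l A where s: "s = (\<Sum>j. cmod (l j))" and d: "atomic_decomposition (test_fun X) l A" by blast
    have "\<bar>y\<bar> \<le> 4 * s"
      using decomposition_log_bmo[OF integrable_test_fun d N] by (simp add: y s)
    then show "small_mass * (ln X - 1) / 4 \<le> s" using y(2) by simp
  qed
qed

section \<open>The maximal function of a difference of two bumps\<close>

lemma heat_maximal_diff:
  assumes f: "integrable rho f" and g: "integrable rho g" and x: "x \<in> G"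
  shows "heat_maximal (\<lambda>z. f z - g z) x \<le> heat_maximal f x + heat_maximal g x"
proof -
  have m: "f \<in> borel_measurable rho" "g \<in> borel_measurable rho" "(\<lambda>z. f z - g z) \<in> borel_measurable rho"
    using f g by auto
  have "ennreal (cmod (heat_avg (\<lambda>z. f z - g z) x t)) \<le> heat_maximal f x + heat_maximal g x" if t: "0 < t" for t
  proof -
    have "heat_avg (\<lambda>z. f z - g z) x t = heat_avg f x t - heat_avg g x t"
      unfolding heat_avg_def using integrable_kernel_at[OF f x t] integrable_kernel_at[OF g x t]
      by (simp add: left_diff_distrib Bochner_Integration.integral_diff)
    then have "ennreal (cmod (heat_avg (\<lambda>z. f z - g z) x t)) \<le> ennreal (cmod (heat_avg f x t)) + ennreal (cmod (heat_avg g x t))"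
      by (simp flip: ennreal_plus add: ennreal_leI norm_triangle_ineq4)
    also have "\<dots> \<le> heat_maximal f x + heat_maximal g x"
      using t m x by (intro add_mono) (auto simp: heat_maximal_eq intro!: SUP_upper)
    finally show ?thesis .
  qed
  then show ?thesis by (subst heat_maximal_eq[OF x m(3)]) (auto intro!: SUP_least)
qed

text \<open>The maximal function of a bump decays like \<open>h\<^sup>-\<^sup>2 / (E E')\<close> with \<open>h\<close> the distance to the identity, which is not
  integrable. On \<open>h \<le> D\<close> one bounds \<open>h\<^sup>-\<^sup>2\<close> by \<open>sqrt D h\<^sup>-\<^sup>5\<^sup>/\<^sup>2\<close> instead; the true order \<open>ln D\<close> is not needed.\<close>

lemma heat_maximal_bump_core:
  obtains C :: real where "0 < C"
    "\<And>L T D. 1 \<le> D \<Longrightarrow> \<forall>x\<in>core L T. hyp_dist x gone \<le> D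
      \<Longrightarrow> (\<integral>\<^sup>+x. heat_maximal (\<lambda>z. complex_of_real (bump 0 z)) x * indicator (core L T) x \<partial>rho) \<le> ennreal (C * sqrt D)"
proof -
  \<comment> \<open>\<open>K1\<close> is the volume of the core at the threshold \<open>9/8\<close>.
    Below, \<open>27648 = 16 * 1728\<close> is the size bound, \<open>8\<close> dominates
    \<open>2 powr (5/2)\<close> from replacing \<open>h\<close> by \<open>(h + 1) / 2\<close>, and
    \<open>8 * pi / 3\<close> is the integral with \<open>\<alpha> = 3/2\<close>.\<close>
  define K1 where "K1 = 128 * pi * (9/8)\<^sup>2 * (9/8 :: real)"
  define K where "K = small_mass * (27648 * 8)"
  define K2 where "K2 = K * (8 * pi / 3)"
  have K: "0 < K1" "0 < K" "0 < K2" using small_mass_pos by (auto simp: K1_def K_def K2_def)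
  let ?g = "\<lambda>z. complex_of_real (bump 0 z)"
  have gi: "integrable rho ?g" using integrable_bump by (rule integrable_of_real)
  have gb: "AE z in rho. cmod (?g z) \<le> 1" using bump_bounds by (auto intro!: AE_I2)
  have gn: "(\<integral>\<^sup>+z. ennreal (cmod (?g z)) \<partial>rho) = ennreal small_mass" using nn_integral_bump[of 0] bump_bounds by simp
  have gs: "AE z in rho. ?g z \<noteq> 0 \<longrightarrow> z \<in> box_at_one (exp 8 * small_radius) small_radius"
    by (auto simp: bump_0 small_box_def indicator_def intro!: AE_I2)
  have main: "(\<integral>\<^sup>+x. heat_maximal ?g x * indicator (core L T) x \<partial>rho) \<le> ennreal ((K1 + K2) * sqrt D)"
    if D: "1 \<le> D" and cD: "\<forall>x\<in>core L T. hyp_dist x gone \<le> D" for L T D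
  proof -
    let ?w = "\<lambda>x. (hyp_dist x gone + 1) powr (- (3/2) - 1) / (dist x gone * dist x (mirror gone))"
    have pt: "heat_maximal ?g x * indicator (core L T) x \<le> indicator (core (9/8) (9/8)) x + ennreal (K * sqrt D) * ennreal (?w x)"
      if x: "x \<in> G" for x
    proof (cases "x \<in> core L T")
      case xc: True
      show ?thesis
      proof (cases "x \<in> core (9/8) (9/8)")
        case True
        have "heat_maximal ?g x \<le> ennreal 1" by (rule heat_maximal_le_bound[OF gi x gb])
        then show ?thesis using True xc by (simp add: add_increasing2)
      next
        case False
        define h where "h = hyp_dist x gone"
        have h: "9/8 \<le> h" using small_ball_core[OF x, of "9/8"] False unfolding h_def by fastforce
        have h': "18 * exp 9 * small_radius \<le> hyp_dist x gone" using h small_radius(2) unfolding h_def by linarith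
        have E: "0 \<le> dist x gone * dist x (mirror gone)" by simp
        have le: "16 * 1728 / (h\<^sup>2 * (dist x gone * dist x (mirror gone))) \<le> 27648 * 8 * (sqrt D * ?w x)"
        proof -
          have "1 / h\<^sup>2 = h powr (1/2) * h powr (- (5/2))"
            unfolding powr_add[symmetric] using h by (simp add: powr_minus_divide)
          also have "h powr (- (5/2)) \<le> ((h + 1) / 2) powr (- (5/2))"
            using h by (intro powr_mono2') auto
          also have "((h + 1) / 2) powr (- (5/2)) = 2 powr (5/2) * (h + 1) powr (- (5/2))"
            using h by (simp add: powr_divide powr_minus field_simps)
          also have "(2 :: real) powr (5/2) \<le> 2 powr 3" by (intro powr_mono) auto
          also have "h powr (1/2) \<le> D powr (1/2)" using h bspec[OF cD xc] unfolding h_def by (intro powr_mono2) auto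
          finally have "1 / h\<^sup>2 \<le> sqrt D * (8 * (h + 1) powr (- (5/2)))"
            using D h by (simp add: powr_half_sqrt mult_mono)
          then have "1 / h\<^sup>2 / (dist x gone * dist x (mirror gone)) \<le> sqrt D * (8 * (h + 1) powr (- (5/2))) / (dist x gone * dist x (mirror gone))"
            using E by (rule divide_right_mono)
          then show ?thesis by (simp add: h_def)
        qed
        have "heat_maximal ?g x \<le> (\<integral>\<^sup>+z. ennreal (cmod (?g z)) * ennreal (27648 * 8 * (sqrt D * ?w x)) \<partial>rho)"
        proof (rule heat_maximal_le_kernel[OF gi x])
          fix t :: real assume t: "0 < t"
          have "ennreal (kernel_at t x z) \<le> ennreal (27648 * 8 * (sqrt D * ?w x))" if "z \<in> box_at_one (exp 8 * small_radius) small_radius" for z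
            using kernel_at_le_small[OF t x that small_radius(1) _ h'] small_radius(2) le unfolding h_def by (intro ennreal_leI) linarith
          with gs show "AE z in rho. ?g z \<noteq> 0 \<longrightarrow> ennreal (kernel_at t x z) \<le> ennreal (27648 * 8 * (sqrt D * ?w x))"
            by (auto elim!: eventually_mono)
        qed
        also have "\<dots> = ennreal small_mass * ennreal (27648 * 8 * (sqrt D * ?w x))"
          using gi gn by (subst nn_integral_multc) auto
        also have "\<dots> = ennreal (small_mass * (27648 * 8 * (sqrt D * ?w x)))"
          using D E by (intro ennreal_mult''[symmetric] mult_nonneg_nonneg divide_nonneg_nonneg) auto
        also have "small_mass * (27648 * 8 * (sqrt D * ?w x)) = K * sqrt D * ?w x" unfolding K_def by (simp only: mult_ac)
        also have "ennreal (K * sqrt D * ?w x) = ennreal (K * sqrt D) * ennreal (?w x)"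
          using E by (intro ennreal_mult'' divide_nonneg_nonneg) auto
        finally show ?thesis using xc by (simp add: add_increasing)
      qed
    qed simp
    have w [measurable]: "(\<lambda>x. ennreal (?w x)) \<in> borel_measurable rho" by measurable
    have "(\<integral>\<^sup>+x. heat_maximal ?g x * indicator (core L T) x \<partial>rho)
        \<le> (\<integral>\<^sup>+x. indicator (core (9/8) (9/8)) x + ennreal (K * sqrt D) * ennreal (?w x) \<partial>rho)"
      by (intro nn_integral_mono pt) (simp add: space_rho)
    also have "\<dots> = (\<integral>\<^sup>+x. indicator (core (9/8) (9/8)) x \<partial>rho) + (\<integral>\<^sup>+x. ennreal (K * sqrt D) * ennreal (?w x) \<partial>rho)"
      using core_sets w by (intro nn_integral_add) auto
    also have "(\<integral>\<^sup>+x. indicator (core (9/8) (9/8)) x \<partial>rho) = ennreal K1"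
      using core_sets by (simp add: emeasure_core K1_def)
    also have "(\<integral>\<^sup>+x. ennreal (K * sqrt D) * ennreal (?w x) \<partial>rho) = ennreal (K * sqrt D) * ennreal (8 * pi / 3)"
      using nn_integral_hyp_dist_powr[of 1 "3/2"] w by (subst nn_integral_cmult) simp_all
    also have "\<dots> = ennreal (K2 * sqrt D)"
      by (subst ennreal_mult''[symmetric]) (simp_all add: K2_def mult_ac)
    also have "ennreal K1 + ennreal (K2 * sqrt D) = ennreal (K1 + K2 * sqrt D)"
      using K D by (simp add: ennreal_plus)
    also have "\<dots> \<le> ennreal ((K1 + K2) * sqrt D)"
      using K D mult_left_mono[of 1 "sqrt D" K1] by (intro ennreal_leI) (simp add: distrib_right)
    finally show ?thesis .
  qed
  show thesis
  proof (rule that)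
    show "0 < K1 + K2" using K by simp
  qed (rule main)
qed

text \<open>\<open>exp h\<close> is at most \<open>E'^2 / a\<close>, hence polynomial in
  \<open>X\<close>: the bound is \<open>4 * (4096 + 25) * X^3\<close>, and \<open>X >= 5\<close>
  absorbs the constant into \<open>X^7\<close>.\<close>

lemma core_hyp_dist_le:
  assumes X: "exp 4 \<le> X" and x: "x \<in> core (8 * X) (ln (4 * X))"
  shows "hyp_dist x gone \<le> 10 * ln X"
proof -
  have X5: "5 \<le> X" using X exp_ge_add_one_self[of 4] by simp
  have xG: "x \<in> G" and q: "horiz_norm_sq x \<le> 64 * (8 * X)\<^sup>2" and v: "\<bar>ln (height x)\<bar> \<le> ln (4 * X)" using x by (auto simp: core_def)
  have a: "0 < height x" using xG by (auto simp: G_def height_def)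
  have a1: "height x \<le> 4 * X" using v a X5 by (metis abs_le_D1 exp_le_cancel_iff exp_ln mult_pos_pos zero_less_numeral less_le_trans)
  have "ln (1 / height x) \<le> ln (4 * X)" using v a by (simp add: ln_div abs_le_iff)
  then have a2: "1 / height x \<le> 4 * X" using a X5 by (subst (asm) ln_le_cancel_iff) auto
  define E E' where "E = dist x gone" and "E' = dist x (mirror gone)"
  have EE': "E < E'" "0 \<le> E" unfolding E_def E'_def using dist_less_mirror[OF xG gone_in_G] by auto
  have "exp (hyp_dist x gone) = (E + E')\<^sup>2 / (4 * height x)"
    unfolding exp_hyp_dist[OF xG gone_in_G] by (simp add: E_def E'_def height_def gone_def)
  also have "\<dots> \<le> (2 * E')\<^sup>2 / (4 * height x)"
    using EE' a by (intro divide_right_mono power_mono) auto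
  also have "\<dots> = E'\<^sup>2 * (1 / height x)" by (simp add: power_mult_distrib)
  also have "E'\<^sup>2 = horiz_norm_sq x + (height x + 1)\<^sup>2"
    unfolding E'_def by (cases x) (simp add: dist_gone horiz_norm_sq_def height_def)
  also have "(horiz_norm_sq x + (height x + 1)\<^sup>2) * (1 / height x) \<le> (64 * (8 * X)\<^sup>2 + (4 * X + X)\<^sup>2) * (4 * X)"
    using q a a1 a2 X5 by (intro mult_mono add_mono power_mono) auto
  also have "\<dots> = 16484 * X ^ 3" by (simp add: power2_eq_square power3_eq_cube)
  also have "\<dots> \<le> X ^ 7 * X ^ 3"
  proof (intro mult_right_mono)
    have "(16484 :: real) \<le> 5 ^ 7" by simp
    also have "\<dots> \<le> X ^ 7" using X5 by (intro power_mono) auto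
    finally show "16484 \<le> X ^ 7" .
  qed (use X5 in auto)
  also have "\<dots> = X ^ 10" by (simp flip: power_add)
  also have "\<dots> = exp (10 * ln X)" using X5 by (simp add: exp_of_nat_mult[of 10, simplified])
  finally show ?thesis by simp
qed

text \<open>Inside the core the bumps are estimated separately, without cancellation, at cost
  \<open>sqrt (ln X)\<close>. Outside, \<open>heat_maximal_off_core\<close> with
  \<open>L = 4 * X\<close> and \<open>T = ln L\<close> gives a bounded contribution: the logarithmic
  term is of order \<open>T\<close>, and \<open>L^2 * exp (- 2 * T) = 1\<close>.\<close>

lemma heat_maximal_test_fun:
  obtains C :: real where "0 < C"
    "\<And>X. exp 4 \<le> X \<Longrightarrow> (\<integral>\<^sup>+x. heat_maximal (test_fun X) x \<partial>rho) \<le> ennreal (C * sqrt (ln X))"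
proof -
  obtain C1 where C1: "0 < C1" and core_bd: "\<And>L T D. 1 \<le> D \<Longrightarrow> \<forall>x\<in>core L T. hyp_dist x gone \<le> D
      \<Longrightarrow> (\<integral>\<^sup>+x. heat_maximal (\<lambda>z. complex_of_real (bump 0 z)) x * indicator (core L T) x \<partial>rho) \<le> ennreal (C1 * sqrt D)"
    by (rule heat_maximal_bump_core) (rule that)
  define K where "K = (5 * 10 ^ 9 * pi + 6912 * pi * 165 + 6912 * 32 * pi) * (2 * small_mass)"
  have K: "0 < K" using small_mass_pos by (simp add: K_def add_pos_pos)
  have main: "(\<integral>\<^sup>+x. heat_maximal (test_fun X) x \<partial>rho) \<le> ennreal ((K + 8 * C1) * sqrt (ln X))" if X: "exp 4 \<le> X" for X
  proof -
    have X5: "5 \<le> X" using X exp_ge_add_one_self[of 4] by simp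
    have lX: "4 \<le> ln X" using X X5 by (subst ln_ge_iff) auto
    define L where "L = 4 * X"
    define T where "T = ln L"
    have L: "exp 4 \<le> L" "0 < L" using X X5 by (auto simp: L_def)
    have T: "4 \<le> T" using L by (simp add: T_def ln_ge_iff)
    let ?f = "test_fun X" and ?g = "\<lambda>z. complex_of_real (bump 0 z)" and ?k = "\<lambda>z. complex_of_real (bump X z)"
    let ?c = "(X, 0, 1) :: pt"
    have gi: "integrable rho ?g" "integrable rho ?k" using integrable_bump by (auto intro: integrable_of_real)
    have mg [measurable]: "heat_maximal ?g \<in> borel_measurable rho" "heat_maximal ?k \<in> borel_measurable rho"
      using gi by (auto intro: heat_maximal_measurable)
    note [measurable] = core_measurable
    define I where "I = (\<integral>\<^sup>+x. heat_maximal ?g x * indicator (core (8 * X) T) x \<partial>rho)"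
    have I: "I \<le> ennreal (C1 * sqrt (10 * ln X))"
      unfolding I_def T_def L_def using lX core_hyp_dist_le[OF X] by (intro core_bd) auto
    have sub: "core L T \<subseteq> core (8 * X) T"
    proof -
      have "64 * L\<^sup>2 \<le> 64 * (8 * X)\<^sup>2" using X5 unfolding L_def by (intro mult_left_mono power_mono) auto
      then show ?thesis by (auto simp: core_def)
    qed
    \<comment> \<open>Recentring the second bump moves the cylinder of radius
      \<open>8 L = 32 X\<close> by \<open>X\<close>; the cylinder of radius \<open>64 X\<close>
      contains the result.\<close>
    have shift: "x \<in> core (8 * X) T" if "?c \<cdot> x \<in> core L T" "x \<in> G" for x
    proof -
      obtain x1 x2 b where xe: "x = (x1, x2, b)" by (metis surj_pair)
      have 1: "(X + x1)\<^sup>2 + x2\<^sup>2 \<le> 64 * L\<^sup>2" "\<bar>ln b\<bar> \<le> T" using that by (auto simp: xe core_def horiz_norm_sq_def height_def)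
      have "x1\<^sup>2 \<le> 2 * (X + x1)\<^sup>2 + 2 * X\<^sup>2"
        using zero_le_power2[of "2 * X + x1"] by (simp add: power2_eq_square algebra_simps)
      moreover have "L\<^sup>2 = 16 * X\<^sup>2" "(8 * X)\<^sup>2 = 64 * X\<^sup>2" by (simp_all add: L_def power_mult_distrib)
      ultimately have "x1\<^sup>2 + x2\<^sup>2 \<le> 64 * (8 * X)\<^sup>2"
        using 1(1) zero_le_power2[of x2] zero_le_power2[of X] by argo
      then show ?thesis using 1 that by (simp add: xe core_def horiz_norm_sq_def height_def)
    qed
    have "(\<integral>\<^sup>+x. heat_maximal ?f x * indicator (core L T) x \<partial>rho)
        \<le> (\<integral>\<^sup>+x. heat_maximal ?g x * indicator (core L T) x + heat_maximal ?k x * indicator (core L T) x \<partial>rho)"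
      unfolding test_fun_def[abs_def] distrib_right[symmetric]
      by (intro nn_integral_mono mult_right_mono heat_maximal_diff gi) (auto simp: space_rho)
    also have "\<dots> = (\<integral>\<^sup>+x. heat_maximal ?g x * indicator (core L T) x \<partial>rho) + (\<integral>\<^sup>+x. heat_maximal ?k x * indicator (core L T) x \<partial>rho)"
      by (rule nn_integral_add) measurable
    also have "(\<integral>\<^sup>+x. heat_maximal ?g x * indicator (core L T) x \<partial>rho) \<le> I"
      unfolding I_def using sub by (intro nn_integral_mono mult_left_mono) (auto simp: indicator_def)
    also have "(\<integral>\<^sup>+x. heat_maximal ?k x * indicator (core L T) x \<partial>rho) \<le> I"
    proof -
      have "(\<integral>\<^sup>+x. heat_maximal ?k x * indicator (core L T) x \<partial>rho)
          = (\<integral>\<^sup>+x. heat_maximal ?k (?c \<cdot> x) * indicator (core L T) (?c \<cdot> x) \<partial>rho)"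
        by (subst nn_integral_left_translate[OF shift_G[of X]]) (measurable, simp add: height_def)
      also have "\<dots> \<le> I"
        unfolding I_def heat_maximal_translate bump_shift
        using shift by (intro nn_integral_mono mult_left_mono) (auto simp: indicator_def space_rho)
      finally show ?thesis .
    qed
    finally have core_part: "(\<integral>\<^sup>+x. heat_maximal ?f x * indicator (core L T) x \<partial>rho) \<le> I + I"
      by (simp add: add_mono)
    have "(\<integral>\<^sup>+x. heat_maximal ?f x * indicator (- core L T) x \<partial>rho)
      \<le> ennreal (5 * 10 ^ 9 * pi + 6912 * pi * ln (1 + 324 * L\<^sup>2 * exp (2 * 1)) / T + 6912 * 32 * pi * L\<^sup>2 * exp (- 2 * T))
        * (\<integral>\<^sup>+z. ennreal (cmod (?f z)) \<partial>rho)"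
    proof (rule heat_maximal_off_core[OF integrable_test_fun integral_test_fun])
      show "AE z in rho. test_fun X z \<noteq> 0 \<longrightarrow> z \<in> box_at_one L 1" unfolding L_def using X5 by (intro test_fun_box_at_one) auto
      have "exp (2 * 1) \<le> exp (4 :: real)" by simp
      then show "exp (2 * 1) \<le> L" using L by linarith
    qed (use T in auto)
    also have "\<dots> \<le> ennreal (5 * 10 ^ 9 * pi + 6912 * pi * 165 + 6912 * 32 * pi) * ennreal (2 * small_mass)"
    proof (rule mult_mono[OF ennreal_leI test_fun_norm])
      have e2: "1 \<le> L\<^sup>2 * exp 2"
      proof -
        have "1 \<le> L" using L exp_ge_add_one_self[of 4] by simp
        then have "1 * 1 \<le> L\<^sup>2 * exp 2" by (intro mult_mono) auto
        then show ?thesis by simp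
      qed
      have "ln (1 + 324 * L\<^sup>2 * exp (2 * 1)) \<le> ln (325 * (L\<^sup>2 * exp 2))"
        using e2 by (subst ln_le_cancel_iff) (auto simp: mult_ac intro!: add_pos_nonneg)
      also have "\<dots> = ln 325 + 2 * T + 2"
        using L by (simp add: ln_mult ln_realpow T_def)
      also have "\<dots> \<le> 324 + 2 * T + 2" using ln_le_minus_one[of 325] by simp
      also have "\<dots> \<le> 165 * T" using T by simp
      finally have "6912 * pi * ln (1 + 324 * L\<^sup>2 * exp (2 * 1)) / T \<le> 6912 * pi * (165 * T) / T"
        using T by (intro divide_right_mono mult_left_mono) auto
      also have "\<dots> = 6912 * pi * 165" using T by simp
      finally have 1: "6912 * pi * ln (1 + 324 * L\<^sup>2 * exp (2 * 1)) / T \<le> 6912 * pi * 165" .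
      have "L\<^sup>2 * exp (- 2 * T) = 1"
        using L by (simp add: T_def exp_minus exp_of_nat_mult[of 2, simplified])
      then have "6912 * 32 * pi * L\<^sup>2 * exp (- 2 * T) = 6912 * 32 * pi" by (simp only: mult.assoc mult_1_right)
      with 1 show "5 * 10 ^ 9 * pi + 6912 * pi * ln (1 + 324 * L\<^sup>2 * exp (2 * 1)) / T + 6912 * 32 * pi * L\<^sup>2 * exp (- 2 * T)
        \<le> 5 * 10 ^ 9 * pi + 6912 * pi * 165 + 6912 * 32 * pi"
        by (intro add_mono) (simp_all only: order_refl)
    qed auto
    also have "\<dots> = ennreal K" unfolding K_def using small_mass_pos by (intro ennreal_mult''[symmetric]) auto
    finally have off: "(\<integral>\<^sup>+x. heat_maximal ?f x * indicator (- core L T) x \<partial>rho) \<le> ennreal K" .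
    have "(\<integral>\<^sup>+x. heat_maximal ?f x \<partial>rho) = (\<integral>\<^sup>+x. heat_maximal ?f x * indicator (core L T) x \<partial>rho)
       + (\<integral>\<^sup>+x. heat_maximal ?f x * indicator (- core L T) x \<partial>rho)"
      by (rule nn_integral_split_set[OF heat_maximal_measurable[OF integrable_test_fun] core_measurable])
    also have "\<dots> \<le> (ennreal (C1 * sqrt (10 * ln X)) + ennreal (C1 * sqrt (10 * ln X))) + ennreal K"
      using core_part off I by (intro add_mono order_trans[OF core_part]) auto
    also have "\<dots> = ennreal (2 * C1 * sqrt (10 * ln X) + K)"
      using C1 K lX by (simp flip: ennreal_plus)
    also have "\<dots> \<le> ennreal ((K + 8 * C1) * sqrt (ln X))"
    proof (rule ennreal_leI)
      have "sqrt 10 \<le> 4" by (intro real_le_lsqrt) auto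
      then have "2 * C1 * (sqrt 10 * sqrt (ln X)) \<le> 2 * C1 * (4 * sqrt (ln X))"
        using C1 lX by (intro mult_left_mono mult_right_mono) auto
      moreover have "K * 1 \<le> K * sqrt (ln X)" using K lX by (intro mult_left_mono) auto
      ultimately show "2 * C1 * sqrt (10 * ln X) + K \<le> (K + 8 * C1) * sqrt (ln X)"
        by (simp add: real_sqrt_mult algebra_simps)
    qed
    finally show ?thesis .
  qed
  show thesis
  proof (rule that)
    show "0 < K + 8 * C1" using K C1 by simp
  qed (rule main)
qed

lemma H1_norm_not_bounded:
  "\<not> (\<exists>C::real. C > 0 \<and> (\<forall>f\<in>H1. ennreal (H1_norm f) \<le> ennreal C * L1_norm (heat_maximal f)))"
proof
  assume "\<exists>C::real. C > 0 \<and> (\<forall>f\<in>H1. ennreal (H1_norm f) \<le> ennreal C * L1_norm (heat_maximal f))"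
  then obtain C where C: "0 < C" "\<And>f. f \<in> H1 \<Longrightarrow> ennreal (H1_norm f) \<le> ennreal C * L1_norm (heat_maximal f)" by blast
  obtain C' where C': "0 < C'" "\<And>X. exp 4 \<le> X \<Longrightarrow> (\<integral>\<^sup>+x. heat_maximal (test_fun X) x \<partial>rho) \<le> ennreal (C' * sqrt (ln X))"
    by (rule heat_maximal_test_fun) (rule that)
  define K where "K = 4 * (C * C') / small_mass"
  have K: "0 < K" using C C' small_mass_pos by (simp add: K_def)
  \<comment> \<open>\<open>s\<close> plays the role of \<open>sqrt (ln X)\<close>; the inequality
    \<open>s^2 - 1 <= K * s\<close> forced by the assumption fails for
    \<open>s = K + 2\<close>.\<close>
  define s where "s = K + 2"
  define X where "X = exp (s\<^sup>2)"
  have "2\<^sup>2 \<le> s\<^sup>2" using K by (intro power_mono) (auto simp: s_def)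
  then have X: "exp 4 \<le> X" by (simp add: X_def)
  have "ennreal (H1_norm (test_fun X)) \<le> ennreal C * ennreal (C' * sqrt (ln X))"
    using C(2)[OF test_fun_H1[OF X]] C'(2)[OF X] unfolding L1_norm_def
    by (meson mult_left_mono order_trans zero_le)
  also have "\<dots> = ennreal (C * (C' * s))"
    using C C' K by (simp add: X_def s_def ennreal_mult)
  finally have "H1_norm (test_fun X) \<le> C * (C' * s)"
    using C C' K by (subst (asm) ennreal_le_iff) (auto simp: s_def)
  then have "small_mass * (s\<^sup>2 - 1) / 4 \<le> C * (C' * s)"
    using test_fun_H1_norm[OF X] by (simp add: X_def)
  then have "small_mass * (s\<^sup>2 - 1) \<le> small_mass * (K * s)"
    using small_mass_pos by (simp add: K_def)
  then have "s\<^sup>2 - 1 \<le> K * s" using small_mass_pos by simp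
  then show False using K by (simp add: s_def power2_eq_square algebra_simps)
qed

section \<open>A superposition of test functions outside the Hardy space\<close>

lemma summable_third: "summable (\<lambda>k. (1 / 3 :: real) ^ k)" "(\<Sum>k<n. (1 / 3 :: real) ^ k) \<le> 2"
proof -
  show "summable (\<lambda>k. (1 / 3 :: real) ^ k)" by (rule summable_geometric) simp
  then have "(\<Sum>k<n. (1 / 3 :: real) ^ k) \<le> (\<Sum>k. (1 / 3 :: real) ^ k)" by (intro sum_le_suminf) auto
  also have "\<dots> \<le> 2" by (subst suminf_geometric) auto
  finally show "(\<Sum>k<n. (1 / 3 :: real) ^ k) \<le> 2" .
qed

text \<open>The separations satisfy \<open>ln (X k) = 4 ^ (k + 1)\<close> and the weights are \<open>3 ^ -k\<close>: the maximal functions then have norms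
  \<open>O((2/3) ^ k)\<close>, while the pairings with \<open>log_bmo\<close> grow like \<open>(4/3) ^ k\<close> and all have the same sign up to \<open>O(3 ^ -k)\<close>.\<close>

lemma integrable_maximal_not_H1: "\<exists>f. integrable rho f \<and> in_L1 (heat_maximal f) \<and> f \<notin> H1"
proof -
  obtain C where C: "0 < C" "\<And>X. exp 4 \<le> X \<Longrightarrow> (\<integral>\<^sup>+x. heat_maximal (test_fun X) x \<partial>rho) \<le> ennreal (C * sqrt (ln X))"
    by (rule heat_maximal_test_fun) (rule that)
  define X where "X k = exp (4 ^ Suc k :: real)" for k :: nat
  have p4: "(4 :: real) \<le> 4 ^ Suc k" for k by simp
  have X: "exp 4 \<le> X k" "1 \<le> X k" "ln (X k) = 4 ^ Suc k" for k
    using p4[of k] by (simp_all add: X_def)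
  define g where "g k z = complex_of_real ((1/3) ^ k) * test_fun (X k) z" for k z
  have gi: "integrable rho (g k)" for k unfolding g_def using integrable_test_fun by simp
  have gle: "cmod (g k z) \<le> (1/3) ^ k" for k z
    unfolding g_def norm_mult using mult_left_mono[OF test_fun_le[of "X k" z], of "(1/3) ^ k"] by (simp add: norm_power norm_divide)
  have sg: "summable (\<lambda>k. cmod (g k z))" for z
    by (rule summable_comparison_test'[OF summable_third(1), of 0]) (use gle in auto)
  \<comment> \<open>An integrable majorant of all tails of the series, for dominated
    convergence.\<close>
  define w where "w z = (\<Sum>k. cmod (g k z))" for z
  define f where "f z = (\<Sum>k. g k z)" for z
  have gn: "(\<integral>z. cmod (g k z) \<partial>rho) \<le> (1/3) ^ k * (2 * small_mass)" for k
  proof -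
    have "ennreal (\<integral>z. cmod (g k z) \<partial>rho) = (\<integral>\<^sup>+z. ennreal (cmod (g k z)) \<partial>rho)"
      using gi by (intro nn_integral_eq_integral[symmetric]) auto
    also have "\<dots> = (\<integral>\<^sup>+z. ennreal ((1/3) ^ k) * ennreal (cmod (test_fun (X k) z)) \<partial>rho)"
      by (intro nn_integral_cong) (simp add: g_def norm_mult norm_power norm_divide ennreal_mult)
    also have "\<dots> = ennreal ((1/3) ^ k) * (\<integral>\<^sup>+z. ennreal (cmod (test_fun (X k) z)) \<partial>rho)"
      using integrable_test_fun by (intro nn_integral_cmult) auto
    also have "\<dots> \<le> ennreal ((1/3) ^ k) * ennreal (2 * small_mass)"
      using test_fun_norm by (intro mult_left_mono) auto
    also have "\<dots> = ennreal ((1/3) ^ k * (2 * small_mass))" using small_mass_pos by (intro ennreal_mult[symmetric]) auto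
    finally show ?thesis using small_mass_pos by (subst (asm) ennreal_le_iff) auto
  qed
  have sgn: "summable (\<lambda>k. \<integral>z. cmod (g k z) \<partial>rho)"
    by (rule summable_comparison_test'[OF summable_mult2[OF summable_third(1), of "2 * small_mass"], of 0]) (use gn in auto)
  have wi: "integrable rho w" unfolding w_def
  proof (rule integrable_suminf)
    show "integrable rho (\<lambda>z. cmod (g k z))" for k using gi by simp
  qed (use sg sgn in auto)
  have fi: "integrable rho f" unfolding f_def
    by (rule integrable_suminf) (use gi sg sgn in auto)
  have lim: "(\<lambda>n. \<integral>z. cmod (f z - (\<Sum>j<n. g j z)) \<partial>rho) \<longlonglongrightarrow> 0"
  proof -
    have "(\<lambda>n. \<integral>z. cmod (f z - (\<Sum>j<n. g j z)) \<partial>rho) \<longlonglongrightarrow> (\<integral>z. 0 \<partial>rho)"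
    proof (rule integral_dominated_convergence[OF _ _ wi])
      show "AE z in rho. (\<lambda>n. cmod (f z - (\<Sum>j<n. g j z))) \<longlonglongrightarrow> 0"
      proof (rule AE_I2)
        fix z
        have "(\<lambda>n. \<Sum>j<n. g j z) \<longlonglongrightarrow> f z" unfolding f_def by (intro summable_LIMSEQ summable_norm_cancel[OF sg])
        from tendsto_norm[OF tendsto_diff[OF tendsto_const[of "f z"] this]]
        show "(\<lambda>n. cmod (f z - (\<Sum>j<n. g j z))) \<longlonglongrightarrow> 0" by simp
      qed
      show "AE z in rho. norm (cmod (f z - (\<Sum>j<n. g j z))) \<le> w z" for n
      proof (rule AE_I2)
        fix z
        have "f z - (\<Sum>j<n. g j z) = (\<Sum>j. g (j + n) z)"
          unfolding f_def using suminf_split_initial_segment[OF summable_norm_cancel[OF sg], of z n] by simp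
        then have "cmod (f z - (\<Sum>j<n. g j z)) \<le> (\<Sum>j. cmod (g (j + n) z))"
          using summable_norm[of "\<lambda>j. g (j + n) z"] sg[of z] by (simp add: summable_iff_shift[of "\<lambda>j. cmod (g j z)" n])
        also have "\<dots> \<le> w z"
          unfolding w_def using suminf_split_initial_segment[OF sg, of z n] by (simp add: sum_nonneg)
        finally show "norm (cmod (f z - (\<Sum>j<n. g j z))) \<le> w z" by simp
      qed
    qed (use fi gi in auto)
    then show ?thesis by simp
  qed
  have Mf: "(\<integral>\<^sup>+x. heat_maximal f x \<partial>rho) < \<infinity>"
  proof -
    have "(\<integral>\<^sup>+x. heat_maximal f x \<partial>rho) \<le> (\<integral>\<^sup>+x. (\<Sum>k. heat_maximal (g k) x) \<partial>rho)"
      by (intro nn_integral_mono heat_maximal_series[OF fi gi _ lim]) (simp add: space_rho)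
    also have "\<dots> = (\<Sum>k. \<integral>\<^sup>+x. heat_maximal (g k) x \<partial>rho)"
      by (intro nn_integral_suminf heat_maximal_measurable gi)
    also have "\<dots> \<le> (\<Sum>k. ennreal (2 * C * (2/3) ^ k))"
    proof (intro suminf_le)
      fix k
      have "(\<integral>\<^sup>+x. heat_maximal (g k) x \<partial>rho) = (\<integral>\<^sup>+x. ennreal ((1/3) ^ k) * heat_maximal (test_fun (X k)) x \<partial>rho)"
        unfolding g_def using heat_maximal_cmult[OF integrable_test_fun]
        by (intro nn_integral_cong) (simp add: space_rho norm_power norm_divide)
      also have "\<dots> = ennreal ((1/3) ^ k) * (\<integral>\<^sup>+x. heat_maximal (test_fun (X k)) x \<partial>rho)"
        by (intro nn_integral_cmult heat_maximal_measurable integrable_test_fun)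
      also have "\<dots> \<le> ennreal ((1/3) ^ k) * ennreal (C * sqrt (ln (X k)))"
        by (intro mult_left_mono C X) auto
      also have "sqrt (ln (X k)) = 2 ^ Suc k"
      proof -
        have "(4 :: real) ^ Suc k = (2 ^ Suc k)\<^sup>2" by (simp flip: power_mult power_mult_distrib add: power2_eq_square)
        then show ?thesis unfolding X(3) by (simp only: real_sqrt_abs) simp
      qed
      also have "ennreal ((1/3) ^ k) * ennreal (C * 2 ^ Suc k) = ennreal (2 * C * (2/3) ^ k)"
        using C by (subst ennreal_mult[symmetric]) (auto simp: power_divide)
      finally show "(\<integral>\<^sup>+x. heat_maximal (g k) x \<partial>rho) \<le> ennreal (2 * C * (2/3) ^ k)" .
    qed auto
    also have "\<dots> = ennreal (\<Sum>k. 2 * C * (2/3) ^ k)"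
      using C by (intro suminf_ennreal2 summable_mult summable_geometric) auto
    also have "\<dots> < \<infinity>" by simp
    finally show ?thesis .
  qed
  have "f \<notin> H1"
  proof
    assume "f \<in> H1"
    then obtain l A where d: "atomic_decomposition f l A" by (auto simp: H1_def)
    define S where "S = (\<Sum>j. cmod (l j))"
    have bd: "small_mass * (4 * (4/3) ^ k - 2) \<le> 4 * S" for k
    proof -
      \<comment> \<open>Truncating at \<open>ln (X k)\<close> lets term \<open>k\<close> contribute
        \<open>3^-k * 4^(k+1) = 4 * (4/3)^k\<close>. Every other term is bounded below only by
        \<open>- 3^-j\<close>, which the sum bound \<open>2\<close> collects.\<close>
      define N :: real where "N = 4 ^ Suc k"
      have N: "0 \<le> N" by (simp add: N_def)
      have "\<forall>j. \<exists>y. (\<integral>z. test_fun (X j) z * complex_of_real (log_bmo N z) \<partial>rho) = - complex_of_real y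
        \<and> small_mass * (min (ln (X j)) N - 1) \<le> y"
        using test_fun_log_bmo[OF X(2) N] by metis
      then obtain y where y: "\<And>j. (\<integral>z. test_fun (X j) z * complex_of_real (log_bmo N z) \<partial>rho) = - complex_of_real (y j)"
        "\<And>j. small_mass * (min (4 ^ Suc j) N - 1) \<le> y j"
        unfolding X(3) by metis
      have gy: "(\<integral>z. g j z * complex_of_real (log_bmo N z) \<partial>rho) = - complex_of_real ((1/3) ^ j * y j)" for j
        unfolding g_def by (simp add: mult.assoc y(1))
      have tend: "(\<lambda>n. cmod (\<Sum>j<n. - complex_of_real ((1/3) ^ j * y j)))
          \<longlonglongrightarrow> cmod (\<integral>z. f z * complex_of_real (log_bmo N z) \<partial>rho)"
        using tendsto_norm[OF L1_limit_log_bmo[OF fi gi N lim]] unfolding gy .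
      have low: "small_mass * (4 * (4/3) ^ k - 2) \<le> cmod (\<Sum>j<n. - complex_of_real ((1/3) ^ j * y j))" if n: "k < n" for n
      proof -
        have yj: "(1/3) ^ j * (small_mass * ((if j = k then N else 0) - 1)) \<le> (1/3) ^ j * y j" for j
        proof (intro mult_left_mono order_trans[OF _ y(2)[of j]])
          show "(if j = k then N else 0) - 1 \<le> min (4 ^ Suc j) N - 1" using N by (auto simp: N_def)
        qed (use small_mass_pos in auto)
        have "(\<Sum>j<n. (1/3) ^ j * (small_mass * ((if j = k then N else 0) - 1))) = small_mass * ((1/3) ^ k * N) - small_mass * (\<Sum>j<n. (1/3) ^ j)"
        proof -
          have "(\<Sum>j<n. (1/3) ^ j * (small_mass * ((if j = k then N else 0) - 1)))
            = (\<Sum>j<n. (if j = k then small_mass * ((1/3) ^ j * N) else 0) - small_mass * (1/3) ^ j)"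
            by (intro sum.cong) (auto simp: algebra_simps)
          also have "\<dots> = small_mass * ((1/3) ^ k * N) - small_mass * (\<Sum>j<n. (1/3) ^ j)"
            using n by (simp add: sum_subtractf sum_distrib_left)
          finally show ?thesis .
        qed
        moreover have "(1/3) ^ k * N = 4 * (4/3) ^ k" by (simp add: N_def power_divide)
        moreover have "small_mass * (\<Sum>j<n. (1/3) ^ j) \<le> small_mass * 2"
          using summable_third(2)[of n] small_mass_pos by (intro mult_left_mono) auto
        moreover have "(\<Sum>j<n. (1/3) ^ j * (small_mass * ((if j = k then N else 0) - 1))) \<le> (\<Sum>j<n. (1/3) ^ j * y j)"
          by (intro sum_mono yj)
        ultimately have "small_mass * (4 * (4/3) ^ k - 2) \<le> (\<Sum>j<n. (1/3) ^ j * y j)"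
          by (simp add: right_diff_distrib)
        also have "\<dots> \<le> \<bar>\<Sum>j<n. (1/3) ^ j * y j\<bar>" by simp
        also have "\<dots> = cmod (\<Sum>j<n. - complex_of_real ((1/3) ^ j * y j))"
          by (simp only: sum_negf norm_minus_cancel of_real_sum[symmetric] norm_of_real)
        finally show ?thesis .
      qed
      have "small_mass * (4 * (4/3) ^ k - 2) \<le> cmod (\<integral>z. f z * complex_of_real (log_bmo N z) \<partial>rho)"
        using low by (intro LIMSEQ_le_const[OF tend]) (auto intro!: exI[of _ "Suc k"])
      also have "\<dots> \<le> 4 * S" unfolding S_def by (rule decomposition_log_bmo[OF fi d N])
      finally show ?thesis .
    qed
    obtain k where "4 * S / small_mass + 2 < (4/3) ^ k" using real_arch_pow[of "4/3" "4 * S / small_mass + 2"] by auto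
    then have "4 * S / small_mass < 4 * (4/3) ^ k - 2" using zero_le_power[of "4/3::real" k] by linarith
    then have "4 * S < small_mass * (4 * (4/3) ^ k - 2)" using small_mass_pos by (simp add: divide_less_eq mult.commute)
    with bd[of k] show False by simp
  qed
  moreover have "in_L1 (heat_maximal f)"
    unfolding in_L1_def L1_norm_def using Mf heat_maximal_measurable[OF fi] by simp
  ultimately show ?thesis using fi by blast
qed

theorem theorem1p3:
  shows "(\<exists>C::real. C > 0 \<and>
            (\<forall>f\<in>H1. in_L1 (heat_maximal f) \<and>
                     L1_norm (heat_maximal f) \<le> ennreal (C * H1_norm f)))
       \<and> \<not> (\<exists>C::real. C > 0 \<and>
            (\<forall>f\<in>H1. ennreal (H1_norm f) \<le> ennreal C * L1_norm (heat_maximal f)))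
       \<and> (\<exists>f. integrable rho f \<and> in_L1 (heat_maximal f) \<and> f \<notin> H1)"
  using H1_heat_maximal H1_norm_not_bounded integrable_maximal_not_H1 by metis

end
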